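(* Let $E$ be a topological space with Borel $\sigma$-field $\mathcal{B}(E)$, $\gamma$ a (nonnegative measure) kernel on $E$, $f:[0,1]\times E^2\to[0,\infty)$ measurable, and let $Q_u(x,A)=\int_Af(u,x,y)\gamma(x,dy)$, $u\in[0,1]$, be Markov kernels on $E$, each with a unique invariant probability measure $\pi_u$. Let $\{X_{n,t}:1\le t\le n,n\ge1\}$ be a triangular array of Markov chains with $X_{n,0}\sim\pi_0$ and $\mathbb{P}(X_{n,t}\in A\mid X_{n,t-1}=x)=Q_{t/n}(x,A)$ for $1\le t\le n$. Let $\phi:E\to[1,\infty)$ be measurable and assume: (SC1) There exist an integer $m\ge1$, real numbers $d_0\ge1$, $\epsilon>0$, $K>0$, $\lambda\in(0,1)$, $b>0$, a family $\{\eta_r:r>0\}$ of positive real numbers and a family $\{\nu_r:r>0\}$ of probability measures on $E$ such that, for all $r>0$ and all $(u_1,\ldots,u_m)\in[0,1]^m$ with $|u_i-u_j|<\epsilon$ for $1\le i,j\le m$, the kernel $P=Q_{u_1}Q_{u_2}\cdots Q_{u_m}$ satisfies $P\phi^{d_0}\le\lambda\phi^{d_0}+b$ and $P(x,A)\ge\eta_r\nu_r(A)$ for all $A\in\mathcal{B}(E)$ and all $x$ with $\phi(x)^{d_0}\le r$. Moreover $Q_u\phi^{d_0}\le K\phi^{d_0}$ for all $u\in[0,1]$. (SC2) There is an integer $k\ge1$ such that for all $(x,y)\in E^2$ the function $u\mapsto f(u,x,y)$ is $k$-times continuously differentiable, with $\ell$-th derivative denoted $\partial_1^{(\ell)}f$.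 (SC3) There exist real numbers $d_1>0$, $q\ge0$ and $C>0$ such that $d_1+kq\le d_0$ and, for all $1\le\ell\le k$, all $0\le d\le d_1+(k-\ell)q$, all $u\in[0,1]$ and $x\in E$, $$\int\phi^d(y)\,|\partial_1^{(\ell)}f(u,x,y)|\,\gamma(x,dy)\le C\phi^{d+q\ell}(x).$$ Moreover, for $s=0,\ldots,k$, $u\in[0,1]$ and $x\in E$, $$\lim_{h\to0}\int\phi^{d_1+qs}(y)\,|\partial_1^{(k-s)}f(u+h,x,y)-\partial_1^{(k-s)}f(u,x,y)|\,\gamma(x,dy)=0.$$ Set $V_0=\phi^{d_1}$. Then the triangular array $\{X_{n,t}\}$ is $V_0$-locally stationary, and for every integer $j\ge1$ the map $u\mapsto\pi_{u,j}$ from $[0,1]$ to $\mathcal{M}_{V_0}(E^j)$ is $k$-times continuously differentiable.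
   Context: For a Markov kernel $P$ and $g\ge0$ measurable, $Pg(x)=\int P(x,dy)g(y)$. For measurable $V:E\to[1,\infty)$ and $j\ge1$, $\mathcal{M}_V(E^j)$ is the Banach space of signed measures $\mu$ on $E^j$ with $\|\mu\|_V:=\sup\{\int g\,d\mu: g \text{ measurable},\ |g(x_1,\ldots,x_j)|\le V(x_1)+\cdots+V(x_j)\}<\infty$. $\pi_{u,j}$ is the law of $(X_1(u),\ldots,X_j(u))$ where $(X_t(u))_{t\in\mathbb{Z}}$ is a stationary Markov chain with kernel $Q_u$, i.e. $\pi_{u,j}(dx_1,\ldots,dx_j)=\pi_u(dx_1)Q_u(x_1,dx_2)\cdots Q_u(x_{j-1},dx_j)$. $\pi^{(n)}_{t,j}$ is the law of $(X_{n,t},\ldots,X_{n,t+j-1})$. The array is called $V$-locally stationary if for every integer $j\ge1$ there is $C_j>0$, not depending on $u,n,t$, such that $\|\pi^{(n)}_{t,j}-\pi_{u,j}\|_V\le C_j\left[|u-\frac tn|+\frac1n\right]$ for all $u\in[0,1]$, $n\ge1$ and $1\le t\le n-j+1$. Derivatives and limits at the endpoints of $[0,1]$ are one-sided. *)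

theory Defs
  imports "HOL-Probability.Probability"
begin

section \<open>Kernels\<close>

text \<open>The measures \<open>\<gamma> x\<close> need not be finite, so \<open>\<gamma>\<close> is in general not a
  measurable map into \<^const>\<open>subprob_algebra\<close>. Markov kernels on \<open>E\<close> are elements of
  \<open>borel \<rightarrow>\<^sub>M prob_algebra borel\<close>.\<close>

definition measure_kernel :: "'a measure \<Rightarrow> 'b measure \<Rightarrow> ('a \<Rightarrow> 'b measure) \<Rightarrow> bool" where
  "measure_kernel M N \<gamma> \<longleftrightarrow>
     (\<forall>x\<in>space M. sets (\<gamma> x) = sets N) \<and>
     (\<forall>A\<in>sets N. (\<lambda>x. emeasure (\<gamma> x) A) \<in> borel_measurable M)"

definition invariant_prob :: "('a::topological_space \<Rightarrow> 'a measure) \<Rightarrow> 'a measure \<Rightarrow> bool" where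
  "invariant_prob \<kappa> \<mu> \<longleftrightarrow> \<mu> \<in> space (prob_algebra borel) \<and> \<mu> \<bind> \<kappa> = \<mu>"

primrec kernel_prod ::
  "('u \<Rightarrow> 'a::topological_space \<Rightarrow> 'a measure) \<Rightarrow> 'u list \<Rightarrow> 'a \<Rightarrow> 'a measure" where
  "kernel_prod Q [] = return borel"
| "kernel_prod Q (u # us) = (\<lambda>x. Q u x \<bind> kernel_prod Q us)"


section \<open>Markov chains and their finite-dimensional laws\<close>

text \<open>\<open>E\<^sup>j\<close> carries the product \<open>\<sigma>\<close>-algebra; its coordinates are indexed by \<open>0, \<dots>, j - 1\<close>.\<close>

abbreviation pow_space :: "nat \<Rightarrow> (nat \<Rightarrow> 'a::topological_space) measure" where
  "pow_space j \<equiv> Pi\<^sub>M {..<j} (\<lambda>_. borel)"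

definition past_algebra ::
  "'w measure \<Rightarrow> (nat \<Rightarrow> 'w \<Rightarrow> 'a::topological_space) \<Rightarrow> nat \<Rightarrow> 'w measure" where
  "past_algebra M Y t = vimage_algebra (space M) (\<lambda>\<omega>. \<lambda>s\<in>{..<t}. Y s \<omega>) (pow_space t)"

text \<open>\<open>\<kappa> t\<close> is the kernel of the transition from time \<open>t - 1\<close> to time \<open>t\<close>.\<close>

definition markov_chain ::
  "'w measure \<Rightarrow> nat \<Rightarrow> (nat \<Rightarrow> 'w \<Rightarrow> 'a::topological_space) \<Rightarrow> 'a measure \<Rightarrow>
   (nat \<Rightarrow> 'a \<Rightarrow> 'a measure) \<Rightarrow> bool" where
  "markov_chain M n Y \<mu> \<kappa> \<longleftrightarrow>
     (\<forall>t\<le>n. Y t \<in> M \<rightarrow>\<^sub>M borel) \<and>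
     distr M borel (Y 0) = \<mu> \<and>
     (\<forall>t\<in>{1..n}. \<forall>A\<in>sets borel. AE \<omega> in M.
        real_cond_exp M (past_algebra M Y t) (indicator (Y t -` A \<inter> space M)) \<omega>
          = measure (\<kappa> t (Y (t - 1) \<omega>)) A)"

definition window_law ::
  "'w measure \<Rightarrow> (nat \<Rightarrow> 'w \<Rightarrow> 'a::topological_space) \<Rightarrow> nat \<Rightarrow> nat \<Rightarrow> (nat \<Rightarrow> 'a) measure" where
  "window_law M Y t j = distr M (pow_space j) (\<lambda>\<omega>. \<lambda>i\<in>{..<j}. Y (t + i) \<omega>)"

text \<open>The measure \<open>\<mu>(dx\<^sub>0) \<kappa>(x\<^sub>0,dx\<^sub>1) \<cdots> \<kappa>(x\<^bsub>j-2\<^esub>,dx\<^bsub>j-1\<^esub>)\<close>.\<close>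

fun path_law ::
  "'a::topological_space measure \<Rightarrow> ('a \<Rightarrow> 'a measure) \<Rightarrow> nat \<Rightarrow> (nat \<Rightarrow> 'a) measure" where
  "path_law \<mu> \<kappa> 0 = return (pow_space 0) (\<lambda>_. undefined)"
| "path_law \<mu> \<kappa> (Suc 0) = distr \<mu> (pow_space (Suc 0)) (\<lambda>x. \<lambda>i\<in>{..<Suc 0}. x)"
| "path_law \<mu> \<kappa> (Suc (Suc j)) =
     path_law \<mu> \<kappa> (Suc j) \<bind>
       (\<lambda>x. distr (\<kappa> (x j)) (pow_space (Suc (Suc j))) (\<lambda>y. x(Suc j := y)))"


section \<open>Spaces of signed measures with a weighted norm\<close>

text \<open>A (finite) signed measure is a real set function vanishing outside \<open>sets M\<close>, the same
  convention as for \<^const>\<open>measure\<close>. Thus \<open>measure N\<close> is the signed measure given by a finite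
  measure \<open>N\<close>, and sums and multiples are formed pointwise.\<close>

definition signed_measure :: "'b measure \<Rightarrow> ('b set \<Rightarrow> real) \<Rightarrow> bool" where
  "signed_measure M \<mu> \<longleftrightarrow>
     (\<forall>A. A \<notin> sets M \<longrightarrow> \<mu> A = 0) \<and> \<mu> {} = 0 \<and>
     (\<forall>A. range A \<subseteq> sets M \<longrightarrow> disjoint_family A \<longrightarrow>
        (\<lambda>i::nat. \<mu> (A i)) sums \<mu> (\<Union>i. A i))"

text \<open>Jordan decomposition: upper and lower variation.\<close>

definition upper_var :: "'b measure \<Rightarrow> ('b set \<Rightarrow> real) \<Rightarrow> 'b measure" where
  "upper_var M \<mu> =
     measure_of (space M) (sets M) (\<lambda>A. SUP B\<in>{B\<in>sets M. B \<subseteq> A}. ennreal (\<mu> B))"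

definition lower_var :: "'b measure \<Rightarrow> ('b set \<Rightarrow> real) \<Rightarrow> 'b measure" where
  "lower_var M \<mu> = upper_var M (\<lambda>A. - \<mu> A)"

definition signed_integral :: "'b measure \<Rightarrow> ('b set \<Rightarrow> real) \<Rightarrow> ('b \<Rightarrow> real) \<Rightarrow> real" where
  "signed_integral M \<mu> g = (\<integral>x. g x \<partial>upper_var M \<mu>) - (\<integral>x. g x \<partial>lower_var M \<mu>)"

text \<open>If \<open>W\<close> is not integrable with respect to the total variation of \<open>\<mu>\<close>, the truncations
  of \<open>W\<close>, signed according to a Hahn decomposition, already make the supremum infinite; hence
  the value 0 of a non-existing Bochner integral does not affect it.\<close>

definition weighted_norm :: "'b measure \<Rightarrow> ('b \<Rightarrow> real) \<Rightarrow> ('b set \<Rightarrow> real) \<Rightarrow> ereal" where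
  "weighted_norm M W \<mu> =
     (SUP g\<in>{g \<in> borel_measurable M. \<forall>x\<in>space M. \<bar>g x\<bar> \<le> W x}. ereal (signed_integral M \<mu> g))"

definition weighted_measures :: "'b measure \<Rightarrow> ('b \<Rightarrow> real) \<Rightarrow> ('b set \<Rightarrow> real) set" where
  "weighted_measures M W = {\<mu>. signed_measure M \<mu> \<and> weighted_norm M W \<mu> < \<infinity>}"

definition sum_weight :: "('a \<Rightarrow> real) \<Rightarrow> nat \<Rightarrow> (nat \<Rightarrow> 'a) \<Rightarrow> real" where
  "sum_weight V j x = (\<Sum>i<j. V (x i))"

text \<open>\<open>k\<close>-times continuous differentiability of a map from \<open>[0,1]\<close> into the normed space
  \<^term>\<open>weighted_measures M W\<close>; \<open>D l\<close> is the derivative of order \<open>l\<close>.\<close>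

definition weighted_C_k ::
  "'b measure \<Rightarrow> ('b \<Rightarrow> real) \<Rightarrow> nat \<Rightarrow> (real \<Rightarrow> 'b set \<Rightarrow> real) \<Rightarrow> bool" where
  "weighted_C_k M W k F \<longleftrightarrow>
     (\<exists>D :: nat \<Rightarrow> real \<Rightarrow> 'b set \<Rightarrow> real.
        (\<forall>u\<in>{0..1}. D 0 u = F u) \<and>
        (\<forall>l\<le>k. \<forall>u\<in>{0..1}. D l u \<in> weighted_measures M W) \<and>
        (\<forall>l<k. \<forall>u\<in>{0..1}.
           ((\<lambda>v. weighted_norm M W (\<lambda>A. (D l v A - D l u A) / (v - u) - D (Suc l) u A)) \<longlongrightarrow> 0)
             (at u within {0..1})) \<and>
        (\<forall>u\<in>{0..1}.
           ((\<lambda>v. weighted_norm M W (\<lambda>A. D k v A - D k u A)) \<longlongrightarrow> 0) (at u within {0..1})))"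


section \<open>Local stationarity\<close>

definition locally_stationary ::
  "('a::topological_space \<Rightarrow> real) \<Rightarrow> 'w measure \<Rightarrow> (nat \<Rightarrow> nat \<Rightarrow> 'w \<Rightarrow> 'a) \<Rightarrow>
   (real \<Rightarrow> nat \<Rightarrow> (nat \<Rightarrow> 'a) measure) \<Rightarrow> bool" where
  "locally_stationary V M X L \<longleftrightarrow>
     (\<forall>j\<ge>1. \<exists>C>0. \<forall>u\<in>{0..1}. \<forall>n\<ge>1. \<forall>t\<ge>1. t + j \<le> n + 1 \<longrightarrow>
        weighted_norm (pow_space j) (sum_weight V j)
            (\<lambda>A. measure (window_law M (X n) t j) A - measure (L u j) A)
          \<le> ereal (C * (\<bar>u - real t / real n\<bar> + 1 / real n)))"

end

theory Submission
  imports Defs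
begin

text \<open>Signed measures are treated as \<open>\<sigma>\<close>-smooth functionals on weighted spaces of functions, and
  kernels as operators on functions. By Harris' theorem \<open>I - Q\<^sub>u\<close> is invertible on the functionals
  of total mass zero, uniformly in \<open>u\<close>. Hence the equation \<open>\<pi>\<^sub>u (I - Q\<^sub>u) = 0\<close> can be
  differentiated \<open>k\<close> times, each derivative of \<open>Q\<^sub>u\<close> costing a factor \<open>\<phi>\<^sup>q\<close> in the weight, and the
  Leibniz rule carries the derivatives over to the laws of paths. Local stationarity follows from
  the contraction over blocks of length \<open>m\<close> and the Lipschitz continuity of \<open>u \<mapsto> \<pi>\<^sub>u\<close>.\<close>

section \<open>Measures as functionals on weighted function spaces\<close>

text \<open>The weighted norm is defined through the Jordan decomposition, which does not respect
  sums or composition with kernels. Functionals add and compose freely, so a Hahn decomposition is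
  needed only once, on the way back to measures. The hypotheses give convergence of the densities
  for each \<open>x\<close> separately, never uniformly in \<open>x\<close>; uniformity over test
  functions must come from domination. The weights are \<open>\<phi> powr (d1 + q * s)\<close> with
  \<open>s = 0, ..., k\<close>, and a derivative of order \<open>l\<close> acts at level
  \<open>s = k - l\<close>. Since \<open>d1 + k * q \<le> d0\<close>, each weight is a power at most
  1 of the Lyapunov function \<open>\<phi> powr d0\<close>; concavity passes the drift on, and
  Harris' contraction holds at every level. The derivatives of \<open>\<pi> u\<close> are not found
  as limits. Candidates are defined by solving the formally differentiated invariance equation with
  a Neumann series. The error of a difference quotient between \<open>u\<close> and \<open>v\<close>
  has mass zero, and applying \<open>I - Q v\<close> to it leaves only terms known to vanish. As
  this operator moves with \<open>v\<close>, the stability constant must not depend on the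
  parameter.\<close>

definition weighted_ball :: "'b measure \<Rightarrow> ('b \<Rightarrow> real) \<Rightarrow> ('b \<Rightarrow> real) set" where
  "weighted_ball M W = {g \<in> borel_measurable M. \<forall>x\<in>space M. \<bar>g x\<bar> \<le> W x}"

definition weighted_fun :: "'b measure \<Rightarrow> ('b \<Rightarrow> real) \<Rightarrow> ('b \<Rightarrow> real) set" where
  "weighted_fun M W = {g \<in> borel_measurable M. \<exists>c. \<forall>x\<in>space M. \<bar>g x\<bar> \<le> c * W x}"

text \<open>The second clause is dominated convergence with majorant \<open>W\<close>; this
  Daniell-type continuity makes the values on indicators countably additive. \<open>T\<close> is a
  total function with no constraint outside \<open>weighted_fun\<close>, which is why membership
  conditions accompany every use of linearity.\<close>

definition weighted_functional :: "'b measure \<Rightarrow> ('b \<Rightarrow> real) \<Rightarrow> (('b \<Rightarrow> real) \<Rightarrow> real) \<Rightarrow> bool" where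
  "weighted_functional M W T \<longleftrightarrow>
     (\<forall>g\<in>weighted_fun M W. \<forall>h\<in>weighted_fun M W. \<forall>a. T (\<lambda>x. a * g x + h x) = a * T g + T h) \<and>
     (\<forall>G g. (\<forall>n. G n \<in> weighted_ball M W) \<longrightarrow> g \<in> borel_measurable M \<longrightarrow>
        (\<forall>x\<in>space M. (\<lambda>n::nat. G n x) \<longlonglongrightarrow> g x) \<longrightarrow> (\<lambda>n. T (G n)) \<longlonglongrightarrow> T g)"

text \<open>An upper bound for the dual norm instead of the norm itself, so that no supremum has to
  be shown finite before it is estimated.\<close>

definition dual_bound :: "'b measure \<Rightarrow> ('b \<Rightarrow> real) \<Rightarrow> (('b \<Rightarrow> real) \<Rightarrow> real) \<Rightarrow> real \<Rightarrow> bool" where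
  "dual_bound M W T c \<longleftrightarrow> (\<forall>g\<in>weighted_ball M W. \<bar>T g\<bar> \<le> c)"

text \<open>Convergence to 0 in the dual norm along a filter. With \<open>at u within {0..1}\<close>
  it becomes one-sided at the endpoints.\<close>

definition dual_vanish ::
  "'v filter \<Rightarrow> 'b measure \<Rightarrow> ('b \<Rightarrow> real) \<Rightarrow> ('v \<Rightarrow> ('b \<Rightarrow> real) \<Rightarrow> real) \<Rightarrow> bool" where
  "dual_vanish F M W S \<longleftrightarrow> (\<forall>e>0. \<forall>\<^sub>F v in F. dual_bound M W (S v) e)"

lemma weighted_ballD:
  assumes "g \<in> weighted_ball M W"
  shows "g \<in> borel_measurable M" "\<And>x. x \<in> space M \<Longrightarrow> \<bar>g x\<bar> \<le> W x"
  using assms by (auto simp: weighted_ball_def)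

lemma weighted_ballI:
  "g \<in> borel_measurable M \<Longrightarrow> (\<And>x. x \<in> space M \<Longrightarrow> \<bar>g x\<bar> \<le> W x) \<Longrightarrow> g \<in> weighted_ball M W"
  by (auto simp: weighted_ball_def)

lemma weighted_funI:
  "g \<in> borel_measurable M \<Longrightarrow> (\<And>x. x \<in> space M \<Longrightarrow> \<bar>g x\<bar> \<le> c * W x) \<Longrightarrow> g \<in> weighted_fun M W"
  by (auto simp: weighted_fun_def)

lemma weighted_fun_measurable: "g \<in> weighted_fun M W \<Longrightarrow> g \<in> borel_measurable M"
  by (auto simp: weighted_fun_def)

lemma weighted_ball_fun: "g \<in> weighted_ball M W \<Longrightarrow> g \<in> weighted_fun M W"
  by (rule weighted_funI[where c=1]) (auto simp: weighted_ball_def)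

lemma weighted_fun_add:
  assumes "g \<in> weighted_fun M W" "h \<in> weighted_fun M W"
  shows "(\<lambda>x. g x + h x) \<in> weighted_fun M W"
proof -
  obtain c d where "\<And>x. x \<in> space M \<Longrightarrow> \<bar>g x\<bar> \<le> c * W x" "\<And>x. x \<in> space M \<Longrightarrow> \<bar>h x\<bar> \<le> d * W x"
    using assms by (auto simp: weighted_fun_def)
  then have "\<bar>g x + h x\<bar> \<le> (c + d) * W x" if "x \<in> space M" for x
    using that by (fastforce simp: algebra_simps intro: order_trans[OF abs_triangle_ineq] add_mono)
  then show ?thesis
    using assms by (intro weighted_funI[where c="c+d"]) (auto simp: weighted_fun_def)
qed

lemma weighted_fun_scale:
  assumes "g \<in> weighted_fun M W"
  shows "(\<lambda>x. a * g x) \<in> weighted_fun M W"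
proof -
  obtain c where "\<And>x. x \<in> space M \<Longrightarrow> \<bar>g x\<bar> \<le> c * W x"
    using assms by (auto simp: weighted_fun_def)
  then have "\<bar>a * g x\<bar> \<le> (\<bar>a\<bar> * c) * W x" if "x \<in> space M" for x
    using that mult_left_mono[of "\<bar>g x\<bar>" "c * W x" "\<bar>a\<bar>"] by (simp add: abs_mult mult.assoc)
  then show ?thesis
    using assms by (intro weighted_funI[where c="\<bar>a\<bar>*c"]) (auto simp: weighted_fun_def)
qed

lemma weighted_fun_diff:
  assumes "g \<in> weighted_fun M W" "h \<in> weighted_fun M W"
  shows "(\<lambda>x. g x - h x) \<in> weighted_fun M W"
  using weighted_fun_add[OF assms(1) weighted_fun_scale[OF assms(2), of "-1"]] by simp

lemma weighted_fun_zero: "(\<lambda>x. 0) \<in> weighted_fun M W"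
  by (rule weighted_funI[where c=0]) auto

lemma weighted_fun_sum:
  "(\<And>i. i \<in> I \<Longrightarrow> G i \<in> weighted_fun M W) \<Longrightarrow> (\<lambda>x. \<Sum>i\<in>I. G i x) \<in> weighted_fun M W"
  by (induction I rule: infinite_finite_induct) (auto intro: weighted_fun_add weighted_fun_zero)

lemma weighted_fun_mono:
  assumes "g \<in> weighted_fun M W'" "\<And>x. x \<in> space M \<Longrightarrow> 0 \<le> W' x"
    "\<And>x. x \<in> space M \<Longrightarrow> W' x \<le> a * W x"
  shows "g \<in> weighted_fun M W"
proof -
  obtain c where c: "\<And>x. x \<in> space M \<Longrightarrow> \<bar>g x\<bar> \<le> c * W' x"
    using assms by (auto simp: weighted_fun_def)
  have "\<bar>g x\<bar> \<le> (\<bar>c\<bar> * a) * W x" if "x \<in> space M" for x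
  proof -
    have "\<bar>g x\<bar> \<le> \<bar>c\<bar> * W' x"
      using c[OF that] assms(2)[OF that] by (meson abs_ge_self mult_right_mono order_trans)
    also have "\<dots> \<le> \<bar>c\<bar> * (a * W x)"
      using assms(3)[OF that] by (intro mult_left_mono) auto
    finally show ?thesis by (simp add: mult.assoc)
  qed
  then show ?thesis
    using assms(1) by (intro weighted_funI[where c="\<bar>c\<bar>*a"]) (auto simp: weighted_fun_def)
qed

lemma weighted_fun_ball:
  assumes "g \<in> weighted_fun M W" "\<And>x. x \<in> space M \<Longrightarrow> 0 \<le> W x"
  obtains c where "c > 0" "(\<lambda>x. g x / c) \<in> weighted_ball M W"
proof -
  obtain c where c: "\<And>x. x \<in> space M \<Longrightarrow> \<bar>g x\<bar> \<le> c * W x"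
    using assms by (auto simp: weighted_fun_def)
  define d where "d = \<bar>c\<bar> + 1"
  have "\<bar>g x / d\<bar> \<le> W x" if "x \<in> space M" for x
  proof -
    have "\<bar>g x\<bar> \<le> d * W x"
      using c[OF that] assms(2)[OF that] by (smt (verit) d_def mult_right_mono)
    then show ?thesis by (simp add: d_def divide_le_eq mult.commute)
  qed
  then show ?thesis
    using assms(1) by (intro that[of d]) (auto simp: d_def weighted_fun_def weighted_ball_def)
qed

lemma functional_linear:
  assumes "weighted_functional M W T" "g \<in> weighted_fun M W" "h \<in> weighted_fun M W"
  shows "T (\<lambda>x. a * g x + h x) = a * T g + T h"
  using assms by (auto simp: weighted_functional_def)

lemma functional_tendsto:
  assumes "weighted_functional M W T" "\<And>n. G n \<in> weighted_ball M W" "g \<in> borel_measurable M"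
    "\<And>x. x \<in> space M \<Longrightarrow> (\<lambda>n. G n x) \<longlonglongrightarrow> g x"
  shows "(\<lambda>n. T (G n)) \<longlonglongrightarrow> T g"
  using assms by (auto simp: weighted_functional_def)

lemma functional_zero:
  assumes "weighted_functional M W T"
  shows "T (\<lambda>x. 0) = 0"
  using functional_linear[OF assms weighted_fun_zero weighted_fun_zero, of 1] by simp

lemma functional_add:
  assumes "weighted_functional M W T" "g \<in> weighted_fun M W" "h \<in> weighted_fun M W"
  shows "T (\<lambda>x. g x + h x) = T g + T h"
  using functional_linear[OF assms, of 1] by simp

lemma functional_scale:
  assumes "weighted_functional M W T" "g \<in> weighted_fun M W"
  shows "T (\<lambda>x. a * g x) = a * T g"
  using functional_linear[OF assms weighted_fun_zero, of a] functional_zero[OF assms(1)] by simp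

lemma functional_diff:
  assumes "weighted_functional M W T" "g \<in> weighted_fun M W" "h \<in> weighted_fun M W"
  shows "T (\<lambda>x. g x - h x) = T g - T h"
  using functional_linear[OF assms(1,3,2), of "-1"] by (simp add: algebra_simps)

lemma functional_sum:
  assumes "weighted_functional M W T" "\<And>i. i \<in> I \<Longrightarrow> G i \<in> weighted_fun M W"
  shows "T (\<lambda>x. \<Sum>i\<in>I. G i x) = (\<Sum>i\<in>I. T (G i))"
  using assms(2)
proof (induction I rule: infinite_finite_induct)
  case (insert i I)
  then show ?case
    using functional_add[OF assms(1), of "G i" "\<lambda>x. \<Sum>i\<in>I. G i x"] by (simp add: weighted_fun_sum)
qed (simp_all add: functional_zero[OF assms(1)])

text \<open>Otherwise rescaled near-maximisers would converge to 0 while their images do not.\<close>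

lemma functional_bounded:
  assumes T: "weighted_functional M W T" and W: "\<And>x. x \<in> space M \<Longrightarrow> 0 \<le> W x"
  obtains c where "c > 0" "dual_bound M W T c"
proof -
  have "\<exists>c>0. dual_bound M W T c"
  proof (rule ccontr)
    assume "\<not> ?thesis"
    then have "\<exists>g\<in>weighted_ball M W. \<bar>T g\<bar> > real (Suc n)" for n
      by (auto simp: dual_bound_def not_le)
    then obtain G where G: "\<And>n. G n \<in> weighted_ball M W" "\<And>n. \<bar>T (G n)\<bar> > real (Suc n)"
      by metis
    have "(\<lambda>n. T (\<lambda>x. (1 / real (Suc n)) * G n x)) \<longlonglongrightarrow> T (\<lambda>x. 0)"
    proof (rule functional_tendsto[OF T])
      fix n show "(\<lambda>x. (1 / real (Suc n)) * G n x) \<in> weighted_ball M W"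
      proof (rule weighted_ballI)
        show "(\<lambda>x. (1 / real (Suc n)) * G n x) \<in> borel_measurable M"
          using G(1)[of n] by (intro borel_measurable_times) (auto simp: weighted_ball_def)
        fix x assume "x \<in> space M"
        then have "\<bar>G n x\<bar> \<le> W x" using G(1)[of n] by (auto simp: weighted_ball_def)
        moreover have "\<bar>1 / real (Suc n) * G n x\<bar> \<le> \<bar>G n x\<bar>"
          using mult_left_mono[of 1 "1 + real n" "\<bar>G n x\<bar>"] by (simp add: abs_mult divide_le_eq)
        ultimately show "\<bar>1 / real (Suc n) * G n x\<bar> \<le> W x" by linarith
      qed
    next
      fix x assume x: "x \<in> space M"
      show "(\<lambda>n. (1 / real (Suc n)) * G n x) \<longlonglongrightarrow> 0"
      proof (rule Lim_null_comparison)
        show "\<forall>\<^sub>F n in sequentially. norm ((1 / real (Suc n)) * G n x) \<le> W x * inverse (real (Suc n))"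
          using G(1) x by (auto simp: weighted_ball_def abs_mult divide_inverse mult.commute
              intro!: always_eventually mult_right_mono)
        show "(\<lambda>n. W x * inverse (real (Suc n))) \<longlonglongrightarrow> 0"
          by (rule tendsto_mult_right_zero[OF LIMSEQ_inverse_real_of_nat])
      qed
    qed auto
    then have "(\<lambda>n. (1 / real (Suc n)) * T (G n)) \<longlonglongrightarrow> 0"
      by (simp only: functional_scale[OF T weighted_ball_fun[OF G(1)]] functional_zero[OF T])
    then have "\<forall>\<^sub>F n in sequentially. \<bar>(1 / real (Suc n)) * T (G n)\<bar> < 1"
      using tendstoD[of _ 0 sequentially 1] by (fastforce simp: dist_real_def)
    then obtain n where "\<bar>(1 / real (Suc n)) * T (G n)\<bar> < 1"
      by (auto simp: eventually_sequentially)
    then have "\<bar>T (G n)\<bar> < real (Suc n)" by (simp add: abs_mult divide_less_eq)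
    then show False using G(2)[of n] by simp
  qed
  then show ?thesis using that by auto
qed

lemma dual_boundD:
  assumes "dual_bound M W T c" "weighted_functional M W T" "g \<in> borel_measurable M" "0 \<le> a"
    "\<And>x. x \<in> space M \<Longrightarrow> \<bar>g x\<bar> \<le> a * W x" "\<And>x. x \<in> space M \<Longrightarrow> 0 \<le> W x"
  shows "\<bar>T g\<bar> \<le> a * c"
proof -
  have g: "g \<in> weighted_fun M W" using assms by (intro weighted_funI)
  have *: "\<bar>T g\<bar> \<le> b * c" if "b > a" for b
  proof -
    have b: "b > 0" using that assms(4) by simp
    have "(\<lambda>x. (1/b) * g x) \<in> weighted_ball M W"
    proof (rule weighted_ballI)
      fix x assume x: "x \<in> space M"
      have "\<bar>g x\<bar> \<le> b * W x"
        using assms(5,6)[OF x] that by (smt (verit) mult_right_mono)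
      then show "\<bar>(1/b) * g x\<bar> \<le> W x" using b by (simp add: abs_mult divide_le_eq mult.commute)
    qed (use assms(3) in auto)
    then have "\<bar>T (\<lambda>x. (1/b) * g x)\<bar> \<le> c" using assms(1) by (auto simp: dual_bound_def)
    then show ?thesis
      using functional_scale[OF assms(2) g, of "1/b"] b by (simp add: abs_mult divide_le_eq mult.commute)
  qed
  \<comment> \<open>\<open>a = 0\<close> is allowed, so the rescaling was done with
    \<open>b > a\<close>, and \<open>b\<close> now decreases to \<open>a\<close>.\<close>
  have "((\<lambda>b. b * c) \<longlongrightarrow> a * c) (at_right a)" by (intro tendsto_intros)
  then show ?thesis
    by (rule tendsto_lowerbound) (auto intro!: * eventually_mono[OF eventually_at_right_less])
qed

text \<open>The ball constrains values on \<open>space M\<close> only. A difference vanishing there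
  stays in the ball under every rescaling, so boundedness forces its image to be 0.\<close>

lemma functional_cong:
  assumes T: "weighted_functional M W T" and g: "g \<in> weighted_fun M W" "h \<in> weighted_fun M W"
    and W: "\<And>x. x \<in> space M \<Longrightarrow> 0 \<le> W x" and eq: "\<And>x. x \<in> space M \<Longrightarrow> g x = h x"
  shows "T g = T h"
proof -
  obtain c where "c > 0" "dual_bound M W T c" using functional_bounded[OF T W] by blast
  then have "\<bar>T (\<lambda>x. g x - h x)\<bar> \<le> 0 * c"
    by (rule_tac dual_boundD[OF _ T])
      (use weighted_fun_measurable[OF weighted_fun_diff[OF g]] eq W in auto)
  then show ?thesis using functional_diff[OF T g] by simp
qed

text \<open>A smaller weight leaves fewer test functions, so the functional restricts. The factor
  \<open>a\<close> is absorbed by scaling sequences with \<open>1/a\<close>, and pointwise limits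
  inherit the bound \<open>W'\<close>.\<close>

lemma functional_mono:
  assumes T: "weighted_functional M W T" and a: "a > 0"
    and W': "\<And>x. x \<in> space M \<Longrightarrow> 0 \<le> W' x"
    and le: "\<And>x. x \<in> space M \<Longrightarrow> W' x \<le> a * W x"
  shows "weighted_functional M W' T"
  unfolding weighted_functional_def
proof (intro conjI ballI allI impI)
  fix g h and b :: real assume "g \<in> weighted_fun M W'" "h \<in> weighted_fun M W'"
  then show "T (\<lambda>x. b * g x + h x) = b * T g + T h"
    by (intro functional_linear[OF T] weighted_fun_mono[OF _ W' le])
next
  fix G :: "nat \<Rightarrow> _" and g
  assume G: "\<forall>n. G n \<in> weighted_ball M W'" and g: "g \<in> borel_measurable M"
    and lim: "\<forall>x\<in>space M. (\<lambda>n. G n x) \<longlonglongrightarrow> g x"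
  have Gf: "G n \<in> weighted_fun M W" for n
    by (rule weighted_fun_mono[OF weighted_ball_fun W' le]) (use G in auto)
  have gb: "\<bar>g x\<bar> \<le> W' x" if "x \<in> space M" for x
    using lim G that
    by (intro tendsto_upperbound[where f="\<lambda>n. \<bar>G n x\<bar>" and F=sequentially])
      (auto simp: weighted_ball_def intro: tendsto_rabs)
  then have gf: "g \<in> weighted_fun M W"
    by (intro weighted_fun_mono[OF weighted_ball_fun W' le] weighted_ballI g) auto
  have "(\<lambda>n. T (\<lambda>x. (1/a) * G n x)) \<longlonglongrightarrow> T (\<lambda>x. (1/a) * g x)"
  proof (rule functional_tendsto[OF T])
    fix n show "(\<lambda>x. (1/a) * G n x) \<in> weighted_ball M W"
    proof (rule weighted_ballI)
      show "(\<lambda>x. (1/a) * G n x) \<in> borel_measurable M"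
        using G by (intro borel_measurable_times) (auto simp: weighted_ball_def)
      fix x assume x: "x \<in> space M"
      then have "\<bar>G n x\<bar> \<le> W' x" using G by (auto simp: weighted_ball_def)
      then have "\<bar>G n x\<bar> \<le> a * W x" using le[OF x] by linarith
      then show "\<bar>(1/a) * G n x\<bar> \<le> W x" using a by (simp add: abs_mult divide_le_eq mult.commute)
    qed
    show "(\<lambda>x. (1/a) * g x) \<in> borel_measurable M" using g by simp
    show "(\<lambda>n. (1/a) * G n x) \<longlonglongrightarrow> (1/a) * g x" if "x \<in> space M" for x
      using tendsto_mult_left[of "\<lambda>n. G n x" "g x" sequentially "1/a"] lim that by blast
  qed
  then have "(\<lambda>n. (1/a) * T (G n)) \<longlonglongrightarrow> (1/a) * T g"
    by (simp only: functional_scale[OF T Gf] functional_scale[OF T gf])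
  from tendsto_mult_left[OF this, of a] show "(\<lambda>n. T (G n)) \<longlonglongrightarrow> T g" using a by simp
qed

lemma functional_lincomb:
  assumes "weighted_functional M W T" "weighted_functional M W S"
  shows "weighted_functional M W (\<lambda>g. a * T g + S g)"
  using assms unfolding weighted_functional_def
  by (auto simp: algebra_simps intro!: tendsto_intros)

lemma functional_null: "weighted_functional M W (\<lambda>g. 0)"
  by (auto simp: weighted_functional_def)

lemma functional_minus:
  assumes "weighted_functional M W T" "weighted_functional M W S"
  shows "weighted_functional M W (\<lambda>g. T g - S g)"
  using functional_lincomb[OF assms(2,1), of "-1"] by (simp add: algebra_simps)

lemma functional_plus:
  assumes "weighted_functional M W T" "weighted_functional M W S"
  shows "weighted_functional M W (\<lambda>g. T g + S g)"
  using functional_lincomb[OF assms, of 1] by simp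

lemma functional_times:
  assumes "weighted_functional M W T"
  shows "weighted_functional M W (\<lambda>g. a * T g)"
  using functional_lincomb[OF assms functional_null, of a] by simp

lemma functional_Sum:
  "(\<And>i. i \<in> I \<Longrightarrow> weighted_functional M W (T i)) \<Longrightarrow> weighted_functional M W (\<lambda>g. \<Sum>i\<in>I. T i g)"
  by (induction I rule: infinite_finite_induct) (auto intro: functional_plus functional_null)

section \<open>Integrals as functionals\<close>

lemma integrable_weighted_fun:
  assumes sets: "sets N = sets M" and W: "integrable N W" and g: "g \<in> weighted_fun M W"
  shows "integrable N g"
proof -
  obtain c where c: "\<And>x. x \<in> space M \<Longrightarrow> \<bar>g x\<bar> \<le> c * W x"
    using g by (auto simp: weighted_fun_def)
  have "g \<in> borel_measurable N"
    using weighted_fun_measurable[OF g] measurable_cong_sets[OF sets refl] by blast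
  moreover have "norm (g x) \<le> norm (c * W x)" if "x \<in> space N" for x
    using c[of x] that sets_eq_imp_space_eq[OF sets] by auto
  ultimately show ?thesis
    by (rule Bochner_Integration.integrable_bound[OF integrable_mult_right[OF W, of c] _ AE_I2])
qed

lemma integral_functional:
  assumes sets: "sets N = sets M" and W: "integrable N W"
  shows "weighted_functional M W (\<lambda>g. \<integral>x. g x \<partial>N)"
  unfolding weighted_functional_def
proof (intro conjI ballI allI impI)
  have sp: "space N = space M" using sets by (rule sets_eq_imp_space_eq)
  have mb: "g \<in> borel_measurable N" if "g \<in> borel_measurable M" for g :: "_ \<Rightarrow> real"
    using that measurable_cong_sets[OF sets refl] by blast
  fix G :: "nat \<Rightarrow> _" and g
  assume G: "\<forall>n. G n \<in> weighted_ball M W" and g: "g \<in> borel_measurable M"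
    and lim: "\<forall>x\<in>space M. (\<lambda>n. G n x) \<longlonglongrightarrow> g x"
  show "(\<lambda>n. \<integral>x. G n x \<partial>N) \<longlonglongrightarrow> (\<integral>x. g x \<partial>N)"
  proof (rule integral_dominated_convergence[OF mb[OF g] mb W])
    show "G n \<in> borel_measurable M" for n using G weighted_ballD by blast
    show "AE x in N. (\<lambda>n. G n x) \<longlonglongrightarrow> g x" using lim sp by (intro AE_I2) simp
    show "AE x in N. norm (G n x) \<le> W x" for n
      using G sp by (intro AE_I2) (simp add: weighted_ball_def)
  qed
next
  fix g h :: "'a \<Rightarrow> real" and a :: real
  assume "g \<in> weighted_fun M W" "h \<in> weighted_fun M W"
  from this[THEN integrable_weighted_fun[OF sets W]]
  show "(\<integral>x. a * g x + h x \<partial>N) = a * (\<integral>x. g x \<partial>N) + (\<integral>x. h x \<partial>N)" by simp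
qed

lemma integral_dual_bound:
  assumes sets: "sets N = sets M" and W: "integrable N W" "(\<integral>x. W x \<partial>N) \<le> c"
  shows "dual_bound M W (\<lambda>g. \<integral>x. g x \<partial>N) c"
  unfolding dual_bound_def
proof
  fix g assume g: "g \<in> weighted_ball M W"
  have int: "integrable N g"
    by (rule integrable_weighted_fun[OF sets W(1) weighted_ball_fun[OF g]])
  have "\<bar>\<integral>x. g x \<partial>N\<bar> \<le> (\<integral>x. \<bar>g x\<bar> \<partial>N)" by simp
  also have "\<dots> \<le> (\<integral>x. W x \<partial>N)"
    using g sets_eq_imp_space_eq[OF sets]
    by (intro integral_mono W integrable_abs int) (simp add: weighted_ball_def)
  finally show "\<bar>\<integral>x. g x \<partial>N\<bar> \<le> c" using W by simp
qed

section \<open>Calculus of norm bounds and of vanishing families\<close>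

lemma dual_bound_add:
  assumes "dual_bound M W T c" "dual_bound M W S d"
  shows "dual_bound M W (\<lambda>g. T g + S g) (c + d)"
  using assms unfolding dual_bound_def by (fastforce intro: order_trans[OF abs_triangle_ineq] add_mono)

lemma dual_bound_times:
  assumes "dual_bound M W T c"
  shows "dual_bound M W (\<lambda>g. a * T g) (\<bar>a\<bar> * c)"
  using assms unfolding dual_bound_def by (auto simp: abs_mult intro: mult_left_mono)

lemma dual_bound_sum:
  "(\<And>i. i \<in> I \<Longrightarrow> dual_bound M W (T i) (c i)) \<Longrightarrow>
     dual_bound M W (\<lambda>g. \<Sum>i\<in>I. T i g) (\<Sum>i\<in>I. c i)"
  unfolding dual_bound_def by (auto intro!: sum_abs[THEN order_trans] sum_mono)

lemma dual_bound_le: "dual_bound M W T c \<Longrightarrow> c \<le> d \<Longrightarrow> dual_bound M W T d"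
  unfolding dual_bound_def by (auto intro: order_trans)

lemma dual_bound_mono:
  assumes "dual_bound M W T c" "weighted_functional M W T" "a \<ge> 0"
    and W: "\<And>x. x \<in> space M \<Longrightarrow> 0 \<le> W x"
    and le: "\<And>x. x \<in> space M \<Longrightarrow> W' x \<le> a * W x"
  shows "dual_bound M W' T (a * c)"
  unfolding dual_bound_def
  by (intro ballI dual_boundD[OF assms(1,2) _ assms(3) _ W]) (auto simp: weighted_ball_def intro: order_trans le)

lemma dual_bound_nonneg:
  assumes "dual_bound M W T c" "\<And>x. x \<in> space M \<Longrightarrow> 0 \<le> W x"
  shows "0 \<le> c"
proof -
  have "(\<lambda>x. 0) \<in> weighted_ball M W" using assms(2) by (auto simp: weighted_ball_def)
  then show ?thesis using assms(1) unfolding dual_bound_def by (meson abs_ge_zero order_trans)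
qed

lemma dual_vanishD: "dual_vanish F M W S \<Longrightarrow> e > 0 \<Longrightarrow> \<forall>\<^sub>F v in F. dual_bound M W (S v) e"
  by (simp add: dual_vanish_def)

lemma dual_vanish_add:
  assumes "dual_vanish F M W S" "dual_vanish F M W T"
  shows "dual_vanish F M W (\<lambda>v g. S v g + T v g)"
  unfolding dual_vanish_def
proof (intro allI impI)
  fix e :: real assume "e > 0"
  then have "e/2 > 0" by simp
  from dual_vanishD[OF assms(1) this] dual_vanishD[OF assms(2) this]
  show "\<forall>\<^sub>F v in F. dual_bound M W (\<lambda>g. S v g + T v g) e"
    by eventually_elim (use dual_bound_add in fastforce)
qed

lemma dual_vanish_times:
  assumes "dual_vanish F M W S"
  shows "dual_vanish F M W (\<lambda>v g. a * S v g)"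
  unfolding dual_vanish_def
proof (intro allI impI)
  fix e :: real assume "e > 0"
  then have "e/(\<bar>a\<bar>+1) > 0" by (simp add: add_nonneg_pos)
  from dual_vanishD[OF assms(1) this]
  show "\<forall>\<^sub>F v in F. dual_bound M W (\<lambda>g. a * S v g) e"
  proof eventually_elim
    case (elim v)
    have "\<bar>a\<bar> * (e/(\<bar>a\<bar>+1)) \<le> e"
      using \<open>e > 0\<close> by (simp add: divide_le_eq add_nonneg_pos algebra_simps)
    then show ?case using dual_bound_times[OF elim, of a] dual_bound_le by blast
  qed
qed

lemma dual_vanish_null: "dual_vanish F M W (\<lambda>v g. 0)"
  by (auto simp: dual_vanish_def dual_bound_def)

lemma dual_vanish_sum:
  "(\<And>i. i \<in> I \<Longrightarrow> dual_vanish F M W (S i)) \<Longrightarrow> dual_vanish F M W (\<lambda>v g. \<Sum>i\<in>I. S i v g)"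
  by (induction I rule: infinite_finite_induct) (auto intro: dual_vanish_add dual_vanish_null)

lemma dual_vanish_cong:
  assumes "dual_vanish F M W S"
    "\<forall>\<^sub>F v in F. \<forall>g\<in>weighted_ball M W. S v g = T v g"
  shows "dual_vanish F M W T"
  unfolding dual_vanish_def
proof (intro allI impI)
  fix e :: real assume "e > 0"
  from dual_vanishD[OF assms(1) this] assms(2)
  show "\<forall>\<^sub>F v in F. dual_bound M W (T v) e"
    by eventually_elim (auto simp: dual_bound_def)
qed

lemma dual_vanish_mono:
  assumes "dual_vanish F M W S" "\<And>x. x \<in> space M \<Longrightarrow> W' x \<le> W x"
  shows "dual_vanish F M W' S"
proof -
  have "weighted_ball M W' \<subseteq> weighted_ball M W"
    using assms(2) by (fastforce simp: weighted_ball_def intro: order_trans)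
  then have "dual_bound M W (S v) e \<Longrightarrow> dual_bound M W' (S v) e" for v e
    unfolding dual_bound_def by blast
  then show ?thesis using assms(1) unfolding dual_vanish_def
    by (blast intro: eventually_mono)
qed

section \<open>From functionals back to signed measures\<close>

lemma indicator_weighted_ball:
  assumes "A \<in> sets M" "\<And>x. x \<in> space M \<Longrightarrow> 1 \<le> W x"
  shows "indicator A \<in> weighted_ball M W"
  using assms by (intro weighted_ballI) (auto simp: indicator_def intro: order_trans)

text \<open>Linearity extends equality from indicators to simple functions, and continuity to their
  dominated limits. \<open>1 \<le> W\<close> puts the indicators into the ball.\<close>

lemma functional_eqI:
  assumes T: "weighted_functional M W T" and S: "weighted_functional M W S"
    and W: "\<And>x. x \<in> space M \<Longrightarrow> 1 \<le> W x"
    and eq: "\<And>A. A \<in> sets M \<Longrightarrow> T (indicator A) = S (indicator A)"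
    and g: "g \<in> weighted_fun M W"
  shows "T g = S g"
proof -
  have W0: "0 \<le> W x" if "x \<in> space M" for x using W[OF that] by simp
  obtain c where c: "c > 0" and gc: "(\<lambda>x. g x / c) \<in> weighted_ball M W"
    using weighted_fun_ball[OF g W0] by blast
  \<comment> \<open>The simple functions approximating \<open>h\<close> are only bounded by
    \<open>2 * \<bar>h\<bar>\<close>; the extra factor 2 keeps them inside the ball.\<close>
  define h where "h = (\<lambda>x. g x / (2 * c))"
  have h_meas: "h \<in> borel_measurable M"
    using weighted_fun_measurable[OF g] by (simp add: h_def)
  from borel_measurable_implies_sequence_metric[OF h_meas, of 0]
  obtain F where F': "\<forall>i. simple_function M (F i)" "\<forall>x\<in>space M. (\<lambda>i. F i x) \<longlonglongrightarrow> h x"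
    "\<forall>i. \<forall>x\<in>space M. dist (F i x) 0 \<le> 2 * dist (h x) 0"
    by blast
  have F: "\<And>i. simple_function M (F i)" "\<And>x. x \<in> space M \<Longrightarrow> (\<lambda>i. F i x) \<longlonglongrightarrow> h x"
    "\<And>i x. x \<in> space M \<Longrightarrow> \<bar>F i x\<bar> \<le> 2 * \<bar>h x\<bar>"
    using F' by (auto simp: dist_real_def)
  have FW: "F i \<in> weighted_ball M W" for i
  proof (rule weighted_ballI[OF borel_measurable_simple_function[OF F(1)]])
    fix x assume x: "x \<in> space M"
    have "2 * \<bar>h x\<bar> \<le> W x"
      using weighted_ballD(2)[OF gc x] c by (simp add: h_def abs_mult)
    then show "\<bar>F i x\<bar> \<le> W x" using F(3)[OF x, of i] by simp
  qed
  have ind: "indicator A \<in> weighted_fun M W" if "A \<in> sets M" for A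
    by (rule weighted_ball_fun[OF indicator_weighted_ball[OF that W]])
  have fs: "R (F i) = (\<Sum>y \<in> F i ` space M. y * R (indicator (F i -` {y} \<inter> space M)))"
    if R: "weighted_functional M W R" for R i
  proof -
    have sm: "F i -` {y} \<inter> space M \<in> sets M" for y
      by (rule simple_functionD(2)[OF F(1)])
    have mem: "(\<lambda>x. y * indicator (F i -` {y} \<inter> space M) x) \<in> weighted_fun M W" for y
      by (rule weighted_fun_scale[OF ind[OF sm]])
    have "R (F i) = R (\<lambda>x. \<Sum>y \<in> F i ` space M. y * indicator (F i -` {y} \<inter> space M) x)"
    proof (rule functional_cong[OF R weighted_ball_fun[OF FW] weighted_fun_sum W0])
      fix x assume x: "x \<in> space M"
      show "F i x = (\<Sum>y \<in> F i ` space M. y * indicator (F i -` {y} \<inter> space M) x)"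
        by (subst simple_function_indicator_representation_banach[OF F(1) x])
          (simp only: real_scaleR_def mult.commute)
    qed (use mem in auto)
    also have "\<dots> = (\<Sum>y \<in> F i ` space M. R (\<lambda>x. y * indicator (F i -` {y} \<inter> space M) x))"
      by (rule functional_sum[OF R mem])
    also have "\<dots> = (\<Sum>y \<in> F i ` space M. y * R (indicator (F i -` {y} \<inter> space M)))"
      by (simp only: functional_scale[OF R ind[OF sm]])
    finally show ?thesis .
  qed
  have "T (F i) = S (F i)" for i
    unfolding fs[OF T] fs[OF S] by (intro sum.cong refl) (simp add: eq simple_functionD(2)[OF F(1)])
  then have "T h = S h"
    using functional_tendsto[OF T FW h_meas F(2)] functional_tendsto[OF S FW h_meas F(2)]
    by (auto intro: LIMSEQ_unique)
  moreover have scale: "R h = R g / (2 * c)" if "weighted_functional M W R" for R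
    using functional_scale[OF that g, of "1 / (2*c)"] by (simp add: h_def)
  ultimately show ?thesis using scale[OF T] scale[OF S] c by simp
qed

context
  fixes M :: "'b measure" and W :: "'b \<Rightarrow> real" and T :: "('b \<Rightarrow> real) \<Rightarrow> real"
  assumes T: "weighted_functional M W T" and W: "\<And>x. x \<in> space M \<Longrightarrow> 1 \<le> W x"
begin

private abbreviation (input) "nu A \<equiv> T (indicator A)"

private lemma W0: "x \<in> space M \<Longrightarrow> 0 \<le> W x"
  using W[of x] by simp

private lemma ind: "A \<in> sets M \<Longrightarrow> indicator A \<in> weighted_fun M W"
  by (rule weighted_ball_fun[OF indicator_weighted_ball[OF _ W]])

lemma functional_indicator_modular:
  assumes "A \<in> sets M" "B \<in> sets M"
  shows "nu (A \<union> B) + nu (A \<inter> B) = nu A + nu B"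
proof -
  have "nu (A \<union> B) + nu (A \<inter> B) = T (\<lambda>x. indicator (A \<union> B) x + indicator (A \<inter> B) x)"
    by (rule functional_add[OF T, symmetric]) (use assms in \<open>auto intro!: ind\<close>)
  also have "\<dots> = T (\<lambda>x. indicator A x + indicator B x)"
    by (rule arg_cong[where f=T]) (auto simp: indicator_def)
  also have "\<dots> = nu A + nu B"
    by (rule functional_add[OF T]) (use assms in \<open>auto intro!: ind\<close>)
  finally show ?thesis .
qed

lemma functional_indicator_empty: "nu {} = 0"
proof -
  have "(indicator {} :: 'b \<Rightarrow> real) = (\<lambda>x. 0)" by auto
  then show ?thesis using functional_zero[OF T] by (simp only:)
qed

lemma functional_indicator_disjoint:
  assumes "A \<in> sets M" "B \<in> sets M" "A \<inter> B = {}"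
  shows "nu (A \<union> B) = nu A + nu B"
  using functional_indicator_modular[OF assms(1,2)] assms(3) functional_indicator_empty by simp

lemma functional_indicator_tendsto:
  assumes "\<And>n. A n \<in> sets M" "B \<in> sets M"
    "\<And>x. (\<lambda>n. indicator (A n) x :: real) \<longlonglongrightarrow> indicator B x"
  shows "(\<lambda>n. nu (A n)) \<longlonglongrightarrow> nu B"
  by (rule functional_tendsto[OF T]) (use assms in \<open>auto intro!: indicator_weighted_ball W\<close>)

lemma functional_indicator_sums:
  assumes "range A \<subseteq> sets M" "disjoint_family A"
  shows "(\<lambda>i::nat. nu (A i)) sums nu (\<Union>i. A i)"
proof -
  have A: "A i \<in> sets M" for i using assms by auto
  have "(\<lambda>n. nu (\<Union>i<n. A i)) \<longlonglongrightarrow> nu (\<Union>i. A i)"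
    by (rule functional_indicator_tendsto) (use A in \<open>auto intro: LIMSEQ_indicator_UN\<close>)
  moreover have "nu (\<Union>i<n. A i) = (\<Sum>i<n. nu (A i))" for n
  proof -
    have "indicator (\<Union>i<n. A i) = (\<lambda>x. \<Sum>i<n. indicator (A i) x :: real)"
      using assms(2) by (intro ext indicator_UN_disjoint)
        (auto simp: disjoint_family_on_def)
    then show ?thesis using functional_sum[OF T, of "{..<n}" "\<lambda>i. indicator (A i)"] ind[OF A] by simp
  qed
  ultimately show ?thesis by (simp add: sums_def)
qed

text \<open>The positive set is the limes inferior of sets almost maximising the signed measure.\<close>

lemma functional_Hahn:
  obtains P where "P \<in> sets M" "\<And>B. B \<in> sets M \<Longrightarrow> B \<subseteq> P \<Longrightarrow> 0 \<le> nu B"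
    "\<And>B. B \<in> sets M \<Longrightarrow> B \<inter> P = {} \<Longrightarrow> nu B \<le> 0"
proof -
  obtain c where "c > 0" and c: "dual_bound M W T c" using functional_bounded[OF T W0] by blast
  have bdd: "bdd_above (nu ` sets M)"
  proof (rule bdd_aboveI2)
    fix A assume "A \<in> sets M"
    then show "nu A \<le> c"
      using c indicator_weighted_ball[OF _ W, of A] by (simp add: dual_bound_def abs_le_iff)
  qed
  define s where "s = (SUP A\<in>sets M. nu A)"
  have le_s: "nu A \<le> s" if "A \<in> sets M" for A
    unfolding s_def by (rule cSUP_upper[OF that bdd])
  have "\<exists>A\<in>sets M. s - (1/2)^n < nu A" for n :: nat
  proof -
    have "s - (1/2)^n < s" by simp
    then show ?thesis
      unfolding s_def by (subst (asm) less_cSUP_iff[OF _ bdd]) auto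
  qed
  then obtain A where A: "\<And>n. A n \<in> sets M" and As: "\<And>n::nat. s - (1/2)^n < nu (A n)"
    by metis
  define C where "C n N = (\<Inter>k\<in>{n..n+N}. A k)" for n N :: nat
  have C_sets: "C n N \<in> sets M" for n N
    unfolding C_def using A by (intro sets.finite_INT) auto
  \<comment> \<open>By modularity, intersecting with \<open>A k\<close> costs at most its defect
    \<open>(1/2)^k\<close>. The defects from \<open>n\<close> on add up to
    \<open>2 * (1/2)^n\<close>, and \<open>(1/2)^(n+N)\<close> is the part not yet spent.\<close>
  have C_ge: "nu (C n N) \<ge> s - 2 * (1/2)^n + (1/2)^(n+N)" for n N
  proof (induction N)
    case 0
    then show ?case using As[of n] by (simp add: C_def)
  next
    case (Suc N)
    have "C n (Suc N) = C n N \<inter> A (n + Suc N)"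
      by (auto simp: C_def atLeastAtMostSuc_conv)
    then have "nu (C n (Suc N)) = nu (C n N) + nu (A (n + Suc N)) - nu (C n N \<union> A (n + Suc N))"
      using functional_indicator_modular[OF C_sets A, of n N "n + Suc N"] by simp
    moreover have "nu (C n N \<union> A (n + Suc N)) \<le> s"
      by (rule le_s) (use C_sets A in auto)
    moreover have "nu (A (n + Suc N)) \<ge> s - (1/2)^(n + Suc N)"
      using As[of "n + Suc N"] by simp
    moreover have "(1/2::real)^(n + N) = 2 * (1/2)^(n + Suc N)" by simp
    ultimately show ?case using Suc by linarith
  qed
  define D where "D n = (\<Inter>k. A (n + k))" for n
  have D_sets: "D n \<in> sets M" for n
    unfolding D_def using A by (intro sets.countable_INT) auto
  have D_ge: "nu (D n) \<ge> s - 2 * (1/2)^n" for n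
  proof (rule tendsto_lowerbound)
    show "(\<lambda>N. nu (C n N)) \<longlonglongrightarrow> nu (D n)"
    proof (rule functional_indicator_tendsto[OF C_sets D_sets])
      have "decseq (C n)" by (auto simp: decseq_def C_def)
      moreover have "(\<Inter>N. C n N) = D n"
      proof (intro set_eqI iffI)
        fix x assume "x \<in> (\<Inter>N. C n N)"
        then have C: "x \<in> C n k" for k by blast
        have "x \<in> A (n + k)" for k by (rule INT_D[OF C[of k, unfolded C_def]]) simp
        then show "x \<in> D n" by (simp add: D_def)
      next
        fix x assume "x \<in> D n"
        then have *: "x \<in> A (n + j)" for j by (simp add: D_def)
        have "x \<in> A k" if "n \<le> k" for k using that *[of "k - n"] by simp
        then show "x \<in> (\<Inter>N. C n N)" by (simp add: C_def)
      qed
      ultimately show "(\<lambda>N. indicator (C n N) x :: real) \<longlonglongrightarrow> indicator (D n) x" for x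
        using LIMSEQ_indicator_decseq[of "C n" x] by simp
    qed
    show "\<forall>\<^sub>F N in sequentially. s - 2 * (1/2)^n \<le> nu (C n N)"
      using C_ge[of n] by (intro always_eventually allI) (smt (verit) zero_le_power divide_nonneg_nonneg)
  qed simp
  define P where "P = (\<Union>n. D n)"
  have P: "P \<in> sets M" unfolding P_def using D_sets by auto
  have "(\<lambda>n. nu (D n)) \<longlonglongrightarrow> nu P"
  proof (rule functional_indicator_tendsto[OF D_sets P])
    have "D n \<subseteq> D m" if "n \<le> m" for n m
    proof -
      show ?thesis
      proof
        fix x assume x: "x \<in> D n"
        have "x \<in> A (n + j)" for j using x by (simp add: D_def)
        from this[of "m - n + _"] show "x \<in> D m" using that by (simp add: D_def)
      qed
    qed
    then have "incseq D" by (auto simp: incseq_def)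
    then show "(\<lambda>n. indicator (D n) x :: real) \<longlonglongrightarrow> indicator P x" for x
      unfolding P_def by (rule LIMSEQ_indicator_incseq)
  qed
  moreover have "(\<lambda>n. s - 2 * (1/2::real)^n) \<longlonglongrightarrow> s - 2 * 0"
    by (intro tendsto_intros) auto
  ultimately have "s \<le> nu P"
    using D_ge by (intro tendsto_le[of sequentially "\<lambda>n. nu (D n)" _ "\<lambda>n. s - 2 * (1/2)^n"]) auto
  \<comment> \<open>\<open>P\<close> attains the supremum \<open>s\<close>: removing a subset of
    negative mass or adding a disjoint set of positive mass would exceed it.\<close>
  then have P_eq: "nu P = s" using le_s[OF P] by simp
  show ?thesis
  proof (rule that[OF P])
    fix B assume B: "B \<in> sets M" "B \<subseteq> P"
    have "nu P = nu (P - B) + nu B"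
      using functional_indicator_disjoint[of "P - B" B] B P by (simp add: Un_absorb2 Int_commute Int_Diff)
    then show "0 \<le> nu B" using le_s[of "P - B"] P_eq P B by auto
  next
    fix B assume B: "B \<in> sets M" "B \<inter> P = {}"
    have "nu (P \<union> B) = nu P + nu B"
      using functional_indicator_disjoint[of P B] B P by blast
    then show "nu B \<le> 0" using le_s[of "P \<union> B"] P_eq P B by auto
  qed
qed

text \<open>On subsets of \<open>A\<close> the largest value is attained at
  \<open>A \<inter> P\<close>, so the upper variation is \<open>T\<close> cut off to the positive
  set. This is checked on indicators and extended by \<open>functional_eqI\<close>.\<close>

lemma integral_upper_var:
  assumes P: "P \<in> sets M" and pos: "\<And>B. B \<in> sets M \<Longrightarrow> B \<subseteq> P \<Longrightarrow> 0 \<le> nu B"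
    and neg: "\<And>B. B \<in> sets M \<Longrightarrow> B \<inter> P = {} \<Longrightarrow> nu B \<le> 0"
    and Wm: "W \<in> borel_measurable M"
    and mu: "\<And>A. A \<in> sets M \<Longrightarrow> \<mu> A = nu A"
    and g: "g \<in> weighted_fun M W"
  shows "(\<integral>x. g x \<partial>upper_var M \<mu>) = T (\<lambda>x. g x * indicator P x)"
proof -
  define U where "U = upper_var M \<mu>"
  have sets_U: "sets U = sets M" and space_U: "space U = space M"
    by (auto simp: U_def upper_var_def)
  have sup_eq: "(SUP B\<in>{B\<in>sets M. B \<subseteq> A}. ennreal (\<mu> B)) = ennreal (nu (A \<inter> P))" if A: "A \<in> sets M" for A
  proof (rule antisym)
    show "(SUP B\<in>{B\<in>sets M. B \<subseteq> A}. ennreal (\<mu> B)) \<le> ennreal (nu (A \<inter> P))"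
    proof (rule SUP_least)
      fix B assume "B \<in> {B\<in>sets M. B \<subseteq> A}"
      then have B: "B \<in> sets M" "B \<subseteq> A" by auto
      have "nu B = nu (B \<inter> P) + nu (B - P)"
        using functional_indicator_disjoint[of "B \<inter> P" "B - P"] B P by (auto simp: Int_Diff_Un)
      moreover have "nu (B - P) \<le> 0" by (rule neg) (use B P in auto)
      moreover have "nu (A \<inter> P) = nu (B \<inter> P) + nu (A \<inter> P - B)"
      proof -
        have "(B \<inter> P) \<union> (A \<inter> P - B) = A \<inter> P" using B by auto
        then show ?thesis
          using functional_indicator_disjoint[of "B \<inter> P" "A \<inter> P - B"] B P A by auto
      qed
      moreover have "0 \<le> nu (A \<inter> P - B)" by (rule pos) (use A B P in auto)
      ultimately show "ennreal (\<mu> B) \<le> ennreal (nu (A \<inter> P))"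
        by (intro ennreal_leI) (simp add: mu B)
    qed
    show "ennreal (nu (A \<inter> P)) \<le> (SUP B\<in>{B\<in>sets M. B \<subseteq> A}. ennreal (\<mu> B))"
      using A P by (intro SUP_upper2[of "A \<inter> P"]) (auto simp: mu)
  qed
  have emeasure_U: "emeasure U A = ennreal (nu (A \<inter> P))" if A: "A \<in> sets M" for A
  proof -
    have "emeasure U A = (SUP B\<in>{B\<in>sets M. B \<subseteq> A}. ennreal (\<mu> B))"
      unfolding U_def upper_var_def
    proof (rule emeasure_measure_of_sigma[OF sets.sigma_algebra_axioms _ _ A])
      show "positive (sets M) (\<lambda>A. SUP B\<in>{B\<in>sets M. B \<subseteq> A}. ennreal (\<mu> B))"
        using sup_eq[of "{}"] by (simp add: positive_def functional_indicator_empty)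
      show "countably_additive (sets M) (\<lambda>A. SUP B\<in>{B\<in>sets M. B \<subseteq> A}. ennreal (\<mu> B))"
        unfolding countably_additive_def
      proof (intro allI impI)
        fix A :: "nat \<Rightarrow> 'b set"
        assume A: "range A \<subseteq> sets M" "disjoint_family A" "(\<Union>i. A i) \<in> sets M"
        have "(\<lambda>i. nu (A i \<inter> P)) sums nu (\<Union>i. A i \<inter> P)"
          by (rule functional_indicator_sums) (use A P in \<open>auto simp: disjoint_family_on_def\<close>)
        then have "(\<Sum>i. ennreal (nu (A i \<inter> P))) = ennreal (nu ((\<Union>i. A i) \<inter> P))"
          using A P by (intro suminf_ennreal_eq) (auto intro!: pos)
        then show "(\<Sum>i. SUP B\<in>{B\<in>sets M. B \<subseteq> A i}. ennreal (\<mu> B)) =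
            (SUP B\<in>{B\<in>sets M. B \<subseteq> \<Union> (range A)}. ennreal (\<mu> B))"
          using A by (subst sup_eq) (auto simp: sup_eq range_subsetD)
      qed
    qed
    then show ?thesis by (simp add: sup_eq A)
  qed
  interpret U: finite_measure U
    by (rule finite_measureI) (simp add: space_U emeasure_U)
  have measure_U: "measure U A = nu (A \<inter> P)" if "A \<in> sets M" for A
    using that P by (simp add: measure_def emeasure_U pos)
  define S where "S g = T (\<lambda>x. g x * indicator P x)" for g
  have cut: "(\<lambda>x. g x * indicator P x) \<in> weighted_fun M W'" if "g \<in> weighted_fun M W'" for g W'
    using that P by (fastforce simp: weighted_fun_def indicator_def abs_mult intro: order_trans[OF abs_ge_zero])
  have cutb: "(\<lambda>x. g x * indicator P x) \<in> weighted_ball M W'" if "g \<in> weighted_ball M W'" for g W'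
    using that P by (fastforce simp: weighted_ball_def indicator_def abs_mult intro: order_trans[OF abs_ge_zero])
  \<comment> \<open>A general weight, because the claim is used twice: with the constant weight 1,
    where integrability is automatic, and then with \<open>W\<close>.\<close>
  have S: "weighted_functional M W' S" if T': "weighted_functional M W' T" for W'
    unfolding weighted_functional_def S_def
  proof (intro conjI ballI allI impI)
    fix g h :: "'b \<Rightarrow> real" and a :: real
    assume "g \<in> weighted_fun M W'" "h \<in> weighted_fun M W'"
    from functional_linear[OF T' cut[OF this(1)] cut[OF this(2)], of a]
    show "T (\<lambda>x. (a * g x + h x) * indicator P x) =
        a * T (\<lambda>x. g x * indicator P x) + T (\<lambda>x. h x * indicator P x)"
      by (simp add: algebra_simps)
  next
    fix G :: "nat \<Rightarrow> 'b \<Rightarrow> real" and g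
    assume "\<forall>n. G n \<in> weighted_ball M W'" "g \<in> borel_measurable M" "\<forall>x\<in>space M. (\<lambda>n. G n x) \<longlonglongrightarrow> g x"
    then show "(\<lambda>n. T (\<lambda>x. G n x * indicator P x)) \<longlonglongrightarrow> T (\<lambda>x. g x * indicator P x)"
      using P by (intro functional_tendsto[OF T'] cutb) (auto intro!: tendsto_intros)
  qed
  have ind_eq: "(\<integral>x. indicator A x \<partial>U) = S (indicator A)" if A: "A \<in> sets M" for A
    using A sets.sets_into_space[OF A]
    by (simp add: measure_U S_def space_U sets_U Int_absorb2 indicator_inter_arith[symmetric])
  have T1: "weighted_functional M (\<lambda>_. 1) T"
    by (rule functional_mono[OF T zero_less_one]) (use W in auto)
  have eq1: "(\<integral>x. g x \<partial>U) = S g" if "g \<in> weighted_fun M (\<lambda>_. 1)" for g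
    by (rule functional_eqI[OF integral_functional[OF sets_U] S[OF T1] _ ind_eq that]) auto
  have bdd: "(\<lambda>x. min (W x) (real n)) \<in> weighted_fun M (\<lambda>_. 1)" for n
    using Wm W0 by (intro weighted_funI[where c="real n"]) auto
  \<comment> \<open>The truncations of \<open>W\<close> have the integrals
    \<open>S (min W n)\<close>. These converge to the finite number \<open>S W\<close> by continuity
    of \<open>S\<close>, so monotone convergence yields integrability.\<close>
  have WU: "integrable U W"
  proof (rule integrable_monotone_convergence)
    show "integrable U (\<lambda>x. min (W x) (real n))" for n
      by (rule integrable_weighted_fun[OF sets_U _ bdd]) simp
    show "AE x in U. mono (\<lambda>n. min (W x) (real n))"
      by (intro AE_I2 monoI) auto
    show "AE x in U. (\<lambda>n. min (W x) (real n)) \<longlonglongrightarrow> W x"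
    proof (intro AE_I2 tendsto_eventually)
      fix x show "\<forall>\<^sub>F n in sequentially. min (W x) (real n) = W x"
        using real_arch_simple[of "W x"] unfolding eventually_sequentially min_def
        by (meson of_nat_mono order_trans)
    qed
    have "(\<lambda>n. S (\<lambda>x. min (W x) (real n))) \<longlonglongrightarrow> S W"
    proof (rule functional_tendsto[OF S[OF T]])
      show "(\<lambda>x. min (W x) (real n)) \<in> weighted_ball M W" for n
        using Wm W0 by (intro weighted_ballI) auto
      fix x show "(\<lambda>n. min (W x) (real n)) \<longlonglongrightarrow> W x"
      proof (intro tendsto_eventually)
        show "\<forall>\<^sub>F n in sequentially. min (W x) (real n) = W x"
          using real_arch_simple[of "W x"] unfolding eventually_sequentially min_def
          by (meson of_nat_mono order_trans)
      qed
    qed fact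
    then show "(\<lambda>n. \<integral>x. min (W x) (real n) \<partial>U) \<longlonglongrightarrow> S W"
      by (simp add: eq1[OF bdd])
    show "W \<in> borel_measurable U" using Wm measurable_cong_sets[OF sets_U refl] by blast
  qed
  have "(\<integral>x. g x \<partial>U) = S g"
    by (rule functional_eqI[OF integral_functional[OF sets_U WU] S[OF T] W ind_eq g])
  then show ?thesis by (simp add: U_def S_def)
qed

text \<open>The bridge from the Jordan decomposition to \<open>T\<close>: afterwards every weighted
  norm is estimated through \<open>dual_bound\<close>.\<close>

lemma signed_integral_functional:
  assumes Wm: "W \<in> borel_measurable M"
    and mu: "\<And>A. A \<in> sets M \<Longrightarrow> \<mu> A = nu A"
    and g: "g \<in> weighted_fun M W"
  shows "signed_integral M \<mu> g = T g"
proof -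
  obtain P where P: "P \<in> sets M" and pos: "\<And>B. B \<in> sets M \<Longrightarrow> B \<subseteq> P \<Longrightarrow> 0 \<le> nu B"
    and neg: "\<And>B. B \<in> sets M \<Longrightarrow> B \<inter> P = {} \<Longrightarrow> nu B \<le> 0"
    using functional_Hahn by blast
  have up: "(\<integral>x. g x \<partial>upper_var M \<mu>) = T (\<lambda>x. g x * indicator P x)"
    by (rule integral_upper_var[OF P pos neg Wm mu g])
  have Q: "space M - P \<in> sets M" using P by auto
  \<comment> \<open>\<open>- T\<close> has the complement of \<open>P\<close> as its positive set,
    so the previous lemma applies to it.\<close>
  have "(\<integral>x. g x \<partial>lower_var M \<mu>) = - T (\<lambda>x. g x * indicator (space M - P) x)"
    unfolding lower_var_def
  proof (rule Submission.integral_upper_var[where T="\<lambda>g. - T g", OF _ W Q _ _ Wm _ g])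
    show "weighted_functional M W (\<lambda>g. - T g)" using functional_times[OF T, of "-1"] by simp
    fix B assume B: "B \<in> sets M"
    show "0 \<le> - nu B" if "B \<subseteq> space M - P" using neg[OF B] that by auto
    show "- nu B \<le> 0" if "B \<inter> (space M - P) = {}"
      using pos[OF B] sets.sets_into_space[OF B] that by auto
  qed (use mu in auto)
  moreover have "T (\<lambda>x. g x * indicator P x) + T (\<lambda>x. g x * indicator (space M - P) x) = T g"
  proof -
    have cut: "(\<lambda>x. g x * indicator A x) \<in> weighted_fun M W" if "A \<in> sets M" for A
      using g that by (fastforce simp: weighted_fun_def indicator_def abs_mult intro: order_trans[OF abs_ge_zero])
    show ?thesis
      unfolding functional_add[OF T cut[OF P] cut[OF Q], symmetric]
      by (rule functional_cong[OF T weighted_fun_add[OF cut[OF P] cut[OF Q]] g W0])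
        (auto simp: indicator_def)
  qed
  ultimately show ?thesis by (simp add: signed_integral_def up)
qed

lemma signed_measure_functional:
  assumes "\<And>A. A \<in> sets M \<Longrightarrow> \<mu> A = nu A" "\<And>A. A \<notin> sets M \<Longrightarrow> \<mu> A = 0"
  shows "signed_measure M \<mu>"
  unfolding signed_measure_def
proof (intro conjI allI impI)
  fix A :: "nat \<Rightarrow> 'b set" assume A: "range A \<subseteq> sets M" "disjoint_family A"
  then have "(\<Union>i. A i) \<in> sets M" by auto
  then show "(\<lambda>i. \<mu> (A i)) sums \<mu> (\<Union>i. A i)"
    using functional_indicator_sums[OF A] A by (simp add: assms range_subsetD)
qed (use assms functional_indicator_empty in auto)

lemma weighted_norm_functional_le:
  assumes Wm: "W \<in> borel_measurable M"
    and mu: "\<And>A. A \<in> sets M \<Longrightarrow> \<mu> A = nu A" and c: "dual_bound M W T c"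
  shows "weighted_norm M W \<mu> \<le> ereal c"
  unfolding weighted_norm_def
proof (rule SUP_least)
  fix g assume "g \<in> {g \<in> borel_measurable M. \<forall>x\<in>space M. \<bar>g x\<bar> \<le> W x}"
  then have g: "g \<in> weighted_ball M W" by (auto intro!: weighted_ballI)
  have "T g \<le> c" using c g by (auto simp: dual_bound_def abs_le_iff)
  then show "ereal (signed_integral M \<mu> g) \<le> ereal c"
    using signed_integral_functional[OF Wm mu weighted_ball_fun[OF g]] by simp
qed

lemma weighted_measures_functional:
  assumes Wm: "W \<in> borel_measurable M"
    and mu: "\<And>A. A \<in> sets M \<Longrightarrow> \<mu> A = nu A" "\<And>A. A \<notin> sets M \<Longrightarrow> \<mu> A = 0"
  shows "\<mu> \<in> weighted_measures M W"
proof -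
  obtain c where "dual_bound M W T c" using functional_bounded[OF T W0] by blast
  then have "weighted_norm M W \<mu> \<le> ereal c" by (intro weighted_norm_functional_le Wm mu(1))
  also have "\<dots> < \<infinity>" by simp
  finally show ?thesis by (simp add: weighted_measures_def signed_measure_functional[OF mu])
qed

end

text \<open>Differentiation is carried out for functionals; this lemma transfers the resulting
  limits to the \<open>ereal\<close>-valued norm.\<close>

lemma weighted_norm_tendsto_zero:
  assumes S: "dual_vanish F M W S" "\<forall>\<^sub>F v in F. weighted_functional M W (S v)"
    and W: "\<And>x. x \<in> space M \<Longrightarrow> 1 \<le> W x" "W \<in> borel_measurable M"
    and mu: "\<forall>\<^sub>F v in F. \<forall>A\<in>sets M. \<mu> v A = S v (indicator A)"
  shows "((\<lambda>v. weighted_norm M W (\<mu> v)) \<longlongrightarrow> 0) F"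
proof (rule order_tendstoI)
  have "0 \<le> weighted_norm M W \<nu>" for \<nu>
    unfolding weighted_norm_def
  proof (rule SUP_upper2[of "\<lambda>_. 0"])
    show "(\<lambda>_. 0) \<in> {g \<in> borel_measurable M. \<forall>x\<in>space M. \<bar>g x\<bar> \<le> W x}"
      using W(1) by (auto intro: order_trans[OF zero_le_one])
  qed (simp add: signed_integral_def zero_ereal_def)
  then show "\<forall>\<^sub>F v in F. a < weighted_norm M W (\<mu> v)" if "a < 0" for a
    using that by (auto intro!: always_eventually intro: less_le_trans)
next
  fix a :: ereal assume "0 < a"
  then obtain e where e: "0 < ereal e" "ereal e < a" using ereal_dense2 by blast
  from dual_vanishD[OF S(1), of e] S(2) mu e(1)
  have "\<forall>\<^sub>F v in F. dual_bound M W (S v) e \<and> weighted_functional M W (S v) \<and>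
      (\<forall>A\<in>sets M. \<mu> v A = S v (indicator A))"
    by (auto intro: eventually_conj)
  then show "\<forall>\<^sub>F v in F. weighted_norm M W (\<mu> v) < a"
  proof eventually_elim
    case (elim v)
    then have "weighted_norm M W (\<mu> v) \<le> ereal e"
      by (intro weighted_norm_functional_le[where T="S v"] W) auto
    then show ?case using e(2) by simp
  qed
qed

section \<open>Smooth families of operators\<close>

text \<open>Almost maximising test functions \<open>g\<close> form a sequence with \<open>R v g \<rightarrow> 0\<close> pointwise, which
  replaces an integral of the pointwise supremum against the total variation of \<open>T\<close>.\<close>

lemma functional_comp_vanish:
  fixes S :: "real set"
  assumes T: "weighted_functional X V T" and V: "\<And>x. x \<in> space X \<Longrightarrow> 0 \<le> V x" and a: "a > 0"
    and W: "\<And>y. y \<in> space Y \<Longrightarrow> 0 \<le> W y"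
    and meas: "\<And>v g. v \<in> S \<Longrightarrow> v \<noteq> u \<Longrightarrow> g \<in> weighted_ball Y W \<Longrightarrow> R v g \<in> borel_measurable X"
    and bound: "\<And>v g x. v \<in> S \<Longrightarrow> v \<noteq> u \<Longrightarrow> g \<in> weighted_ball Y W \<Longrightarrow> x \<in> space X \<Longrightarrow>
      \<bar>R v g x\<bar> \<le> a * V x"
    and lim: "\<And>x. x \<in> space X \<Longrightarrow> dual_vanish (at u within S) Y W (\<lambda>v g. R v g x)"
  shows "dual_vanish (at u within S) Y W (\<lambda>v g. T (R v g))"
  unfolding dual_vanish_def
\<comment> \<open>The continuity of \<open>T\<close> concerns sequences, so the limit in the real
  parameter \<open>v\<close> is tested along sequences \<open>f\<close>.\<close>
proof (intro allI impI sequentially_imp_eventually_within)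
  fix e :: real and f :: "nat \<Rightarrow> real"
  assume e: "e > 0" and f: "(\<forall>n. f n \<in> S \<and> f n \<noteq> u) \<and> f \<longlonglongrightarrow> u"
  have fl: "filterlim f (at u within S) sequentially"
    using f by (auto simp: filterlim_at)
  have zero: "(\<lambda>_. 0) \<in> weighted_ball Y W" using W by (auto intro: weighted_ballI)
  have "\<exists>g\<in>weighted_ball Y W. \<not> dual_bound Y W (\<lambda>g. T (R (f n) g)) e \<longrightarrow> \<bar>T (R (f n) g)\<bar> > e" for n
    using zero by (auto simp: dual_bound_def not_le)
  then obtain g where g: "\<And>n. g n \<in> weighted_ball Y W"
    and big: "\<And>n. \<not> dual_bound Y W (\<lambda>g. T (R (f n) g)) e \<Longrightarrow> \<bar>T (R (f n) (g n))\<bar> > e"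
    by metis
  have T': "weighted_functional X (\<lambda>x. a * V x) T"
    by (rule functional_mono[OF T a]) (use V a in auto)
  have "(\<lambda>n. T (R (f n) (g n))) \<longlonglongrightarrow> T (\<lambda>x. 0)"
  proof (rule functional_tendsto[OF T'])
    fix n show "R (f n) (g n) \<in> weighted_ball X (\<lambda>x. a * V x)"
      using weighted_ballI[of _ X] meas bound f g by metis
  next
    fix x assume x: "x \<in> space X"
    show "(\<lambda>n. R (f n) (g n) x) \<longlonglongrightarrow> 0"
    proof (rule tendstoI)
      fix d :: real assume "d > 0"
      then have "d / 2 > 0" by simp
      from dual_vanishD[OF lim[OF x] this]
      have "\<forall>\<^sub>F n in sequentially. dual_bound Y W (\<lambda>g. R (f n) g x) (d/2)"
        using fl by (rule eventually_compose_filterlim)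
      then show "\<forall>\<^sub>F n in sequentially. dist (R (f n) (g n) x) 0 < d"
      proof eventually_elim
        case (elim n)
        then have "\<bar>R (f n) (g n) x\<bar> \<le> d / 2" using g by (simp add: dual_bound_def)
        then show ?case using \<open>d > 0\<close> by (simp add: dist_real_def)
      qed
    qed
  qed simp
  then have "\<forall>\<^sub>F n in sequentially. \<bar>T (R (f n) (g n))\<bar> < e"
    using tendstoD[OF _ e] functional_zero[OF T] by (fastforce simp: dist_real_def)
  then show "\<forall>\<^sub>F n in sequentially. dual_bound Y W (\<lambda>g. T (R (f n) g)) e"
    by eventually_elim (use big in force)
qed

lemma eventually_at_within_self: "\<forall>\<^sub>F v in at u within S. v \<in> S \<and> v \<noteq> u"
  by (auto simp: eventually_at_filter)

text \<open>\<open>K l\<close> stands for the derivative of order \<open>l\<close> and maps test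
  functions of weight \<open>s\<close> to functions of weight \<open>s + l\<close>. Convergence is
  uniform in \<open>g\<close> but only at fixed \<open>x\<close>, as in the hypotheses;
  \<open>K_bound\<close> and \<open>K_Lipschitz\<close> supply the domination in \<open>x\<close>
  under which a functional preserves it. Both the one-step kernels and the extension of paths by one
  coordinate are instances.\<close>

locale smooth_operators =
  fixes k :: nat and X :: "'x measure" and WX :: "nat \<Rightarrow> 'x \<Rightarrow> real"
    and Y :: "'y measure" and WY :: "nat \<Rightarrow> 'y \<Rightarrow> real"
    and K :: "nat \<Rightarrow> real \<Rightarrow> ('y \<Rightarrow> real) \<Rightarrow> 'x \<Rightarrow> real" and c :: real
  assumes WX1: "\<And>s x. x \<in> space X \<Longrightarrow> 1 \<le> WX s x"
    and WY1: "\<And>s y. y \<in> space Y \<Longrightarrow> 1 \<le> WY s y"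
    and c_pos: "c > 0"
    and K0_measurable: "\<And>s u g. s \<le> k \<Longrightarrow> u \<in> {0..1} \<Longrightarrow> g \<in> weighted_fun Y (WY s) \<Longrightarrow>
      K 0 u g \<in> borel_measurable X"
    and K_functional: "\<And>s l u x. s + l \<le> k \<Longrightarrow> u \<in> {0..1} \<Longrightarrow> x \<in> space X \<Longrightarrow>
      weighted_functional Y (WY s) (\<lambda>g. K l u g x)"
    and K_bound: "\<And>s l u x. s + l \<le> k \<Longrightarrow> u \<in> {0..1} \<Longrightarrow> x \<in> space X \<Longrightarrow>
      dual_bound Y (WY s) (\<lambda>g. K l u g x) (c * WX (s + l) x)"
    and K_cont: "\<And>s l u x. s + l \<le> k \<Longrightarrow> u \<in> {0..1} \<Longrightarrow> x \<in> space X \<Longrightarrow>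
      dual_vanish (at u within {0..1}) Y (WY s) (\<lambda>v g. K l v g x - K l u g x)"
    and K_deriv: "\<And>s l u x. s + l < k \<Longrightarrow> u \<in> {0..1} \<Longrightarrow> x \<in> space X \<Longrightarrow>
      dual_vanish (at u within {0..1}) Y (WY s)
        (\<lambda>v g. (K l v g x - K l u g x) / (v - u) - K (Suc l) u g x)"
    and K_Lipschitz: "\<And>s l u v x. s + l < k \<Longrightarrow> u \<in> {0..1} \<Longrightarrow> v \<in> {0..1} \<Longrightarrow> x \<in> space X \<Longrightarrow>
      dual_bound Y (WY s) (\<lambda>g. K l v g x - K l u g x) (\<bar>v - u\<bar> * (c * WX (Suc (s + l)) x))"
begin

lemma WX0: "x \<in> space X \<Longrightarrow> 0 \<le> WX s x"
  using WX1[of x s] by simp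

lemma WY0: "y \<in> space Y \<Longrightarrow> 0 \<le> WY s y"
  using WY1[of y s] by simp

lemma K_abs_le:
  "s + l \<le> k \<Longrightarrow> u \<in> {0..1} \<Longrightarrow> x \<in> space X \<Longrightarrow> g \<in> weighted_ball Y (WY s) \<Longrightarrow>
    \<bar>K l u g x\<bar> \<le> c * WX (s + l) x"
  using K_bound by (auto simp: dual_bound_def)

lemma K_deriv_tendsto:
  assumes "s + l < k" "u \<in> {0..1}" "x \<in> space X" "g \<in> weighted_ball Y (WY s)"
  shows "((\<lambda>v. (K l v g x - K l u g x) / (v - u)) \<longlongrightarrow> K (Suc l) u g x) (at u within {0..1})"
proof (rule tendstoI)
  fix e :: real assume "e > 0"
  then have "e / 2 > 0" by simp
  from dual_vanishD[OF K_deriv[OF assms(1-3)] this]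
  show "\<forall>\<^sub>F v in at u within {0..1}. dist ((K l v g x - K l u g x) / (v - u)) (K (Suc l) u g x) < e"
    by eventually_elim (use assms(4) \<open>e > 0\<close> in \<open>force simp: dual_bound_def dist_real_def\<close>)
qed

text \<open>Measurability in \<open>x\<close> is assumed at order 0 only; higher orders inherit it
  as sequential limits of difference quotients.\<close>

lemma K_measurable_ball:
  "s + l \<le> k \<Longrightarrow> u \<in> {0..1} \<Longrightarrow> g \<in> weighted_ball Y (WY s) \<Longrightarrow> K l u g \<in> borel_measurable X"
proof (induction l arbitrary: u)
  case 0
  then show ?case by (intro K0_measurable weighted_ball_fun) auto
next
  case (Suc l)
  have "u islimpt {0..1}" using Suc.prems(2) by (simp add: islimpt_Icc)
  then obtain f where f: "\<And>n. f n \<in> {0..1} - {u}" "f \<longlonglongrightarrow> u"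
    by (auto simp: islimpt_sequential)
  have fl: "filterlim f (at u within {0..1}) sequentially"
    using f by (auto simp: filterlim_at)
  show ?case
  proof (rule borel_measurable_LIMSEQ_real)
    show "(\<lambda>n. (K l (f n) g x - K l u g x) / (f n - u)) \<longlonglongrightarrow> K (Suc l) u g x" if "x \<in> space X" for x
      by (rule filterlim_compose[OF K_deriv_tendsto fl]) (use Suc.prems that in auto)
    show "(\<lambda>x. (K l (f n) g x - K l u g x) / (f n - u)) \<in> borel_measurable X" for n
      using f(1)[of n] Suc by (intro borel_measurable_divide borel_measurable_diff) auto
  qed
qed

lemma K_weighted_fun:
  assumes l: "s + l \<le> k" "u \<in> {0..1}" and g: "g \<in> weighted_fun Y (WY s)"
  shows "K l u g \<in> weighted_fun X (WX (s + l))"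
proof -
  obtain d where d: "d > 0" "(\<lambda>y. g y / d) \<in> weighted_ball Y (WY s)"
    using weighted_fun_ball[OF g WY0] by blast
  let ?h = "K l u (\<lambda>y. g y / d)"
  have eq: "K l u g x = d * ?h x" if "x \<in> space X" for x
    using functional_scale[OF K_functional[OF l that] weighted_ball_fun[OF d(2)], of d] d(1) by simp
  have "(\<lambda>x. d * ?h x) \<in> borel_measurable X"
    using K_measurable_ball[OF l d(2)] by simp
  then have "K l u g \<in> borel_measurable X"
    using measurable_cong[of X "K l u g" "\<lambda>x. d * ?h x" borel] eq by simp
  moreover have "\<bar>K l u g x\<bar> \<le> (d * c) * WX (s + l) x" if "x \<in> space X" for x
    using K_abs_le[OF l that d(2)] d(1) by (simp add: eq[OF that] abs_mult)
  ultimately show ?thesis by (rule weighted_funI)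
qed

lemma K_ball:
  "s + l \<le> k \<Longrightarrow> u \<in> {0..1} \<Longrightarrow> g \<in> weighted_ball Y (WY s) \<Longrightarrow>
    K l u g \<in> weighted_ball X (\<lambda>x. c * WX (s + l) x)"
  by (rule weighted_ballI[OF K_measurable_ball K_abs_le])

lemma comp_functional:
  assumes l: "s + l \<le> k" "u \<in> {0..1}" and T: "weighted_functional X (WX (s + l)) T"
  shows "weighted_functional Y (WY s) (\<lambda>g. T (K l u g))"
  unfolding weighted_functional_def
proof (intro conjI ballI allI impI)
  fix g h and a :: real assume g: "g \<in> weighted_fun Y (WY s)" and h: "h \<in> weighted_fun Y (WY s)"
  note Kg = K_weighted_fun[OF l g] and Kh = K_weighted_fun[OF l h]
  have "T (K l u (\<lambda>y. a * g y + h y)) = T (\<lambda>x. a * K l u g x + K l u h x)"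
  proof (rule functional_cong[OF T K_weighted_fun[OF l] _ WX0])
    show "(\<lambda>y. a * g y + h y) \<in> weighted_fun Y (WY s)"
      by (intro weighted_fun_add weighted_fun_scale g h)
    show "(\<lambda>x. a * K l u g x + K l u h x) \<in> weighted_fun X (WX (s + l))"
      by (intro weighted_fun_add weighted_fun_scale Kg Kh)
    fix x assume "x \<in> space X"
    then show "K l u (\<lambda>y. a * g y + h y) x = a * K l u g x + K l u h x"
      by (rule functional_linear[OF K_functional[OF l] g h])
  qed
  then show "T (K l u (\<lambda>y. a * g y + h y)) = a * T (K l u g) + T (K l u h)"
    by (simp only: functional_linear[OF T Kg Kh])
next
  fix G :: "nat \<Rightarrow> _" and g
  assume G: "\<forall>n. G n \<in> weighted_ball Y (WY s)" and g: "g \<in> borel_measurable Y"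
    and lim: "\<forall>x\<in>space Y. (\<lambda>n. G n x) \<longlonglongrightarrow> g x"
  have T': "weighted_functional X (\<lambda>x. c * WX (s + l) x) T"
    by (rule functional_mono[OF T c_pos]) (use WX0 c_pos in auto)
  have gb: "g \<in> weighted_ball Y (WY s)"
  proof (rule weighted_ballI[OF g])
    fix x assume x: "x \<in> space Y"
    show "\<bar>g x\<bar> \<le> WY s x"
      using lim G x by (intro tendsto_upperbound[where f="\<lambda>n. \<bar>G n x\<bar>" and F=sequentially])
        (auto simp: weighted_ball_def intro: tendsto_rabs)
  qed
  show "(\<lambda>n. T (K l u (G n))) \<longlonglongrightarrow> T (K l u g)"
  proof (rule functional_tendsto[OF T'])
    show "K l u (G n) \<in> weighted_ball X (\<lambda>x. c * WX (s + l) x)" for n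
      using K_ball[OF l] G by blast
    show "K l u g \<in> borel_measurable X" by (rule K_measurable_ball[OF l gb])
    show "(\<lambda>n. K l u (G n) x) \<longlonglongrightarrow> K l u g x" if "x \<in> space X" for x
      using functional_tendsto[OF K_functional[OF l that]] G g lim by blast
  qed
qed

lemma comp_bound:
  assumes l: "s + l \<le> k" "u \<in> {0..1}" and T: "weighted_functional X (WX (s + l)) T"
    and e: "dual_bound X (WX (s + l)) T e"
  shows "dual_bound Y (WY s) (\<lambda>g. T (K l u g)) (c * e)"
  unfolding dual_bound_def
proof
  fix g assume g: "g \<in> weighted_ball Y (WY s)"
  show "\<bar>T (K l u g)\<bar> \<le> c * e"
    using weighted_ballD[OF K_ball[OF l g]] c_pos by (intro dual_boundD[OF e T] WX0) auto
qed

lemma comp_cont: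
  assumes l: "s + l \<le> k" "u \<in> {0..1}" and T: "weighted_functional X (WX (s + l)) T"
  shows "dual_vanish (at u within {0..1}) Y (WY s) (\<lambda>v g. T (K l v g) - T (K l u g))"
proof -
  have "dual_vanish (at u within {0..1}) Y (WY s) (\<lambda>v g. T (\<lambda>x. K l v g x - K l u g x))"
  proof (rule functional_comp_vanish[OF T WX0 _ WY0, of "2 * c"])
    fix v g assume v: "v \<in> {0..1::real}" and g: "g \<in> weighted_ball Y (WY s)"
    show "(\<lambda>x. K l v g x - K l u g x) \<in> borel_measurable X"
      using K_measurable_ball g v l by (intro borel_measurable_diff) auto
    fix x assume x: "x \<in> space X"
    show "\<bar>K l v g x - K l u g x\<bar> \<le> 2 * c * WX (s + l) x"
      using K_abs_le[OF l x g] K_abs_le[OF l(1) v x g] by linarith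
  qed (use c_pos K_cont[OF l] in auto)
  then show ?thesis
  proof (rule dual_vanish_cong)
    show "\<forall>\<^sub>F v in at u within {0..1}. \<forall>g\<in>weighted_ball Y (WY s).
        T (\<lambda>x. K l v g x - K l u g x) = T (K l v g) - T (K l u g)"
      using eventually_at_within_self
    proof eventually_elim
      case (elim v)
      then show ?case
        using l by (intro ballI functional_diff[OF T] K_weighted_fun weighted_ball_fun) auto
    qed
  qed
qed

text \<open>\<open>K_Lipschitz\<close> dominates the difference quotients by the weight of level
  \<open>Suc (s + l)\<close>, so \<open>T\<close> has to act on that larger weight.\<close>

lemma comp_deriv:
  assumes l: "s + l < k" "u \<in> {0..1}" and T: "weighted_functional X (WX (Suc (s + l))) T"
    and mono: "\<And>x. x \<in> space X \<Longrightarrow> WX (s + l) x \<le> WX (Suc (s + l)) x"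
  shows "dual_vanish (at u within {0..1}) Y (WY s)
    (\<lambda>v g. (T (K l v g) - T (K l u g)) / (v - u) - T (K (Suc l) u g))"
proof -
  have l': "s + l \<le> k" "s + Suc l \<le> k" using l by auto
  have "dual_vanish (at u within {0..1}) Y (WY s)
      (\<lambda>v g. T (\<lambda>x. (K l v g x - K l u g x) / (v - u) - K (Suc l) u g x))"
  proof (rule functional_comp_vanish[OF T WX0 _ WY0, of "2 * c"])
    fix v g assume v: "v \<in> {0..1::real}" "v \<noteq> u" and g: "g \<in> weighted_ball Y (WY s)"
    show "(\<lambda>x. (K l v g x - K l u g x) / (v - u) - K (Suc l) u g x) \<in> borel_measurable X"
      using K_measurable_ball[OF l'(1) v(1) g] K_measurable_ball[OF l'(1) l(2) g]
        K_measurable_ball[OF l'(2) l(2) g] by simp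
    fix x assume x: "x \<in> space X"
    have "\<bar>K l v g x - K l u g x\<bar> \<le> \<bar>v - u\<bar> * (c * WX (Suc (s + l)) x)"
      using K_Lipschitz[OF l v(1) x] g by (auto simp: dual_bound_def)
    then have "\<bar>(K l v g x - K l u g x) / (v - u)\<bar> \<le> c * WX (Suc (s + l)) x"
      using v by (simp add: divide_le_eq mult.commute)
    then show "\<bar>(K l v g x - K l u g x) / (v - u) - K (Suc l) u g x\<bar> \<le> 2 * c * WX (Suc (s + l)) x"
      using K_abs_le[OF l'(2) l(2) x g]
        abs_triangle_ineq4[of "(K l v g x - K l u g x) / (v - u)" "K (Suc l) u g x"] by simp
  qed (use c_pos K_deriv[OF l] in auto)
  then show ?thesis
  proof (rule dual_vanish_cong)
    show "\<forall>\<^sub>F v in at u within {0..1}. \<forall>g\<in>weighted_ball Y (WY s).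
        T (\<lambda>x. (K l v g x - K l u g x) / (v - u) - K (Suc l) u g x) =
        (T (K l v g) - T (K l u g)) / (v - u) - T (K (Suc l) u g)"
      using eventually_at_within_self
    proof eventually_elim
      case (elim v)
      show ?case
      proof
        fix g assume g: "g \<in> weighted_ball Y (WY s)"
        have Kw: "K l w g \<in> weighted_fun X (WX (Suc (s + l)))" if "w \<in> {0..1}" for w
          by (rule weighted_fun_mono[OF K_weighted_fun[OF l'(1) that weighted_ball_fun[OF g]] WX0, of 1])
            (simp_all add: mono)
        have KS: "K (Suc l) u g \<in> weighted_fun X (WX (Suc (s + l)))"
          using K_weighted_fun[OF l'(2) l(2) weighted_ball_fun[OF g]] by simp
        have d: "(\<lambda>x. K l v g x - K l u g x) \<in> weighted_fun X (WX (Suc (s + l)))"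
          using elim l by (intro weighted_fun_diff Kw) auto
        show "T (\<lambda>x. (K l v g x - K l u g x) / (v - u) - K (Suc l) u g x) =
          (T (K l v g) - T (K l u g)) / (v - u) - T (K (Suc l) u g)"
          using functional_diff[OF T weighted_fun_scale[OF d, of "1/(v-u)"] KS]
            functional_scale[OF T d, of "1/(v-u)"] functional_diff[OF T Kw Kw, of v u] elim l
          by simp
      qed
    qed
  qed
qed

lemma comp_vanish:
  assumes l: "s + l \<le> k" and R: "dual_vanish (at u within {0..1}) X (WX (s + l)) R"
    and wf: "\<And>v. v \<in> {0..1} \<Longrightarrow> v \<noteq> u \<Longrightarrow> weighted_functional X (WX (s + l)) (R v)"
  shows "dual_vanish (at u within {0..1}) Y (WY s) (\<lambda>v g. R v (K l v g))"
  unfolding dual_vanish_def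
proof (intro allI impI)
  fix e :: real assume "e > 0"
  then have "e / c > 0" using c_pos by simp
  from dual_vanishD[OF R this] eventually_at_within_self
  show "\<forall>\<^sub>F v in at u within {0..1}. dual_bound Y (WY s) (\<lambda>g. R v (K l v g)) e"
  proof eventually_elim
    case (elim v)
    then have "dual_bound Y (WY s) (\<lambda>g. R v (K l v g)) (c * (e / c))"
      by (intro comp_bound[OF l] wf) auto
    then show ?case using c_pos by simp
  qed
qed

lemma product_cont:
  assumes l: "s + l \<le> k" "u \<in> {0..1}"
    and wf: "\<And>v. v \<in> {0..1} \<Longrightarrow> weighted_functional X (WX (s + l)) (T v)"
    and cont: "dual_vanish (at u within {0..1}) X (WX (s + l)) (\<lambda>v g. T v g - T u g)"
  shows "dual_vanish (at u within {0..1}) Y (WY s) (\<lambda>v g. T v (K l v g) - T u (K l u g))"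
proof -
  have "dual_vanish (at u within {0..1}) Y (WY s) (\<lambda>v g. T v (K l v g) - T u (K l v g))"
    by (rule comp_vanish[OF l(1) cont]) (intro functional_minus wf l)
  from dual_vanish_add[OF this comp_cont[OF l wf[OF l(2)]]] show ?thesis by simp
qed

text \<open>The error splits into \<open>((T v - T u) / (v - u) - T')\<close> applied to
  \<open>K l v g\<close>, then \<open>T'\<close> applied to \<open>K l v g - K l u g\<close>, then
  \<open>T u\<close> applied to the error of the difference quotient of \<open>K l\<close>. The last
  term requires \<open>T\<close> one level above \<open>T'\<close>.\<close>

lemma product_deriv:
  assumes l: "s + l < k" "u \<in> {0..1}"
    and wf: "\<And>v. v \<in> {0..1} \<Longrightarrow> weighted_functional X (WX (Suc (s + l))) (T v)"
    and wf': "weighted_functional X (WX (s + l)) T'"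
    and mono: "\<And>x. x \<in> space X \<Longrightarrow> WX (s + l) x \<le> WX (Suc (s + l)) x"
    and deriv: "dual_vanish (at u within {0..1}) X (WX (s + l))
      (\<lambda>v g. (T v g - T u g) / (v - u) - T' g)"
  shows "dual_vanish (at u within {0..1}) Y (WY s)
    (\<lambda>v g. (T v (K l v g) - T u (K l u g)) / (v - u) - (T' (K l u g) + T u (K (Suc l) u g)))"
proof -
  have l': "s + l \<le> k" using l by simp
  have wf0: "weighted_functional X (WX (s + l)) (T v)" if "v \<in> {0..1}" for v
    by (rule functional_mono[OF wf[OF that] zero_less_one WX0]) (simp_all add: mono)
  have "weighted_functional X (WX (s + l)) (\<lambda>g. (T v g - T u g) / (v - u) - T' g)"
    if "v \<in> {0..1}" for v
    using functional_minus[OF functional_times[OF functional_minus[OF wf0[OF that] wf0[OF l(2)]], of "1/(v-u)"] wf']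
    by simp
  then have "dual_vanish (at u within {0..1}) Y (WY s)
      (\<lambda>v g. (T v (K l v g) - T u (K l v g)) / (v - u) - T' (K l v g))"
    by (intro comp_vanish[OF l' deriv])
  from dual_vanish_add[OF dual_vanish_add[OF this comp_cont[OF l' l(2) wf']]
      comp_deriv[OF l wf[OF l(2)] mono]]
  show ?thesis by (rule dual_vanish_cong) (auto simp: diff_divide_distrib)
qed

end

section \<open>Differentiable families of functionals\<close>

text \<open>Each derivative costs one step in the scale of weights.\<close>

definition dual_Ck ::
  "nat \<Rightarrow> 'b measure \<Rightarrow> (nat \<Rightarrow> 'b \<Rightarrow> real) \<Rightarrow> (nat \<Rightarrow> real \<Rightarrow> ('b \<Rightarrow> real) \<Rightarrow> real) \<Rightarrow> bool" where
  "dual_Ck k M W T \<longleftrightarrow>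
     (\<forall>l\<le>k. \<forall>u\<in>{0..1}. weighted_functional M (W (k - l)) (T l u)) \<and>
     (\<forall>l\<le>k. \<forall>u\<in>{0..1}.
        dual_vanish (at u within {0..1}) M (W (k - l)) (\<lambda>v g. T l v g - T l u g)) \<and>
     (\<forall>l<k. \<forall>u\<in>{0..1}. dual_vanish (at u within {0..1}) M (W (k - Suc l))
        (\<lambda>v g. (T l v g - T l u g) / (v - u) - T (Suc l) u g))"

definition leibniz ::
  "(nat \<Rightarrow> real \<Rightarrow> ('x \<Rightarrow> real) \<Rightarrow> real) \<Rightarrow> (nat \<Rightarrow> real \<Rightarrow> ('y \<Rightarrow> real) \<Rightarrow> 'x \<Rightarrow> real) \<Rightarrow>
     nat \<Rightarrow> real \<Rightarrow> ('y \<Rightarrow> real) \<Rightarrow> real" where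
  "leibniz T K l u g = (\<Sum>i\<le>l. real (l choose i) * T (l - i) u (K i u g))"

text \<open>The right side is what termwise differentiation produces; Pascal's rule merges its two
  sums.\<close>

lemma leibniz_Suc:
  "leibniz T K (Suc l) u g =
     (\<Sum>i\<le>l. real (l choose i) * (T (Suc (l - i)) u (K i u g) + T (l - i) u (K (Suc i) u g)))"
proof -
  let ?a = "\<lambda>i. T (Suc l - i) u (K i u g)"
  have "(\<Sum>i\<le>l. real (l choose i) * (T (Suc (l - i)) u (K i u g) + T (l - i) u (K (Suc i) u g))) =
      (\<Sum>i\<le>l. real (l choose i) * ?a i) + (\<Sum>i\<le>l. real (l choose i) * ?a (Suc i))"
    unfolding sum.distrib[symmetric] by (intro sum.cong refl) (auto simp: Suc_diff_le algebra_simps)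
  also have "(\<Sum>i\<le>l. real (l choose i) * ?a i) = (\<Sum>i\<le>Suc l. real (l choose i) * ?a i)"
    by simp
  also have "\<dots> = ?a 0 + (\<Sum>i\<le>l. real (l choose Suc i) * ?a (Suc i))"
    by (subst sum.atMost_Suc_shift) simp
  also have "\<dots> + (\<Sum>i\<le>l. real (l choose i) * ?a (Suc i)) =
      ?a 0 + (\<Sum>i\<le>l. real (Suc l choose Suc i) * ?a (Suc i))"
    by (simp add: sum.distrib[symmetric] algebra_simps)
  also have "\<dots> = leibniz T K (Suc l) u g"
    unfolding leibniz_def by (subst sum.atMost_Suc_shift) simp
  finally show ?thesis by simp
qed

context smooth_operators begin

text \<open>The levels match: \<open>T (l - i)\<close> acts on weight
  \<open>k - (l - i) = (k - l) + i\<close>, which is where \<open>K i\<close> sends test functions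
  of weight \<open>k - l\<close>.\<close>

lemma dual_Ck_comp:
  assumes T: "dual_Ck k X WX T"
    and mono: "\<And>s x. x \<in> space X \<Longrightarrow> WX s x \<le> WX (Suc s) x"
  shows "dual_Ck k Y WY (leibniz T K)"
proof -
  have Twf: "weighted_functional X (WX (k - l)) (T l u)" if "l \<le> k" "u \<in> {0..1}" for l u
    using T that unfolding dual_Ck_def by blast
  have Tcont: "dual_vanish (at u within {0..1}) X (WX (k - l)) (\<lambda>v g. T l v g - T l u g)"
    if "l \<le> k" "u \<in> {0..1}" for l u
    using T that unfolding dual_Ck_def by blast
  have Tderiv: "dual_vanish (at u within {0..1}) X (WX (k - Suc l))
      (\<lambda>v g. (T l v g - T l u g) / (v - u) - T (Suc l) u g)" if "l < k" "u \<in> {0..1}" for l u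
    using T that unfolding dual_Ck_def by blast
  have idx: "k - l + i = k - (l - i)" if "i \<le> l" "l \<le> k" for i l using that by simp
  have wf: "weighted_functional X (WX (k - l + i)) (T (l - i) u)" if "i \<le> l" "l \<le> k" "u \<in> {0..1}" for i l u
    unfolding idx[OF that(1,2)] by (rule Twf) (use that in auto)
  show ?thesis
    unfolding dual_Ck_def
  proof (intro conjI allI impI ballI)
    fix l and u :: real assume l: "l \<le> k" and u: "u \<in> {0..1}"
    show "weighted_functional Y (WY (k - l)) (leibniz T K l u)"
      unfolding leibniz_def
      by (intro functional_Sum functional_times comp_functional wf) (use l u in auto)
    have "dual_vanish (at u within {0..1}) Y (WY (k - l))
      (\<lambda>v g. \<Sum>i\<le>l. real (l choose i) * (T (l - i) v (K i v g) - T (l - i) u (K i u g)))"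
    proof (intro dual_vanish_sum dual_vanish_times product_cont wf)
      fix i assume i: "i \<in> {..l}"
      have idx': "k - l + i = k - (l - i)" by (rule idx) (use i l in auto)
      show "dual_vanish (at u within {0..1}) X (WX (k - l + i)) (\<lambda>v g. T (l - i) v g - T (l - i) u g)"
        unfolding idx' by (rule Tcont) (use l u in auto)
    qed (use l u in auto)
    then show "dual_vanish (at u within {0..1}) Y (WY (k - l)) (\<lambda>v g. leibniz T K l v g - leibniz T K l u g)"
      by (simp add: leibniz_def sum_subtractf[symmetric] algebra_simps)
  next
    fix l and u :: real assume l: "l < k" and u: "u \<in> {0..1}"
    have "dual_vanish (at u within {0..1}) Y (WY (k - Suc l))
      (\<lambda>v g. \<Sum>i\<le>l. real (l choose i) * ((T (l - i) v (K i v g) - T (l - i) u (K i u g)) / (v - u)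
         - (T (Suc (l - i)) u (K i u g) + T (l - i) u (K (Suc i) u g))))"
    proof (intro dual_vanish_sum dual_vanish_times product_deriv mono)
      fix i assume i: "i \<in> {..l}"
      have idx': "k - Suc l + i = k - Suc (l - i)" "Suc (k - Suc l + i) = k - (l - i)"
        using i l by auto
      show "dual_vanish (at u within {0..1}) X (WX (k - Suc l + i))
          (\<lambda>v g. (T (l - i) v g - T (l - i) u g) / (v - u) - T (Suc (l - i)) u g)"
        unfolding idx' by (rule Tderiv) (use l u in auto)
      show "weighted_functional X (WX (Suc (k - Suc l + i))) (T (l - i) v)" if "v \<in> {0..1}" for v
        unfolding idx'(2) by (rule Twf) (use l that in auto)
      show "weighted_functional X (WX (k - Suc l + i)) (T (Suc (l - i)) u)"
        unfolding idx' by (rule Twf) (use l u i in auto)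
    qed (use l u in auto)
    then show "dual_vanish (at u within {0..1}) Y (WY (k - Suc l))
        (\<lambda>v g. (leibniz T K l v g - leibniz T K l u g) / (v - u) - leibniz T K (Suc l) u g)"
      unfolding leibniz_Suc
      by (simp add: leibniz_def sum_subtractf[symmetric] sum_divide_distrib algebra_simps diff_divide_distrib)
  qed
qed

end

text \<open>An equation \<open>T (I - K) = S\<close> can be differentiated when \<open>I - K\<close> is stable
  on the functionals of total mass zero.\<close>

lemma dual_Ck_fixpoint:
  fixes T :: "nat \<Rightarrow> real \<Rightarrow> ('b \<Rightarrow> real) \<Rightarrow> real"
  assumes K: "smooth_operators k M W M W K c"
    and mono: "\<And>s x. x \<in> space M \<Longrightarrow> W s x \<le> W (Suc s) x"
    and wf: "\<And>l u. l \<le> k \<Longrightarrow> u \<in> {0..1} \<Longrightarrow> weighted_functional M (W (k - l)) (T l u)"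
    and mass: "\<And>l u v. l \<le> k \<Longrightarrow> u \<in> {0..1} \<Longrightarrow> v \<in> {0..1} \<Longrightarrow> T l u (\<lambda>_. 1) = T l v (\<lambda>_. 1)"
    and mass': "\<And>l u. l < k \<Longrightarrow> u \<in> {0..1} \<Longrightarrow> T (Suc l) u (\<lambda>_. 1) = 0"
    and fixpoint: "\<And>l u g. l \<le> k \<Longrightarrow> u \<in> {0..1} \<Longrightarrow> g \<in> weighted_ball M (W (k - l)) \<Longrightarrow>
      T l u g = leibniz T K l u g"
    and stab: "\<And>s. stab s > 0"
    and stable: "\<And>s u S e. s \<le> k \<Longrightarrow> u \<in> {0..1} \<Longrightarrow> weighted_functional M (W s) S \<Longrightarrow>
      S (\<lambda>_. 1) = 0 \<Longrightarrow> dual_bound M (W s) (\<lambda>g. S g - S (K 0 u g)) e \<Longrightarrow>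
      dual_bound M (W s) S (stab s * e)"
  shows "dual_Ck k M W T"
proof -
  interpret smooth_operators k M W M W K c by fact
  \<comment> \<open>Stability is used with the operator at the moving parameter \<open>v\<close>;
    this works because \<open>stab s\<close> does not depend on it.\<close>
  have stable_vanish: "dual_vanish (at u within {0..1}) M (W s) S"
    if s: "s \<le> k" and S: "\<And>v. v \<in> {0..1} \<Longrightarrow> v \<noteq> u \<Longrightarrow> weighted_functional M (W s) (S v)"
      "\<And>v. v \<in> {0..1} \<Longrightarrow> v \<noteq> u \<Longrightarrow> S v (\<lambda>_. 1) = 0"
      and van: "dual_vanish (at u within {0..1}) M (W s) (\<lambda>v g. S v g - S v (K 0 v g))"
    for s S and u :: real
    unfolding dual_vanish_def
  proof (intro allI impI)
    fix e :: real assume "e > 0"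
    then have "e / stab s > 0" using stab[of s] by simp
    from dual_vanishD[OF van this] eventually_at_within_self
    show "\<forall>\<^sub>F v in at u within {0..1}. dual_bound M (W s) (S v) e"
    proof eventually_elim
      case (elim v)
      then have "dual_bound M (W s) (S v) (stab s * (e / stab s))"
        by (intro stable[OF s] S) auto
      then show ?case using stab[of s] by simp
    qed
  qed
  let ?cont = "\<lambda>l. \<forall>u\<in>{0..1}. dual_vanish (at u within {0..1}) M (W (k - l)) (\<lambda>v g. T l v g - T l u g)"
  let ?deriv = "\<lambda>l. \<forall>u\<in>{0..1}. dual_vanish (at u within {0..1}) M (W (k - Suc l))
        (\<lambda>v g. (T l v g - T l u g) / (v - u) - T (Suc l) u g)"
  have split: "T l u g - T l u (K 0 u g) = (\<Sum>i\<in>{1..l}. real (l choose i) * T (l - i) u (K i u g))"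
    if "l \<le> k" "u \<in> {0..1}" "g \<in> weighted_ball M (W (k - l))" for l u g
  proof -
    have "{..l} = insert 0 {1..l}" by auto
    then show ?thesis using fixpoint[OF that] by (simp add: leibniz_def)
  qed
  \<comment> \<open>Strong induction with both properties together: order \<open>l\<close> only
    involves the orders \<open>l - i\<close> with \<open>i \<ge> 1\<close> and the fixed functionals
    at \<open>u\<close>.\<close>
  have "(l \<le> k \<longrightarrow> ?cont l) \<and> (l < k \<longrightarrow> ?deriv l)" for l
  proof (induction l rule: less_induct)
    case (less l)
    show ?case
    proof (intro conjI impI ballI)
      fix u :: real assume l: "l \<le> k" and u: "u \<in> {0..1}"
      let ?S = "\<lambda>v g. T l v g - T l u g"
      show "dual_vanish (at u within {0..1}) M (W (k - l)) ?S"
      proof (rule stable_vanish)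
        show "weighted_functional M (W (k - l)) (?S v)" if "v \<in> {0..1}" for v
          by (intro functional_minus wf l that u)
        show "?S v (\<lambda>_. 1) = 0" if "v \<in> {0..1}" for v using mass[OF l that u] by simp
        \<comment> \<open>Applying \<open>I - K 0 v\<close> to the increment eliminates the unknown
          \<open>T l v\<close>: the fixed point equation replaces it by lower orders, and
          \<open>T l u\<close> meets only the difference \<open>K 0 v - K 0 u\<close>.\<close>
        have "dual_vanish (at u within {0..1}) M (W (k - l))
            (\<lambda>v g. (\<Sum>i\<in>{1..l}. real (l choose i) * (T (l - i) v (K i v g) - T (l - i) u (K i u g)))
               + (T l u (K 0 v g) - T l u (K 0 u g)))"
        proof (intro dual_vanish_add dual_vanish_sum dual_vanish_times product_cont comp_cont)
          fix i assume i: "i \<in> {1..l}"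
          have idx: "k - l + i = k - (l - i)" using i l by auto
          show "dual_vanish (at u within {0..1}) M (W (k - l + i)) (\<lambda>v g. T (l - i) v g - T (l - i) u g)"
            using less.IH[of "l - i"] i l u unfolding idx by auto
          show "weighted_functional M (W (k - l + i)) (T (l - i) v)" if "v \<in> {0..1}" for v
            unfolding idx using l that by (intro wf) auto
        qed (use l u wf[of l u] in \<open>auto intro: dual_vanish_null\<close>)
        then show "dual_vanish (at u within {0..1}) M (W (k - l)) (\<lambda>v g. ?S v g - ?S v (K 0 v g))"
        proof (rule dual_vanish_cong)
          show "\<forall>\<^sub>F v in at u within {0..1}. \<forall>g\<in>weighted_ball M (W (k - l)).
             (\<Sum>i\<in>{1..l}. real (l choose i) * (T (l - i) v (K i v g) - T (l - i) u (K i u g)))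
               + (T l u (K 0 v g) - T l u (K 0 u g)) = ?S v g - ?S v (K 0 v g)"
            using eventually_at_within_self
          proof eventually_elim
            case (elim v)
            show ?case
            proof
              fix g assume "g \<in> weighted_ball M (W (k - l))"
              from split[OF l _ this, of v] split[OF l u this] elim
              show "(\<Sum>i\<in>{1..l}. real (l choose i) * (T (l - i) v (K i v g) - T (l - i) u (K i u g)))
               + (T l u (K 0 v g) - T l u (K 0 u g)) = ?S v g - ?S v (K 0 v g)"
                by (simp add: right_diff_distrib sum_subtractf)
            qed
          qed
        qed
      qed simp
    next
      fix u :: real assume l: "l < k" and u: "u \<in> {0..1}"
      let ?s = "k - Suc l"
      let ?S = "\<lambda>v g. (T l v g - T l u g) / (v - u) - T (Suc l) u g"
      have lk: "l \<le> k" "Suc l \<le> k" and s: "Suc ?s = k - l" using l by auto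
      have mono_s: "W ?s x \<le> W (k - l) x" if "x \<in> space M" for x
        using mono[OF that, of ?s] by (simp add: s)
      have wf0: "weighted_functional M (W ?s) (T l v)" if "v \<in> {0..1}" for v
        by (rule functional_mono[OF wf[OF lk(1) that] zero_less_one WX0]) (auto simp: mono_s)
      show "dual_vanish (at u within {0..1}) M (W ?s) ?S"
      proof (rule stable_vanish)
        show "weighted_functional M (W ?s) (?S v)" if "v \<in> {0..1}" for v
          using functional_minus[OF functional_times[OF functional_minus[OF wf0[OF that] wf0[OF u]], of "1/(v-u)"]
              wf[OF lk(2) u]] by simp
        show "?S v (\<lambda>_. 1) = 0" if "v \<in> {0..1}" for v
          using mass[OF lk(1) that u] mass'[OF l u] by simp
        \<comment> \<open>The same elimination for the difference quotient. What remains are product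
          rule errors of lower orders, the differentiation error of \<open>K 0\<close> under
          \<open>T l u\<close>, and its continuity error under \<open>T (Suc l) u\<close>.\<close>
        have "dual_vanish (at u within {0..1}) M (W ?s)
            (\<lambda>v g. (\<Sum>i\<in>{1..l}. real (l choose i) *
                 ((T (l - i) v (K i v g) - T (l - i) u (K i u g)) / (v - u)
                   - (T (Suc (l - i)) u (K i u g) + T (l - i) u (K (Suc i) u g))))
               + ((T l u (K 0 v g) - T l u (K 0 u g)) / (v - u) - T l u (K (Suc 0) u g))
               + (T (Suc l) u (K 0 v g) - T (Suc l) u (K 0 u g)))"
        proof (intro dual_vanish_add dual_vanish_sum dual_vanish_times product_deriv comp_deriv comp_cont mono)
          fix i assume i: "i \<in> {1..l}"
          have idx: "?s + i = k - Suc (l - i)" "Suc (?s + i) = k - (l - i)" using i l by auto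
          show "dual_vanish (at u within {0..1}) M (W (?s + i))
             (\<lambda>v g. (T (l - i) v g - T (l - i) u g) / (v - u) - T (Suc (l - i)) u g)"
            using less.IH[of "l - i"] i l u unfolding idx by auto
          show "weighted_functional M (W (Suc (?s + i))) (T (l - i) v)" if "v \<in> {0..1}" for v
            unfolding idx(2) using l that by (intro wf) auto
          show "weighted_functional M (W (?s + i)) (T (Suc (l - i)) u)"
            unfolding idx using l u i by (intro wf) auto
        qed (use l u wf[of l u] wf[of "Suc l" u] in \<open>auto simp: s\<close>)
        then show "dual_vanish (at u within {0..1}) M (W ?s) (\<lambda>v g. ?S v g - ?S v (K 0 v g))"
        proof (rule dual_vanish_cong)
          show "\<forall>\<^sub>F v in at u within {0..1}. \<forall>g\<in>weighted_ball M (W ?s).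
             (\<Sum>i\<in>{1..l}. real (l choose i) *
                 ((T (l - i) v (K i v g) - T (l - i) u (K i u g)) / (v - u)
                   - (T (Suc (l - i)) u (K i u g) + T (l - i) u (K (Suc i) u g))))
               + ((T l u (K 0 v g) - T l u (K 0 u g)) / (v - u) - T l u (K (Suc 0) u g))
               + (T (Suc l) u (K 0 v g) - T (Suc l) u (K 0 u g)) = ?S v g - ?S v (K 0 v g)"
            using eventually_at_within_self
          proof eventually_elim
            case (elim v)
            show ?case
            proof
              fix g assume g: "g \<in> weighted_ball M (W ?s)"
              then have g': "g \<in> weighted_ball M (W (k - l))"
                using mono_s by (force simp: weighted_ball_def)
              have "{..l} = insert 0 {1..l}" by auto
              then have "T (Suc l) u g = T (Suc l) u (K 0 u g) + T l u (K (Suc 0) u g) +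
                  (\<Sum>i\<in>{1..l}. real (l choose i) * (T (Suc (l - i)) u (K i u g) + T (l - i) u (K (Suc i) u g)))"
                using fixpoint[OF lk(2) u g] by (simp add: leibniz_Suc)
              moreover have "(T l v g - T l v (K 0 v g) - (T l u g - T l u (K 0 u g))) / (v - u) =
                  (\<Sum>i\<in>{1..l}. real (l choose i) * ((T (l - i) v (K i v g) - T (l - i) u (K i u g)) / (v - u)))"
                using split[OF lk(1) _ g', of v] split[OF lk(1) u g'] elim
                by (simp add: right_diff_distrib sum_subtractf sum_divide_distrib diff_divide_distrib)
              ultimately show "(\<Sum>i\<in>{1..l}. real (l choose i) *
                 ((T (l - i) v (K i v g) - T (l - i) u (K i u g)) / (v - u)
                   - (T (Suc (l - i)) u (K i u g) + T (l - i) u (K (Suc i) u g))))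
               + ((T l u (K 0 v g) - T l u (K 0 u g)) / (v - u) - T l u (K (Suc 0) u g))
               + (T (Suc l) u (K 0 v g) - T (Suc l) u (K 0 u g)) = ?S v g - ?S v (K 0 v g)"
                by (simp only: right_diff_distrib sum_subtractf) (simp add: diff_divide_distrib)
            qed
          qed
        qed
      qed simp
    qed
  qed
  then show ?thesis using wf by (auto simp: dual_Ck_def)
qed

section \<open>Kernels with smooth densities\<close>

text \<open>By the mean value theorem each increment of \<open>F\<close> is the step length times
  \<open>F'\<close> at some interior point; uniform continuity replaces that point by the left
  endpoint, with total error at most \<open>e / 2\<close>.\<close>

lemma Riemann_sum_tendsto:
  fixes F F' :: "real \<Rightarrow> real"
  assumes uv: "u < v"
    and deriv: "\<And>t. t \<in> {u..v} \<Longrightarrow> (F has_real_derivative F' t) (at t within {u..v})"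
    and cont: "continuous_on {u..v} F'"
  shows "(\<lambda>n. \<Sum>i<Suc n. (v - u) / real (Suc n) * F' (u + real i * ((v - u) / real (Suc n))))
           \<longlonglongrightarrow> F v - F u"
proof (rule tendstoI)
  fix e :: real assume e: "e > 0"
  define e' where "e' = e / (2 * (v - u))"
  have e': "e' > 0" using e uv by (simp add: e'_def)
  have "uniformly_continuous_on {u..v} F'"
    by (intro compact_uniformly_continuous cont compact_Icc)
  then obtain d where d: "d > 0"
    "\<And>s t. s \<in> {u..v} \<Longrightarrow> t \<in> {u..v} \<Longrightarrow> \<bar>s - t\<bar> < d \<Longrightarrow> \<bar>F' s - F' t\<bar> < e'"
    using e' unfolding uniformly_continuous_on_def dist_real_def by meson
  have "(\<lambda>n. (v - u) * inverse (real (Suc n))) \<longlonglongrightarrow> (v - u) * 0"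
    by (intro tendsto_intros LIMSEQ_inverse_real_of_nat)
  then have "\<forall>\<^sub>F n in sequentially. (v - u) * inverse (real (Suc n)) < d"
    using d(1) by (intro order_tendstoD) auto
  then show "\<forall>\<^sub>F n in sequentially. dist (\<Sum>i<Suc n. (v - u) / real (Suc n) *
      F' (u + real i * ((v - u) / real (Suc n)))) (F v - F u) < e"
  proof eventually_elim
    case (elim n)
    define h where "h = (v - u) / real (Suc n)"
    have h: "h > 0" "h < d" and nh: "real (Suc n) * h = v - u"
      using elim uv by (auto simp: h_def divide_inverse)
    define t where "t i = u + real i * h" for i
    have t0: "t 0 = u" "t (Suc n) = v" using nh by (simp_all add: t_def)
    have step: "\<bar>F (t (Suc i)) - F (t i) - h * F' (t i)\<bar> \<le> h * e'" if "i < Suc n" for i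
    proof -
      have "real (Suc i) * h \<le> real (Suc n) * h" using that h(1) by (intro mult_right_mono) auto
      then have ti: "u \<le> t i" "t (Suc i) \<le> v" "t (Suc i) = t i + h"
        using h(1) nh by (auto simp: t_def algebra_simps)
      have "\<exists>x\<in>{t i<..<t (Suc i)}. F (t (Suc i)) - F (t i) = F' x * (t (Suc i) - t i)"
      proof (rule mvt_simple)
        fix x assume "t i \<le> x" "x \<le> t (Suc i)"
        then have "(F has_real_derivative F' x) (at x within {t i..t (Suc i)})"
          using ti by (intro DERIV_subset[OF deriv]) auto
        then show "(F has_derivative (*) (F' x)) (at x within {t i..t (Suc i)})"
          by (simp add: has_field_derivative_def)
      qed (use ti h in auto)
      then obtain x where x: "t i < x" "x < t (Suc i)" "F (t (Suc i)) - F (t i) = F' x * h"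
        using ti by auto
      have "\<bar>F' x - F' (t i)\<bar> < e'"
        using x ti h by (intro d(2)) auto
      have "F (t (Suc i)) - F (t i) - h * F' (t i) = h * (F' x - F' (t i))"
        using x(3) by (simp add: algebra_simps)
      then show ?thesis
        using \<open>\<bar>F' x - F' (t i)\<bar> < e'\<close> h(1) by (simp add: abs_mult)
    qed
    have "F v - F u - (\<Sum>i<Suc n. h * F' (t i)) = (\<Sum>i<Suc n. F (t (Suc i)) - F (t i) - h * F' (t i))"
      using sum_lessThan_telescope[of "\<lambda>i. F (t i)" "Suc n"] t0 by (simp only: sum_subtractf)
    also have "\<bar>\<dots>\<bar> \<le> (\<Sum>i<Suc n. h * e')"
      by (rule order_trans[OF sum_abs sum_mono]) (use step in auto)
    also have "\<dots> = real (Suc n) * h * e'" by simp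
    also have "\<dots> = e / 2" unfolding nh using uv by (simp add: e'_def field_simps)
    finally show ?case using e unfolding dist_real_def t_def h_def by linarith
  qed
qed

text \<open>Fubini's theorem is not available, since \<open>N\<close> may fail to be \<open>\<sigma>\<close>-finite; Fatou's lemma is
  applied to Riemann sums instead.\<close>

lemma L1_mean_value_less:
  fixes F F' :: "real \<Rightarrow> 'b \<Rightarrow> real"
  assumes uv: "u < v"
    and deriv: "\<And>t y. t \<in> {u..v} \<Longrightarrow> ((\<lambda>t. F t y) has_real_derivative F' t y) (at t within {u..v})"
    and cont: "\<And>y. continuous_on {u..v} (\<lambda>t. F' t y)"
    and meas: "\<And>t. t \<in> {u..v} \<Longrightarrow> F' t \<in> borel_measurable N" "G \<in> borel_measurable N"
      "w \<in> borel_measurable N"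
    and w: "\<And>y. 0 \<le> w y"
    and bound: "\<And>t. t \<in> {u..v} \<Longrightarrow> (\<integral>\<^sup>+y. ennreal (w y * \<bar>F' t y - G y\<bar>) \<partial>N) \<le> e"
  shows "(\<integral>\<^sup>+y. ennreal (w y * \<bar>F v y - F u y - (v - u) * G y\<bar>) \<partial>N) \<le> ennreal (v - u) * e"
proof -
  define h where "h n = (v - u) / real (Suc n)" for n
  define t where "t n i = u + real i * h n" for n i
  have h: "h n > 0" and nh: "real (Suc n) * h n = v - u" for n
    using uv by (auto simp: h_def)
  have t: "t n i \<in> {u..v}" if "i < Suc n" for n i
  proof -
    have "real i * h n \<le> real (Suc n) * h n" using that h[of n] by (intro mult_right_mono) auto
    then show ?thesis using nh[of n] h[of n] by (simp add: t_def del: of_nat_Suc)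
  qed
  \<comment> \<open>Riemann sums of \<open>F' - G\<close>. The step lengths add up to
    \<open>v - u\<close>, so every \<open>R n\<close> already satisfies the claimed bound, which
    Fatou's lemma passes to the limit.\<close>
  define R where "R n y = (\<Sum>i<Suc n. h n * (F' (t n i) y - G y))" for n y
  have R_lim: "(\<lambda>n. R n y) \<longlonglongrightarrow> F v y - F u y - (v - u) * G y" for y
  proof -
    have "R n y = (\<Sum>i<Suc n. h n * F' (t n i) y) - (v - u) * G y" for n
      using nh[of n] by (simp add: R_def right_diff_distrib sum_subtractf del: sum.lessThan_Suc)
    moreover have "(\<lambda>n. \<Sum>i<Suc n. h n * F' (t n i) y) \<longlonglongrightarrow> F v y - F u y"
      unfolding t_def h_def by (rule Riemann_sum_tendsto[OF uv deriv cont])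
    ultimately show ?thesis by (simp only:) (intro tendsto_intros)
  qed
  have R_meas: "R n \<in> borel_measurable N" for n
    unfolding R_def using meas t by (intro borel_measurable_sum borel_measurable_times borel_measurable_diff) auto
  have R_int: "(\<integral>\<^sup>+y. ennreal (w y * \<bar>R n y\<bar>) \<partial>N) \<le> ennreal (v - u) * e" for n
  proof -
    have "(\<integral>\<^sup>+y. ennreal (w y * \<bar>R n y\<bar>) \<partial>N)
        \<le> (\<integral>\<^sup>+y. (\<Sum>i<Suc n. ennreal (h n) * ennreal (w y * \<bar>F' (t n i) y - G y\<bar>)) \<partial>N)"
    proof (rule nn_integral_mono)
      fix y
      have "\<bar>R n y\<bar> \<le> (\<Sum>i<Suc n. h n * \<bar>F' (t n i) y - G y\<bar>)"
        unfolding R_def by (rule order_trans[OF sum_abs]) (use h[of n] in \<open>simp add: abs_mult del: sum.lessThan_Suc\<close>)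
      then have "w y * \<bar>R n y\<bar> \<le> (\<Sum>i<Suc n. h n * (w y * \<bar>F' (t n i) y - G y\<bar>))"
        using mult_left_mono[OF _ w[of y]] by (fastforce simp: sum_distrib_left algebra_simps simp del: sum.lessThan_Suc)
      then have "ennreal (w y * \<bar>R n y\<bar>) \<le> ennreal (\<Sum>i<Suc n. h n * (w y * \<bar>F' (t n i) y - G y\<bar>))"
        by (rule ennreal_leI)
      also have "\<dots> = (\<Sum>i<Suc n. ennreal (h n) * ennreal (w y * \<bar>F' (t n i) y - G y\<bar>))"
        using h[of n] w[of y] by (subst sum_ennreal[symmetric]) (auto simp: ennreal_mult less_imp_le)
      finally show "ennreal (w y * \<bar>R n y\<bar>) \<le> \<dots>" .
    qed
    also have "\<dots> = (\<Sum>i<Suc n. ennreal (h n) * (\<integral>\<^sup>+y. ennreal (w y * \<bar>F' (t n i) y - G y\<bar>) \<partial>N))"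
      using meas t by (subst nn_integral_sum) (auto simp: nn_integral_cmult simp del: sum.lessThan_Suc)
    also have "\<dots> \<le> (\<Sum>i<Suc n. ennreal (h n) * e)"
      by (intro sum_mono mult_left_mono bound t) auto
    also have "\<dots> = ennreal (real (Suc n) * h n) * e"
      using h[of n] by (simp add: ennreal_mult ennreal_of_nat_eq_real_of_nat less_imp_le mult.assoc del: sum.lessThan_Suc of_nat_Suc)
    finally show ?thesis unfolding nh .
  qed
  have "(\<integral>\<^sup>+y. ennreal (w y * \<bar>F v y - F u y - (v - u) * G y\<bar>) \<partial>N)
      = (\<integral>\<^sup>+y. liminf (\<lambda>n. ennreal (w y * \<bar>R n y\<bar>)) \<partial>N)"
    by (intro nn_integral_cong lim_imp_Liminf[symmetric] tendsto_intros R_lim) auto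
  also have "\<dots> \<le> liminf (\<lambda>n. \<integral>\<^sup>+y. ennreal (w y * \<bar>R n y\<bar>) \<partial>N)"
    by (rule nn_integral_liminf) (use R_meas meas in auto)
  also have "\<dots> \<le> ennreal (v - u) * e"
    using R_int by (intro Liminf_le) auto
  finally show ?thesis .
qed

text \<open>\<open>G = 0\<close> yields Lipschitz bounds, and \<open>G = F' u\<close> the error of
  the difference quotient. Both orders of \<open>u\<close> and \<open>v\<close> are covered.\<close>

lemma L1_mean_value:
  fixes F F' :: "real \<Rightarrow> 'b \<Rightarrow> real"
  assumes S: "closed_segment u v \<subseteq> S"
    and deriv: "\<And>t y. t \<in> S \<Longrightarrow> ((\<lambda>t. F t y) has_real_derivative F' t y) (at t within S)"
    and cont: "\<And>y. continuous_on S (\<lambda>t. F' t y)"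
    and meas: "\<And>t. t \<in> S \<Longrightarrow> F' t \<in> borel_measurable N" "G \<in> borel_measurable N"
      "w \<in> borel_measurable N"
    and w: "\<And>y. 0 \<le> w y"
    and bound: "\<And>t. t \<in> closed_segment u v \<Longrightarrow> (\<integral>\<^sup>+y. ennreal (w y * \<bar>F' t y - G y\<bar>) \<partial>N) \<le> e"
  shows "(\<integral>\<^sup>+y. ennreal (w y * \<bar>F v y - F u y - (v - u) * G y\<bar>) \<partial>N) \<le> ennreal \<bar>v - u\<bar> * e"
proof -
  consider "u < v" | "u = v" | "v < u" by linarith
  then show ?thesis
  proof cases
    case 1
    then have seg: "closed_segment u v = {u..v}" by (simp add: closed_segment_eq_real_ivl)
    have sub: "{u..v} \<subseteq> S" using S seg by simp
    have "(\<integral>\<^sup>+y. ennreal (w y * \<bar>F v y - F u y - (v - u) * G y\<bar>) \<partial>N) \<le> ennreal (v - u) * e"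
      by (rule L1_mean_value_less[OF 1 DERIV_subset[OF deriv sub] continuous_on_subset[OF cont sub] meas(1) meas(2,3) w])
        (use sub bound seg in auto)
    then show ?thesis using 1 by simp
  next
    case 3
    then have seg: "closed_segment u v = {v..u}" by (simp add: closed_segment_eq_real_ivl)
    have sub: "{v..u} \<subseteq> S" using S seg by simp
    have "(\<integral>\<^sup>+y. ennreal (w y * \<bar>F u y - F v y - (u - v) * G y\<bar>) \<partial>N) \<le> ennreal (u - v) * e"
      by (rule L1_mean_value_less[OF 3 DERIV_subset[OF deriv sub] continuous_on_subset[OF cont sub] meas(1) meas(2,3) w])
        (use sub bound seg in auto)
    moreover have "\<bar>F u y - F v y - (u - v) * G y\<bar> = \<bar>F v y - F u y - (v - u) * G y\<bar>" for y
      by (simp add: abs_if algebra_simps)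
    ultimately show ?thesis using 3 by simp
  qed simp
qed

section \<open>Functionals given by signed densities\<close>

lemma density_integrable:
  assumes c: "c \<in> N \<rightarrow>\<^sub>M Y" and H: "H \<in> borel_measurable N"
    and int: "integrable N (\<lambda>y. w y * \<bar>H y\<bar>)"
    and W: "\<And>y. y \<in> space N \<Longrightarrow> 0 \<le> W (c y)" "\<And>y. y \<in> space N \<Longrightarrow> W (c y) \<le> w y"
    and g: "g \<in> weighted_fun Y W"
  shows "integrable N (\<lambda>y. H y * g (c y))"
proof -
  obtain a where a: "\<And>y. y \<in> space Y \<Longrightarrow> \<bar>g y\<bar> \<le> a * W y"
    using g by (auto simp: weighted_fun_def)
  show ?thesis
  proof (rule Bochner_Integration.integrable_bound[OF integrable_mult_right[OF int, of "\<bar>a\<bar>"]])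
    show "(\<lambda>y. H y * g (c y)) \<in> borel_measurable N"
      using H measurable_compose[OF c weighted_fun_measurable[OF g]] by simp
    show "AE y in N. norm (H y * g (c y)) \<le> norm (\<bar>a\<bar> * (w y * \<bar>H y\<bar>))"
    proof (intro AE_I2)
      fix y assume y: "y \<in> space N"
      have "\<bar>g (c y)\<bar> \<le> \<bar>a\<bar> * W (c y)"
        using a[of "c y"] measurable_space[OF c y] W(1)[OF y]
        by (meson abs_ge_self mult_right_mono order_trans)
      also have "\<dots> \<le> \<bar>a\<bar> * w y" using W(2)[OF y] by (simp add: mult_left_mono)
      finally have "\<bar>H y\<bar> * \<bar>g (c y)\<bar> \<le> \<bar>H y\<bar> * (\<bar>a\<bar> * w y)" by (rule mult_left_mono) simp
      moreover have "0 \<le> w y" using W[OF y] by simp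
      ultimately show "norm (H y * g (c y)) \<le> norm (\<bar>a\<bar> * (w y * \<bar>H y\<bar>))"
        by (simp add: abs_mult ac_simps)
    qed
  qed
qed

lemma density_functional:
  assumes c: "c \<in> N \<rightarrow>\<^sub>M Y" and H: "H \<in> borel_measurable N"
    and int: "integrable N (\<lambda>y. w y * \<bar>H y\<bar>)"
    and W: "\<And>y. y \<in> space N \<Longrightarrow> 0 \<le> W (c y)" "\<And>y. y \<in> space N \<Longrightarrow> W (c y) \<le> w y"
  shows "weighted_functional Y W (\<lambda>g. \<integral>y. H y * g (c y) \<partial>N)"
  unfolding weighted_functional_def
proof (intro conjI ballI allI impI)
  fix g h and a :: real assume g: "g \<in> weighted_fun Y W" and h: "h \<in> weighted_fun Y W"
  have "integrable N (\<lambda>y. H y * g (c y))" "integrable N (\<lambda>y. H y * h (c y))"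
    by (rule density_integrable[OF c H int W], use g h in auto)+
  then show "(\<integral>y. H y * (a * g (c y) + h (c y)) \<partial>N) =
      a * (\<integral>y. H y * g (c y) \<partial>N) + (\<integral>y. H y * h (c y) \<partial>N)"
    by (simp add: distrib_left mult.left_commute[of _ a])
next
  fix G :: "nat \<Rightarrow> _" and g
  assume G: "\<forall>n. G n \<in> weighted_ball Y W" and g: "g \<in> borel_measurable Y"
    and lim: "\<forall>x\<in>space Y. (\<lambda>n. G n x) \<longlonglongrightarrow> g x"
  show "(\<lambda>n. \<integral>y. H y * G n (c y) \<partial>N) \<longlonglongrightarrow> (\<integral>y. H y * g (c y) \<partial>N)"
  proof (rule integral_dominated_convergence[OF _ _ int])
    show "(\<lambda>y. H y * g (c y)) \<in> borel_measurable N"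
      using H measurable_compose[OF c g] by simp
    show "(\<lambda>y. H y * G n (c y)) \<in> borel_measurable N" for n
      using H measurable_compose[OF c weighted_ballD(1)[of "G n" Y W]] G by simp
    show "AE y in N. (\<lambda>n. H y * G n (c y)) \<longlonglongrightarrow> H y * g (c y)"
      using lim measurable_space[OF c] by (intro AE_I2 tendsto_mult_left) auto
    show "AE y in N. norm (H y * G n (c y)) \<le> w y * \<bar>H y\<bar>" for n
    proof (intro AE_I2)
      fix y assume y: "y \<in> space N"
      have "\<bar>G n (c y)\<bar> \<le> w y"
        using weighted_ballD(2)[OF G[rule_format, of n] measurable_space[OF c y]] W(2)[OF y] by linarith
      then show "norm (H y * G n (c y)) \<le> w y * \<bar>H y\<bar>"
        by (simp add: abs_mult mult.commute[of "w y"] mult_left_mono)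
    qed
  qed
qed

lemma density_dual_bound:
  assumes c: "c \<in> N \<rightarrow>\<^sub>M Y" and H: "H \<in> borel_measurable N"
    and int: "integrable N (\<lambda>y. w y * \<bar>H y\<bar>)"
    and W: "\<And>y. y \<in> space N \<Longrightarrow> 0 \<le> W (c y)" "\<And>y. y \<in> space N \<Longrightarrow> W (c y) \<le> w y"
    and e: "(\<integral>y. w y * \<bar>H y\<bar> \<partial>N) \<le> e"
  shows "dual_bound Y W (\<lambda>g. \<integral>y. H y * g (c y) \<partial>N) e"
  unfolding dual_bound_def
proof
  fix g assume g: "g \<in> weighted_ball Y W"
  note i = density_integrable[OF c H int W weighted_ball_fun[OF g]]
  have "\<bar>\<integral>y. H y * g (c y) \<partial>N\<bar> \<le> (\<integral>y. \<bar>H y * g (c y)\<bar> \<partial>N)" by simp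
  also have "\<dots> \<le> (\<integral>y. w y * \<bar>H y\<bar> \<partial>N)"
  proof (rule integral_mono[OF integrable_abs[OF i] int])
    fix y assume y: "y \<in> space N"
    have "\<bar>g (c y)\<bar> \<le> w y"
      using weighted_ballD(2)[OF g measurable_space[OF c y]] W(2)[OF y] by linarith
    then show "\<bar>H y * g (c y)\<bar> \<le> w y * \<bar>H y\<bar>"
      by (simp add: abs_mult mult.commute[of "w y"] mult_left_mono)
  qed
  finally show "\<bar>\<integral>y. H y * g (c y) \<partial>N\<bar> \<le> e" using e by simp
qed

text \<open>\<open>D_bound\<close> includes \<open>l = 0\<close>, where it is a moment bound for the
  kernel itself and thus comes from the growth condition on \<open>\<phi>\<close>.
  \<open>D_limit\<close> is indexed by the order of the derivative, so the exponent carries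
  \<open>k - l\<close>.\<close>

locale smooth_kernel =
  fixes \<gamma> :: "'a::topological_space \<Rightarrow> 'a measure"
    and Q :: "real \<Rightarrow> 'a \<Rightarrow> 'a measure"
    and D :: "nat \<Rightarrow> real \<Rightarrow> 'a \<Rightarrow> 'a \<Rightarrow> real"
    and \<phi> :: "'a \<Rightarrow> real" and k :: nat and d1 q C0 :: real
  assumes sets_\<gamma>: "\<And>x. sets (\<gamma> x) = sets borel"
    and D0_measurable: "\<And>u x. u \<in> {0..1} \<Longrightarrow> D 0 u x \<in> borel_measurable borel"
    and D0_nonneg: "\<And>u x y. u \<in> {0..1} \<Longrightarrow> 0 \<le> D 0 u x y"
    and Q_density: "\<And>u x. u \<in> {0..1} \<Longrightarrow> Q u x = density (\<gamma> x) (\<lambda>y. ennreal (D 0 u x y))"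
    and Q_markov: "\<And>u. u \<in> {0..1} \<Longrightarrow> Q u \<in> borel \<rightarrow>\<^sub>M prob_algebra borel"
    and \<phi>_measurable[measurable]: "\<phi> \<in> borel_measurable borel"
    and \<phi>_ge_1: "\<And>x. 1 \<le> \<phi> x"
    and D_deriv: "\<And>l u x y. l < k \<Longrightarrow> u \<in> {0..1} \<Longrightarrow>
          ((\<lambda>v. D l v x y) has_real_derivative D (Suc l) u x y) (at u within {0..1})"
    and D_continuous: "\<And>x y. continuous_on {0..1} (\<lambda>u. D k u x y)"
    and d1: "d1 \<ge> 0" and q: "q \<ge> 0" and C0: "C0 > 0"
    and D_bound: "\<And>l d u x. l \<le> k \<Longrightarrow> 0 \<le> d \<Longrightarrow> d \<le> d1 + q * real (k - l) \<Longrightarrow> u \<in> {0..1} \<Longrightarrow>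
          (\<integral>\<^sup>+ y. ennreal (\<phi> y powr d * \<bar>D l u x y\<bar>) \<partial>\<gamma> x) \<le> ennreal (C0 * \<phi> x powr (d + q * real l))"
    and D_limit: "\<And>l u x. l \<le> k \<Longrightarrow> u \<in> {0..1} \<Longrightarrow>
          ((\<lambda>v. \<integral>\<^sup>+ y. ennreal (\<phi> y powr (d1 + q * real (k - l)) * \<bar>D l v x y - D l u x y\<bar>) \<partial>\<gamma> x)
             \<longlongrightarrow> 0) (at u within {0..1})"
begin

text \<open>\<open>s\<close> counts the derivatives that can still be taken: order \<open>l\<close>
  is controlled with the exponent \<open>deg (k - l)\<close>, which ends at \<open>d1\<close> for
  \<open>l = k\<close>.\<close>

definition deg :: "nat \<Rightarrow> real" where
  "deg s = d1 + q * real s"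

lemma deg_nonneg: "0 \<le> deg s"
  using d1 q by (simp add: deg_def)

lemma deg_mono: "s \<le> t \<Longrightarrow> deg s \<le> deg t"
  using q by (simp add: deg_def mult_left_mono)

lemma deg_add: "deg (s + l) = deg s + q * real l"
  by (simp add: deg_def algebra_simps)

lemma \<phi>_powr_mono: "d \<le> d' \<Longrightarrow> \<phi> x powr d \<le> \<phi> x powr d'"
  using \<phi>_ge_1 by (intro powr_mono) auto

lemma \<phi>_powr_ge_1: "0 \<le> d \<Longrightarrow> 1 \<le> \<phi> x powr d"
  using \<phi>_ge_1 by (intro ge_one_powr_ge_zero) auto

lemma D_cont: "l \<le> k \<Longrightarrow> continuous_on {0..1} (\<lambda>u. D l u x y)"
  using D_continuous D_deriv[of l] DERIV_continuous_on[of "{0..1}" "\<lambda>u. D l u x y" "\<lambda>u. D (Suc l) u x y"]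
  by (cases "l = k") auto

lemma D_measurable_borel: "l \<le> k \<Longrightarrow> u \<in> {0..1} \<Longrightarrow> D l u x \<in> borel_measurable borel"
proof (induction l arbitrary: u)
  case 0
  then show ?case by (simp add: D0_measurable)
next
  case (Suc l)
  have "u islimpt {0..1}" using Suc.prems(2) by (simp add: islimpt_Icc)
  then obtain f where f: "\<And>n. f n \<in> {0..1} - {u}" "f \<longlonglongrightarrow> u"
    by (auto simp: islimpt_sequential)
  have fl: "filterlim f (at u within {0..1}) sequentially"
    using f by (auto simp: filterlim_at)
  show ?case
  proof (rule borel_measurable_LIMSEQ_real)
    show "(\<lambda>n. (D l (f n) x y - D l u x y) / (f n - u)) \<longlonglongrightarrow> D (Suc l) u x y" for y
      using D_deriv[of l u x y] Suc.prems unfolding has_field_derivative_iff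
      by (intro filterlim_compose[OF _ fl]) auto
    show "(\<lambda>y. (D l (f n) x y - D l u x y) / (f n - u)) \<in> borel_measurable borel" for n
      using f(1)[of n] Suc by (intro borel_measurable_divide borel_measurable_diff) auto
  qed
qed

lemma D_measurable: "l \<le> k \<Longrightarrow> u \<in> {0..1} \<Longrightarrow> D l u x \<in> borel_measurable (\<gamma> z)"
  using D_measurable_borel measurable_cong_sets[OF sets_\<gamma> refl] by blast

lemma borel_measurable_\<gamma>: "h \<in> borel_measurable borel \<Longrightarrow> h \<in> borel_measurable (\<gamma> z)"
  using measurable_cong_sets[OF sets_\<gamma> refl] by blast

lemma \<phi>_powr_measurable_\<gamma>: "(\<lambda>y. \<phi> y powr d) \<in> borel_measurable (\<gamma> z)"
  by (rule borel_measurable_\<gamma>) measurable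

lemma D_diff_bound:
  assumes l: "l < k" and d: "0 \<le> d" "d \<le> d1 + q * real (k - Suc l)" and uv: "u \<in> {0..1}" "v \<in> {0..1}"
  shows "(\<integral>\<^sup>+ y. ennreal (\<phi> y powr d * \<bar>D l v x y - D l u x y\<bar>) \<partial>\<gamma> x)
    \<le> ennreal (\<bar>v - u\<bar> * (C0 * \<phi> x powr (d + q * real (Suc l))))"
proof -
  have "(\<integral>\<^sup>+y. ennreal (\<phi> y powr d * \<bar>D l v x y - D l u x y - (v - u) * 0\<bar>) \<partial>\<gamma> x)
      \<le> ennreal \<bar>v - u\<bar> * ennreal (C0 * \<phi> x powr (d + q * real (Suc l)))"
  proof (rule L1_mean_value[where S="{0..1}" and F'="\<lambda>t. D (Suc l) t x"])
    show seg: "closed_segment u v \<subseteq> {0..1}" using uv by (auto simp: closed_segment_eq_real_ivl)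
    show "(\<integral>\<^sup>+y. ennreal (\<phi> y powr d * \<bar>D (Suc l) t x y - 0\<bar>) \<partial>\<gamma> x)
        \<le> ennreal (C0 * \<phi> x powr (d + q * real (Suc l)))" if "t \<in> closed_segment u v" for t
      unfolding diff_0_right by (rule D_bound) (use l d seg that in auto)
  qed (use l D_deriv D_cont D_measurable \<phi>_powr_measurable_\<gamma> in auto)
  then show ?thesis using C0 by (simp add: ennreal_mult)
qed

text \<open>By \<open>L1_mean_value\<close> the error is at most the largest weighted distance
  between \<open>D (Suc l) t\<close> and \<open>D (Suc l) u\<close> for \<open>t\<close> between
  \<open>u\<close> and \<open>v\<close>, and that is small by \<open>D_limit\<close>.\<close>

lemma D_quotient_limit:
  assumes l: "l < k" and u: "u \<in> {0..1}" and e: "e > 0"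
  shows "\<forall>\<^sub>F v in at u within {0..1}.
    (\<integral>\<^sup>+ y. ennreal (\<phi> y powr (d1 + q * real (k - Suc l)) *
       \<bar>(D l v x y - D l u x y) / (v - u) - D (Suc l) u x y\<bar>) \<partial>\<gamma> x) \<le> ennreal e"
proof -
  let ?w = "\<lambda>y. \<phi> y powr (d1 + q * real (k - Suc l))"
  have "\<forall>\<^sub>F t in at u within {0..1}.
      (\<integral>\<^sup>+ y. ennreal (?w y * \<bar>D (Suc l) t x y - D (Suc l) u x y\<bar>) \<partial>\<gamma> x) < ennreal e"
    using D_limit[of "Suc l" u x] l u e by (intro order_tendstoD(2)[where y=0]) auto
  then obtain d where d: "d > 0" "\<And>t. t \<in> {0..1} \<Longrightarrow> t \<noteq> u \<Longrightarrow> dist t u < d \<Longrightarrow>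
      (\<integral>\<^sup>+ y. ennreal (?w y * \<bar>D (Suc l) t x y - D (Suc l) u x y\<bar>) \<partial>\<gamma> x) < ennreal e"
    unfolding eventually_at by auto
  have *: "(\<integral>\<^sup>+ y. ennreal (?w y * \<bar>(D l v x y - D l u x y) / (v - u) - D (Suc l) u x y\<bar>) \<partial>\<gamma> x) \<le> ennreal e"
    if v: "v \<in> {0..1}" "v \<noteq> u" "dist v u < d" for v
  proof -
    have seg: "closed_segment u v \<subseteq> {0..1}" using u v by (auto simp: closed_segment_eq_real_ivl)
    have "(\<integral>\<^sup>+y. ennreal (?w y * \<bar>D l v x y - D l u x y - (v - u) * D (Suc l) u x y\<bar>) \<partial>\<gamma> x)
      \<le> ennreal \<bar>v - u\<bar> * ennreal e"
    proof (rule L1_mean_value[where S="{0..1}" and F'="\<lambda>t. D (Suc l) t x", OF seg])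
      fix t assume t: "t \<in> closed_segment u v"
      then have "dist t u < d" using v by (auto simp: closed_segment_eq_real_ivl dist_real_def split: if_splits)
      then show "(\<integral>\<^sup>+y. ennreal (?w y * \<bar>D (Suc l) t x y - D (Suc l) u x y\<bar>) \<partial>\<gamma> x) \<le> ennreal e"
        using d(2)[of t] t seg by (cases "t = u") (auto intro: less_imp_le)
    qed (use l u D_deriv D_cont D_measurable \<phi>_powr_measurable_\<gamma> in auto)
    then have "ennreal (1 / \<bar>v - u\<bar>) * (\<integral>\<^sup>+y. ennreal (?w y * \<bar>D l v x y - D l u x y - (v - u) * D (Suc l) u x y\<bar>) \<partial>\<gamma> x)
      \<le> ennreal (1 / \<bar>v - u\<bar>) * (ennreal \<bar>v - u\<bar> * ennreal e)"
      by (rule mult_left_mono) simp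
    also have "\<dots> = ennreal e"
      using v e by (simp add: ennreal_mult[symmetric])
    also have "ennreal (1 / \<bar>v - u\<bar>) * (\<integral>\<^sup>+y. ennreal (?w y * \<bar>D l v x y - D l u x y - (v - u) * D (Suc l) u x y\<bar>) \<partial>\<gamma> x)
      = (\<integral>\<^sup>+y. ennreal (1 / \<bar>v - u\<bar>) * ennreal (?w y * \<bar>D l v x y - D l u x y - (v - u) * D (Suc l) u x y\<bar>) \<partial>\<gamma> x)"
      using u v l D_measurable[of l] D_measurable[of "Suc l"] \<phi>_powr_measurable_\<gamma>
      by (intro nn_integral_cmult[symmetric]) auto
    also have "\<dots> = (\<integral>\<^sup>+ y. ennreal (?w y * \<bar>(D l v x y - D l u x y) / (v - u) - D (Suc l) u x y\<bar>) \<partial>\<gamma> x)"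
    proof (rule nn_integral_cong)
      fix y
      have "(D l v x y - D l u x y) / (v - u) - D (Suc l) u x y =
          (D l v x y - D l u x y - (v - u) * D (Suc l) u x y) / (v - u)"
        using v by (simp add: field_simps)
      then have "1 / \<bar>v - u\<bar> * (?w y * \<bar>D l v x y - D l u x y - (v - u) * D (Suc l) u x y\<bar>) =
          ?w y * \<bar>(D l v x y - D l u x y) / (v - u) - D (Suc l) u x y\<bar>"
        by (simp only: abs_divide) simp
      then show "ennreal (1 / \<bar>v - u\<bar>) * ennreal (?w y * \<bar>D l v x y - D l u x y - (v - u) * D (Suc l) u x y\<bar>)
          = ennreal (?w y * \<bar>(D l v x y - D l u x y) / (v - u) - D (Suc l) u x y\<bar>)"
        by (subst ennreal_mult[symmetric]) auto
    qed
    finally show ?thesis .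
  qed
  show ?thesis
    unfolding eventually_at using d(1) * by auto
qed

text \<open>\<open>p x\<close> is the current state contained in \<open>x\<close>, and
  \<open>c x y\<close> records the new state \<open>y\<close>. Forgetting \<open>x\<close> gives the
  one-step operator; appending \<open>y\<close> gives the extension of a path.\<close>

definition kernel_op ::
  "('x \<Rightarrow> 'a) \<Rightarrow> ('x \<Rightarrow> 'a \<Rightarrow> 'y) \<Rightarrow> nat \<Rightarrow> real \<Rightarrow> ('y \<Rightarrow> real) \<Rightarrow> 'x \<Rightarrow> real" where
  "kernel_op p c l u g x = (\<integral>y. D l u (p x) y * g (c x y) \<partial>\<gamma> (p x))"

text \<open>\<open>A\<close> is the weight of the coordinates already fixed and
  \<open>\<phi> y powr d\<close> that of the new one, so a moment of order 0 and one of order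
  \<open>d\<close> are combined.\<close>

lemma weight_integrable:
  assumes H: "H \<in> borel_measurable (\<gamma> z)" and A: "0 \<le> A" and e: "0 \<le> e1" "0 \<le> e2"
    and b1: "(\<integral>\<^sup>+y. ennreal \<bar>H y\<bar> \<partial>\<gamma> z) \<le> ennreal e1"
    and b2: "(\<integral>\<^sup>+y. ennreal (\<phi> y powr d * \<bar>H y\<bar>) \<partial>\<gamma> z) \<le> ennreal e2"
  shows "integrable (\<gamma> z) (\<lambda>y. (A + \<phi> y powr d) * \<bar>H y\<bar>)"
    and "(\<integral>y. (A + \<phi> y powr d) * \<bar>H y\<bar> \<partial>\<gamma> z) \<le> A * e1 + e2"
proof -
  note [measurable] = H \<phi>_powr_measurable_\<gamma>
  have "(\<integral>\<^sup>+y. ennreal ((A + \<phi> y powr d) * \<bar>H y\<bar>) \<partial>\<gamma> z)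
      = (\<integral>\<^sup>+y. ennreal A * ennreal \<bar>H y\<bar> + ennreal (\<phi> y powr d * \<bar>H y\<bar>) \<partial>\<gamma> z)"
    using A by (intro nn_integral_cong) (simp add: ennreal_mult[symmetric] ennreal_plus[symmetric] algebra_simps del: ennreal_plus)
  also have "\<dots> = ennreal A * (\<integral>\<^sup>+y. ennreal \<bar>H y\<bar> \<partial>\<gamma> z) + (\<integral>\<^sup>+y. ennreal (\<phi> y powr d * \<bar>H y\<bar>) \<partial>\<gamma> z)"
    by (subst nn_integral_add) (auto simp: nn_integral_cmult)
  also have "\<dots> \<le> ennreal A * ennreal e1 + ennreal e2"
    by (intro add_mono mult_left_mono b1 b2) auto
  also have "\<dots> = ennreal (A * e1 + e2)"
    using A e by (simp add: ennreal_mult ennreal_plus)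
  finally have *: "(\<integral>\<^sup>+y. ennreal ((A + \<phi> y powr d) * \<bar>H y\<bar>) \<partial>\<gamma> z) \<le> ennreal (A * e1 + e2)" .
  show int: "integrable (\<gamma> z) (\<lambda>y. (A + \<phi> y powr d) * \<bar>H y\<bar>)"
  proof (rule integrableI_bounded)
    have "(\<integral>\<^sup>+y. ennreal (norm ((A + \<phi> y powr d) * \<bar>H y\<bar>)) \<partial>\<gamma> z)
        = (\<integral>\<^sup>+y. ennreal ((A + \<phi> y powr d) * \<bar>H y\<bar>) \<partial>\<gamma> z)"
      using A by (intro nn_integral_cong) (simp add: abs_mult)
    also have "\<dots> < \<infinity>" using * by (auto simp: less_top[symmetric] top_unique)
    finally show "(\<integral>\<^sup>+y. ennreal (norm ((A + \<phi> y powr d) * \<bar>H y\<bar>)) \<partial>\<gamma> z) < \<infinity>" .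
  qed measurable
  show "(\<integral>y. (A + \<phi> y powr d) * \<bar>H y\<bar> \<partial>\<gamma> z) \<le> A * e1 + e2"
  proof -
    have "ennreal (\<integral>y. (A + \<phi> y powr d) * \<bar>H y\<bar> \<partial>\<gamma> z) \<le> ennreal (A * e1 + e2)"
      using * A by (subst (asm) nn_integral_eq_integral[OF int]) (auto simp del: ennreal_plus)
    then show ?thesis using A e by (subst (asm) ennreal_le_iff) auto
  qed
qed

lemma nn_powr_mono:
  assumes "d \<le> d'" "(\<integral>\<^sup>+y. ennreal (\<phi> y powr d' * \<bar>H y\<bar>) \<partial>\<gamma> z) \<le> e"
  shows "(\<integral>\<^sup>+y. ennreal (\<phi> y powr d * \<bar>H y\<bar>) \<partial>\<gamma> z) \<le> e"
  by (rule order_trans[OF nn_integral_mono assms(2)])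
    (auto intro!: ennreal_leI mult_right_mono \<phi>_powr_mono assms(1))

lemma nn_powr_0:
  "(\<integral>\<^sup>+y. ennreal (\<phi> y powr 0 * \<bar>H y\<bar>) \<partial>\<gamma> z) = (\<integral>\<^sup>+y. ennreal \<bar>H y\<bar> \<partial>\<gamma> z)"
proof (intro nn_integral_cong)
  fix y show "ennreal (\<phi> y powr 0 * \<bar>H y\<bar>) = ennreal \<bar>H y\<bar>"
    using \<phi>_ge_1[of y] by simp
qed

lemma kernel_op_0:
  assumes u: "u \<in> {0..1}" and g: "(\<lambda>y. g (c x y)) \<in> borel_measurable borel"
  shows "kernel_op p c 0 u g x = (\<integral>y. g (c x y) \<partial>Q u (p x))"
  unfolding kernel_op_def Q_density[OF u]
  by (subst integral_density) (use borel_measurable_\<gamma>[OF g] D_measurable[of 0] D0_nonneg u in auto)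

text \<open>A derivative of order \<open>l\<close> has plain L1 norm of size
  \<open>\<phi> (p x) powr (q * l)\<close>, and it multiplies the weight already accumulated;
  \<open>WX_mult\<close> states that level \<open>s + l\<close> absorbs this product. In the
  constant \<open>C0 * (cX + 1)\<close>, \<open>cX\<close> pays for the old coordinates and 1 for
  the new one.\<close>

lemma smooth_operators_kernel_op:
  assumes p: "p \<in> X \<rightarrow>\<^sub>M borel" and c: "(\<lambda>(x, y). c x y) \<in> X \<Otimes>\<^sub>M borel \<rightarrow>\<^sub>M Y"
    and WX1: "\<And>s x. x \<in> space X \<Longrightarrow> 1 \<le> WX s x"
    and WY1: "\<And>s y. y \<in> space Y \<Longrightarrow> 1 \<le> WY s y"
    and WY: "\<And>s x y. x \<in> space X \<Longrightarrow> WY s (c x y) \<le> WX s x + \<phi> y powr deg s"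
    and WX: "\<And>s x. x \<in> space X \<Longrightarrow> \<phi> (p x) powr deg s \<le> WX s x"
    and WX_mult: "\<And>s l x. x \<in> space X \<Longrightarrow> WX s x * \<phi> (p x) powr (q * real l) \<le> cX * WX (s + l) x"
    and cX: "cX > 0"
  shows "smooth_operators k X WX Y WY (kernel_op p c) (C0 * (cX + 1))"
proof -
  have cm: "c x \<in> \<gamma> z \<rightarrow>\<^sub>M Y" if "x \<in> space X" for x z
    using measurable_compose[OF measurable_Pair1'[OF that] c]
    by (simp add: measurable_cong_sets[OF sets_\<gamma> refl])
  have WX0: "0 \<le> WX s x" if "x \<in> space X" for s x using WX1[OF that, of s] by simp
  have WY0: "0 \<le> WY s (c x y)" if "x \<in> space X" for s x y
  proof -
    have "c x y \<in> space Y" using measurable_space[OF cm[OF that, of undefined], of y] sets_eq_imp_space_eq[OF sets_\<gamma>] by simp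
    then show ?thesis using WY1[of "c x y" s] by simp
  qed
  have total: "WX s x * (a * (C0 * \<phi> (p x) powr (q * real l))) + a * (C0 * \<phi> (p x) powr (deg (s + l)))
      \<le> a * (C0 * (cX + 1) * WX (s + l) x)" if "x \<in> space X" "0 \<le> a" for s x l a
  proof -
    have "WX s x * \<phi> (p x) powr (q * real l) + \<phi> (p x) powr (deg (s + l)) \<le> cX * WX (s + l) x + WX (s + l) x"
      by (intro add_mono WX_mult WX that)
    from mult_left_mono[OF this, of "a * C0"] show ?thesis
      using C0 that by (simp add: algebra_simps)
  qed
  have degk: "deg s \<le> d1 + q * real (k - l)" if "s + l \<le> k" for s l
    using deg_mono[of s "k - l"] that by (simp add: deg_def)
  have degk0: "0 \<le> d1 + q * real (k - l)" for l using d1 q by simp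
  have deg_eq: "deg s + q * real l = deg (s + l)" for s l by (simp add: deg_def algebra_simps)
  have D_int: "integrable (\<gamma> (p x)) (\<lambda>y. (WX s x + \<phi> y powr deg s) * \<bar>D l u (p x) y\<bar>)"
    and D_le: "(\<integral>y. (WX s x + \<phi> y powr deg s) * \<bar>D l u (p x) y\<bar> \<partial>\<gamma> (p x)) \<le> C0 * (cX + 1) * WX (s + l) x"
    if l: "s + l \<le> k" "u \<in> {0..1}" and x: "x \<in> space X" for s l u x
  proof -
    have b1: "(\<integral>\<^sup>+y. ennreal \<bar>D l u (p x) y\<bar> \<partial>\<gamma> (p x)) \<le> ennreal (C0 * \<phi> (p x) powr (q * real l))"
      using D_bound[OF _ order_refl degk0 l(2), of l "p x"] l(1) by (simp only: nn_powr_0 add_0_left)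
    have b2: "(\<integral>\<^sup>+y. ennreal (\<phi> y powr deg s * \<bar>D l u (p x) y\<bar>) \<partial>\<gamma> (p x)) \<le> ennreal (C0 * \<phi> (p x) powr (deg (s + l)))"
      using D_bound[of l "deg s" u "p x"] l degk[OF l(1)] deg_nonneg by (simp add: deg_eq)
    have m: "D l u (p x) \<in> borel_measurable (\<gamma> (p x))" using l by (intro D_measurable) auto
    note w = weight_integrable[OF m WX0[OF x, of s] _ _ b1 b2]
    show "integrable (\<gamma> (p x)) (\<lambda>y. (WX s x + \<phi> y powr deg s) * \<bar>D l u (p x) y\<bar>)"
      using C0 by (intro w(1)) auto
    have "(\<integral>y. (WX s x + \<phi> y powr deg s) * \<bar>D l u (p x) y\<bar> \<partial>\<gamma> (p x))
        \<le> WX s x * (C0 * \<phi> (p x) powr (q * real l)) + C0 * \<phi> (p x) powr (deg (s + l))"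
      using C0 by (intro w(2)) auto
    also have "\<dots> \<le> C0 * (cX + 1) * WX (s + l) x" using total[OF x, of 1 s l] by simp
    finally show "(\<integral>y. (WX s x + \<phi> y powr deg s) * \<bar>D l u (p x) y\<bar> \<partial>\<gamma> (p x)) \<le> C0 * (cX + 1) * WX (s + l) x" .
  qed
  have g_int: "integrable (\<gamma> (p x)) (\<lambda>y. D l u (p x) y * g (c x y))"
    if l: "s + l \<le> k" "u \<in> {0..1}" and x: "x \<in> space X" and g: "g \<in> weighted_fun Y (WY s)" for s l u x g
    using l x by (intro density_integrable[OF cm[OF x] D_measurable D_int[OF l x] WY0 WY g]) auto
  have H_bound: "dual_bound Y (WY s) (\<lambda>g. \<integral>y. H y * g (c x y) \<partial>\<gamma> (p x)) (WX s x * e1 + e2)"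
    if "H \<in> borel_measurable (\<gamma> (p x))" "x \<in> space X" "0 \<le> e1" "0 \<le> e2"
      "(\<integral>\<^sup>+y. ennreal \<bar>H y\<bar> \<partial>\<gamma> (p x)) \<le> ennreal e1"
      "(\<integral>\<^sup>+y. ennreal (\<phi> y powr deg s * \<bar>H y\<bar>) \<partial>\<gamma> (p x)) \<le> ennreal e2" for H x e1 e2 s
    by (rule density_dual_bound[OF cm[OF that(2)] that(1) weight_integrable(1)[OF that(1) WX0 that(3-6)] WY0 WY
          weight_integrable(2)[OF that(1) WX0 that(3-6)]]) (use that in auto)
  \<comment> \<open>If both moments are at most \<open>e / (WX s x + 1)\<close>, the bound of
    \<open>H_bound\<close> adds up to \<open>e\<close>. The threshold may depend on
    \<open>x\<close>, since convergence is required at fixed \<open>x\<close>.\<close>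
  have H_vanish: "dual_bound Y (WY s) (\<lambda>g. \<integral>y. H y * g (c x y) \<partial>\<gamma> (p x)) e"
    if H: "H \<in> borel_measurable (\<gamma> (p x))" "x \<in> space X" "0 < e" "deg s \<le> d"
      "(\<integral>\<^sup>+y. ennreal (\<phi> y powr d * \<bar>H y\<bar>) \<partial>\<gamma> (p x)) \<le> ennreal (e / (WX s x + 1))" for H x e d s
  proof -
    have pos: "WX s x + 1 > 0" using WX0[OF H(2), of s] by simp
    have "dual_bound Y (WY s) (\<lambda>g. \<integral>y. H y * g (c x y) \<partial>\<gamma> (p x))
        (WX s x * (e / (WX s x + 1)) + e / (WX s x + 1))"
    proof (rule H_bound[OF H(1,2)])
      show "(\<integral>\<^sup>+y. ennreal \<bar>H y\<bar> \<partial>\<gamma> (p x)) \<le> ennreal (e / (WX s x + 1))"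
        using nn_powr_mono[OF order_trans[OF deg_nonneg H(4)] H(5)] by (simp only: nn_powr_0)
    qed (use nn_powr_mono[OF H(4,5)] pos H(3) in auto)
    moreover have "WX s x * (e / (WX s x + 1)) + e / (WX s x + 1) = (WX s x + 1) * (e / (WX s x + 1))"
      by (simp only: distrib_right mult_1_left)
    moreover have "(WX s x + 1) * (e / (WX s x + 1)) = e" using pos by simp
    ultimately show ?thesis by simp
  qed
  show ?thesis
  proof
    show "1 \<le> WX s x" if "x \<in> space X" for s x by (rule WX1[OF that])
    show "1 \<le> WY s y" if "y \<in> space Y" for s y by (rule WY1[OF that])
    show "C0 * (cX + 1) > 0" using C0 cX by simp
  next
    fix s u g assume "s \<le> k" and u: "u \<in> {0..1::real}" and g: "g \<in> weighted_fun Y (WY s)"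
    have Qp: "(\<lambda>x. Q u (p x)) \<in> X \<rightarrow>\<^sub>M subprob_algebra borel"
      by (rule measurable_compose[OF p measurable_prob_algebraD[OF Q_markov[OF u]]])
    have gm: "g \<in> borel_measurable Y" by (rule weighted_fun_measurable[OF g])
    have cb: "c x \<in> borel \<rightarrow>\<^sub>M Y" if "x \<in> space X" for x
      using measurable_compose[OF measurable_Pair1'[OF that] c] by simp
    \<comment> \<open>At order 0 the integral is one against the Markov kernel \<open>Q u\<close>,
      whose measurability as a map into measures gives measurability in \<open>x\<close>.\<close>
    have "(\<lambda>x. \<integral>y. g y \<partial>distr (Q u (p x)) Y (c x)) \<in> borel_measurable X"
      by (rule measurable_compose[OF measurable_distr2[OF c Qp] integral_measurable_subprob_algebra[OF gm]])
    moreover have "(\<integral>y. g y \<partial>distr (Q u (p x)) Y (c x)) = kernel_op p c 0 u g x" if x: "x \<in> space X" for x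
    proof -
      have "sets (Q u (p x)) = sets borel" using Q_density[OF u] sets_\<gamma> by simp
      then have "c x \<in> Q u (p x) \<rightarrow>\<^sub>M Y" using cb[OF x] measurable_cong_sets by blast
      then show ?thesis
        using measurable_compose[OF cb[OF x] gm] gm by (subst integral_distr) (auto simp: kernel_op_0[OF u])
    qed
    ultimately show "kernel_op p c 0 u g \<in> borel_measurable X"
      by (simp cong: measurable_cong)
  next
    fix s l u x assume l: "s + l \<le> k" "u \<in> {0..1::real}" and x: "x \<in> space X"
    have m: "D l v (p x) \<in> borel_measurable (\<gamma> (p x))" if "v \<in> {0..1}" for v
      using l that by (intro D_measurable) auto
    show "weighted_functional Y (WY s) (\<lambda>g. kernel_op p c l u g x)"
      unfolding kernel_op_def
      by (rule density_functional[OF cm[OF x] m[OF l(2)] D_int[OF l x]]) (use WY0 WY x in auto)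
    show "dual_bound Y (WY s) (\<lambda>g. kernel_op p c l u g x) (C0 * (cX + 1) * WX (s + l) x)"
      unfolding kernel_op_def
      by (rule density_dual_bound[OF cm[OF x] m[OF l(2)] D_int[OF l x] _ _ D_le[OF l x]]) (use WY0 WY x in auto)
    show "dual_vanish (at u within {0..1}) Y (WY s) (\<lambda>v g. kernel_op p c l v g x - kernel_op p c l u g x)"
      unfolding dual_vanish_def
    proof (intro allI impI)
      fix e :: real assume e: "e > 0"
      then have "e / (WX s x + 1) > 0" using WX0[OF x, of s] by (simp add: add_nonneg_pos)
      then have "\<forall>\<^sub>F v in at u within {0..1}.
          (\<integral>\<^sup>+y. ennreal (\<phi> y powr (d1 + q * real (k - l)) * \<bar>D l v (p x) y - D l u (p x) y\<bar>) \<partial>\<gamma> (p x))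
            < ennreal (e / (WX s x + 1))"
        using D_limit[of l u "p x"] l by (intro order_tendstoD(2)[where y=0]) auto
      with eventually_at_within_self
      show "\<forall>\<^sub>F v in at u within {0..1}.
          dual_bound Y (WY s) (\<lambda>g. kernel_op p c l v g x - kernel_op p c l u g x) e"
      proof eventually_elim
        case (elim v)
        have "dual_bound Y (WY s) (\<lambda>g. \<integral>y. (D l v (p x) y - D l u (p x) y) * g (c x y) \<partial>\<gamma> (p x)) e"
          using elim m[of u] m[of v] l by (intro H_vanish[OF _ x e degk[OF l(1)]] borel_measurable_diff) auto
        then show ?case
          using g_int[OF l(1) _ x weighted_ball_fun] elim l
          by (simp add: dual_bound_def kernel_op_def left_diff_distrib)
      qed
    qed
  next
    fix s l u x assume l: "s + l < k" and u: "u \<in> {0..1::real}" and x: "x \<in> space X"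
    have l': "s + l \<le> k" "s + Suc l \<le> k" "l < k" using l by auto
    have m: "D l v (p x) \<in> borel_measurable (\<gamma> (p x))" "D (Suc l) v (p x) \<in> borel_measurable (\<gamma> (p x))"
      if "v \<in> {0..1}" for v
      using l that by (auto intro!: D_measurable)
    show "dual_vanish (at u within {0..1}) Y (WY s)
        (\<lambda>v g. (kernel_op p c l v g x - kernel_op p c l u g x) / (v - u) - kernel_op p c (Suc l) u g x)"
      unfolding dual_vanish_def
    proof (intro allI impI)
      fix e :: real assume e: "e > 0"
      then have "e / (WX s x + 1) > 0" using WX0[OF x, of s] by (simp add: add_nonneg_pos)
      from D_quotient_limit[OF l'(3) u this, of "p x"] eventually_at_within_self
      show "\<forall>\<^sub>F v in at u within {0..1}. dual_bound Y (WY s)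
        (\<lambda>g. (kernel_op p c l v g x - kernel_op p c l u g x) / (v - u) - kernel_op p c (Suc l) u g x) e"
      proof eventually_elim
        case (elim v)
        have "dual_bound Y (WY s) (\<lambda>g. \<integral>y. ((D l v (p x) y - D l u (p x) y) / (v - u) - D (Suc l) u (p x) y) * g (c x y) \<partial>\<gamma> (p x)) e"
          using elim m u by (intro H_vanish[OF _ x e degk[OF l'(2)]] borel_measurable_diff borel_measurable_divide) auto
        then show ?case
          using g_int[OF l'(1) _ x weighted_ball_fun] g_int[OF l'(2) u x weighted_ball_fun] elim u
          by (simp add: dual_bound_def kernel_op_def left_diff_distrib diff_divide_distrib)
      qed
    qed
    fix v assume v: "v \<in> {0..1::real}"
    have "dual_bound Y (WY s) (\<lambda>g. \<integral>y. (D l v (p x) y - D l u (p x) y) * g (c x y) \<partial>\<gamma> (p x))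
       (WX s x * (\<bar>v - u\<bar> * (C0 * \<phi> (p x) powr (q * real (Suc l)))) + \<bar>v - u\<bar> * (C0 * \<phi> (p x) powr (deg (s + Suc l))))"
    proof (rule H_bound[OF _ x])
      show "(\<integral>\<^sup>+y. ennreal \<bar>D l v (p x) y - D l u (p x) y\<bar> \<partial>\<gamma> (p x))
          \<le> ennreal (\<bar>v - u\<bar> * (C0 * \<phi> (p x) powr (q * real (Suc l))))"
        using D_diff_bound[OF l'(3) order_refl degk0 u v, of "p x"] by (simp only: nn_powr_0 add_0_left)
      show "(\<integral>\<^sup>+y. ennreal (\<phi> y powr deg s * \<bar>D l v (p x) y - D l u (p x) y\<bar>) \<partial>\<gamma> (p x))
          \<le> ennreal (\<bar>v - u\<bar> * (C0 * \<phi> (p x) powr (deg (s + Suc l))))"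
        using D_diff_bound[OF l'(3) deg_nonneg degk[OF l'(2)] u v, of "p x"] by (simp only: deg_eq)
    qed (use m u v C0 in auto)
    then have "dual_bound Y (WY s) (\<lambda>g. \<integral>y. (D l v (p x) y - D l u (p x) y) * g (c x y) \<partial>\<gamma> (p x))
       (\<bar>v - u\<bar> * (C0 * (cX + 1) * WX (s + Suc l) x))"
      by (rule dual_bound_le) (rule total[OF x], simp)
    then show "dual_bound Y (WY s) (\<lambda>g. kernel_op p c l v g x - kernel_op p c l u g x)
        (\<bar>v - u\<bar> * (C0 * (cX + 1) * WX (Suc (s + l)) x))"
      using g_int[OF l'(1) _ x weighted_ball_fun] u v
      by (simp add: dual_bound_def kernel_op_def left_diff_distrib)
  qed
qed

end

section \<open>Series of functionals, mixtures and concave moments\<close>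

lemma functional_suminf:
  assumes S: "\<And>q. weighted_functional M W (S q)" and a: "\<And>q. dual_bound M W (S q) (a q)"
    and sum: "summable a" and W: "\<And>x. x \<in> space M \<Longrightarrow> 0 \<le> W x"
  shows "weighted_functional M W (\<lambda>g. \<Sum>q. S q g)"
    and "g \<in> weighted_fun M W \<Longrightarrow> summable (\<lambda>q. S q g)"
proof -
  have summ: "summable (\<lambda>q. S q g)" if g: "g \<in> weighted_fun M W" for g
  proof -
    obtain c where c: "c > 0" "(\<lambda>x. g x / c) \<in> weighted_ball M W" using weighted_fun_ball[OF g W] by blast
    have "norm (S q g) \<le> c * a q" for q
    proof -
      have "\<bar>S q (\<lambda>x. g x / c)\<bar> \<le> a q" using a[of q] c(2) by (simp add: dual_bound_def)
      moreover have "S q (\<lambda>x. g x / c) = S q g / c" using functional_scale[OF S g, of q "1/c"] by simp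
      ultimately show ?thesis using c(1) by (simp add: abs_mult divide_le_eq mult.commute)
    qed
    then show ?thesis by (intro summable_comparison_test'[OF summable_mult[OF sum, of c], of 0])
  qed
  then show "g \<in> weighted_fun M W \<Longrightarrow> summable (\<lambda>q. S q g)" .
  show "weighted_functional M W (\<lambda>g. \<Sum>q. S q g)"
    unfolding weighted_functional_def
  proof (intro conjI ballI allI impI)
    fix g h and b :: real assume g: "g \<in> weighted_fun M W" and h: "h \<in> weighted_fun M W"
    have "(\<Sum>q. S q (\<lambda>x. b * g x + h x)) = (\<Sum>q. b * S q g + S q h)"
      by (simp add: functional_linear[OF S g h])
    also have "\<dots> = b * (\<Sum>q. S q g) + (\<Sum>q. S q h)"
      using summ[OF g] summ[OF h] by (simp add: suminf_add[symmetric] suminf_mult summable_mult)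
    finally show "(\<Sum>q. S q (\<lambda>x. b * g x + h x)) = b * (\<Sum>q. S q g) + (\<Sum>q. S q h)" .
  next
    fix G :: "nat \<Rightarrow> _" and g
    assume G: "\<forall>n. G n \<in> weighted_ball M W" and g: "g \<in> borel_measurable M"
      and lim: "\<forall>x\<in>space M. (\<lambda>n. G n x) \<longlonglongrightarrow> g x"
    have "(\<lambda>n. \<Sum>q. S q (G n)) \<longlonglongrightarrow> (\<Sum>q. S q g)"
    \<comment> \<open>Dominated convergence for series, with the summable majorant
      \<open>a\<close>.\<close>
    proof (rule tannerys_theorem[THEN conjunct2, THEN conjunct2, OF _ _ sum])
      show "(\<lambda>n. S q (G n)) \<longlonglongrightarrow> S q g" for q
        using functional_tendsto[OF S] G g lim by blast
      show "\<forall>\<^sub>F (q, n) in sequentially \<times>\<^sub>F sequentially. norm (S q (G n)) \<le> a q"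
        using a G by (intro always_eventually) (auto simp: dual_bound_def)
    qed simp
    then show "(\<lambda>n. \<Sum>q. S q (G n)) \<longlonglongrightarrow> (\<Sum>q. S q g)" .
  qed
qed

text \<open>The nonnegative integral disintegrates without conditions; integrability of
  \<open>W\<close> makes all values finite, so signed integrands can be split into positive and
  negative parts.\<close>

lemma integral_bind_weighted:
  assumes \<kappa>: "\<kappa> \<in> N \<rightarrow>\<^sub>M subprob_algebra M" and ne: "space N \<noteq> {}"
    and W: "integrable (N \<bind> \<kappa>) W" "\<And>x. x \<in> space N \<Longrightarrow> integrable (\<kappa> x) W"
    and g: "g \<in> weighted_fun M W"
  shows "(\<integral>y. g y \<partial>(N \<bind> \<kappa>)) = (\<integral>x. \<integral>y. g y \<partial>\<kappa> x \<partial>N)"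
    and "integrable N (\<lambda>x. \<integral>y. g y \<partial>\<kappa> x)"
proof -
  have sets: "sets (N \<bind> \<kappa>) = sets M" "\<And>x. x \<in> space N \<Longrightarrow> sets (\<kappa> x) = sets M"
    using sets_kernel[OF \<kappa>] ne by (auto intro!: sets_bind)
  have nonneg: "(\<integral>y. h y \<partial>(N \<bind> \<kappa>)) = (\<integral>x. \<integral>y. h y \<partial>\<kappa> x \<partial>N) \<and> integrable N (\<lambda>x. \<integral>y. h y \<partial>\<kappa> x)"
    if h: "h \<in> weighted_fun M W" and h0: "\<And>y. 0 \<le> h y" for h
  proof -
    have hm: "h \<in> borel_measurable M" by (rule weighted_fun_measurable[OF h])
    have hb: "integrable (N \<bind> \<kappa>) h" by (rule integrable_weighted_fun[OF sets(1) W(1) h])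
    have hk: "integrable (\<kappa> x) h" if "x \<in> space N" for x
      by (rule integrable_weighted_fun[OF sets(2)[OF that] W(2)[OF that] h])
    have inner: "(\<integral>\<^sup>+y. ennreal (h y) \<partial>\<kappa> x) = ennreal (\<integral>y. h y \<partial>\<kappa> x)" if "x \<in> space N" for x
      by (rule nn_integral_eq_integral[OF hk[OF that]]) (simp add: h0)
    have "ennreal (\<integral>y. h y \<partial>(N \<bind> \<kappa>)) = (\<integral>\<^sup>+y. ennreal (h y) \<partial>(N \<bind> \<kappa>))"
      by (rule nn_integral_eq_integral[OF hb, symmetric]) (simp add: h0)
    also have "\<dots> = (\<integral>\<^sup>+x. \<integral>\<^sup>+y. ennreal (h y) \<partial>\<kappa> x \<partial>N)"
      by (rule nn_integral_bind[OF _ \<kappa>]) (use hm in simp)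
    also have "\<dots> = (\<integral>\<^sup>+x. ennreal (\<integral>y. h y \<partial>\<kappa> x) \<partial>N)"
      by (rule nn_integral_cong) (rule inner)
    finally have eq: "ennreal (\<integral>y. h y \<partial>(N \<bind> \<kappa>)) = (\<integral>\<^sup>+x. ennreal (\<integral>y. h y \<partial>\<kappa> x) \<partial>N)" .
    have m: "(\<lambda>x. \<integral>y. h y \<partial>\<kappa> x) \<in> borel_measurable N"
      by (rule measurable_compose[OF \<kappa> integral_measurable_subprob_algebra[OF hm]])
    have int: "integrable N (\<lambda>x. \<integral>y. h y \<partial>\<kappa> x)"
      by (rule integrableI_nonneg[OF m]) (auto simp: eq[symmetric] h0 integral_nonneg)
    have "(\<integral>x. \<integral>y. h y \<partial>\<kappa> x \<partial>N) = enn2real (\<integral>\<^sup>+x. ennreal (\<integral>y. h y \<partial>\<kappa> x) \<partial>N)"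
      by (rule integral_eq_nn_integral[OF m]) (simp add: h0 integral_nonneg)
    also have "\<dots> = (\<integral>y. h y \<partial>(N \<bind> \<kappa>))"
      unfolding eq[symmetric] by (simp add: h0 integral_nonneg)
    finally show ?thesis using int by simp
  qed
  have part: "(\<lambda>y. max (g y) 0) \<in> weighted_fun M W" "(\<lambda>y. max (- g y) 0) \<in> weighted_fun M W"
  proof -
    obtain c where c: "\<And>x. x \<in> space M \<Longrightarrow> \<bar>g x\<bar> \<le> c * W x" using g by (auto simp: weighted_fun_def)
    have "\<bar>max (g y) 0\<bar> \<le> c * W y" "\<bar>max (- g y) 0\<bar> \<le> c * W y" if "y \<in> space M" for y
      using c[OF that] by auto
    then show "(\<lambda>y. max (g y) 0) \<in> weighted_fun M W" "(\<lambda>y. max (- g y) 0) \<in> weighted_fun M W"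
      using weighted_fun_measurable[OF g] by (auto intro!: weighted_funI[where c=c])
  qed
  note pos = nonneg[OF part(1)] and neg = nonneg[OF part(2)]
  have eq: "(\<lambda>y. g y) = (\<lambda>y. max (g y) 0 - max (- g y) 0)" by auto
  have bi: "integrable (N \<bind> \<kappa>) (\<lambda>y. max (g y) 0)" "integrable (N \<bind> \<kappa>) (\<lambda>y. max (- g y) 0)"
    using part by (auto intro: integrable_weighted_fun[OF sets(1) W(1)])
  have ki: "(\<integral>y. g y \<partial>\<kappa> x) = (\<integral>y. max (g y) 0 \<partial>\<kappa> x) - (\<integral>y. max (- g y) 0 \<partial>\<kappa> x)" if "x \<in> space N" for x
    by (subst eq, rule Bochner_Integration.integral_diff)
      (use part that in \<open>auto intro: integrable_weighted_fun[OF sets(2) W(2)]\<close>)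
  have "(\<integral>x. \<integral>y. g y \<partial>\<kappa> x \<partial>N) = (\<integral>x. (\<integral>y. max (g y) 0 \<partial>\<kappa> x) - (\<integral>y. max (- g y) 0 \<partial>\<kappa> x) \<partial>N)"
    by (rule Bochner_Integration.integral_cong[OF refl ki])
  also have "\<dots> = (\<integral>x. \<integral>y. max (g y) 0 \<partial>\<kappa> x \<partial>N) - (\<integral>x. \<integral>y. max (- g y) 0 \<partial>\<kappa> x \<partial>N)"
    using pos neg by (intro Bochner_Integration.integral_diff) auto
  also have "\<dots> = (\<integral>y. max (g y) 0 \<partial>(N \<bind> \<kappa>)) - (\<integral>y. max (- g y) 0 \<partial>(N \<bind> \<kappa>))"
    using pos neg by simp
  also have "\<dots> = (\<integral>y. g y \<partial>(N \<bind> \<kappa>))"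
    by (subst (3) eq, rule Bochner_Integration.integral_diff[symmetric, OF bi])
  finally show "(\<integral>y. g y \<partial>(N \<bind> \<kappa>)) = (\<integral>x. \<integral>y. g y \<partial>\<kappa> x \<partial>N)" by simp
  have "integrable N (\<lambda>x. (\<integral>y. max (g y) 0 \<partial>\<kappa> x) - (\<integral>y. max (- g y) 0 \<partial>\<kappa> x))"
    using pos neg by auto
  then show "integrable N (\<lambda>x. \<integral>y. g y \<partial>\<kappa> x)"
    by (subst Bochner_Integration.integrable_cong[OF refl ki])
qed

text \<open>For \<open>t = a / (a + b)\<close> and for \<open>t = b / (a + b)\<close> one has
  \<open>t \<le> t powr r\<close>, as \<open>t \<le> 1\<close>; the two inequalities are
  added.\<close>

lemma powr_add_le:
  fixes a b r :: real
  assumes "a > 0" "b > 0" "0 \<le> r" "r \<le> 1"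
  shows "(a + b) powr r \<le> a powr r + b powr r"
proof -
  have *: "x / (a + b) \<le> x powr r / (a + b) powr r" if "0 < x" "x \<le> a + b" for x
    using powr_mono'[of r 1 "x / (a + b)"] that assms by (simp add: powr_divide)
  have "1 = a / (a + b) + b / (a + b)" using assms by (simp add: add_divide_distrib[symmetric])
  also have "\<dots> \<le> a powr r / (a + b) powr r + b powr r / (a + b) powr r"
    using assms by (intro add_mono *) auto
  finally show ?thesis using assms by (simp add: add_divide_distrib[symmetric] le_divide_eq)
qed

text \<open>Jensen's inequality for a concave power: Young's inequality says that the power lies
  below its tangent at \<open>z\<close>, whose slope is \<open>r * z powr (r - 1)\<close>, and the
  tangent is integrated.\<close>

lemma nn_integral_powr_le:
  assumes N: "prob_space N" and h: "h \<in> borel_measurable N" "\<And>x. 0 < h x"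
    and z: "z > 0" "(\<integral>\<^sup>+x. ennreal (h x) \<partial>N) \<le> ennreal z" and r: "0 \<le> r" "r \<le> 1"
  shows "(\<integral>\<^sup>+x. ennreal (h x powr r) \<partial>N) \<le> ennreal (z powr r)"
proof -
  interpret prob_space N by fact
  define y where "y = z powr (r - 1)"
  have y: "y > 0" "y * z = z powr r"
    using z by (auto simp: y_def powr_diff)
  have le: "h x powr r \<le> y * (r * h x + (1 - r) * z)" for x
  proof -
    have "h x powr r * z powr (1 - r) \<le> r * h x + (1 - r) * z"
      by (rule Youngs_inequality_0) (use r z h in auto)
    then have "y * (h x powr r * z powr (1 - r)) \<le> y * (r * h x + (1 - r) * z)"
      using y by simp
    moreover have "y * (h x powr r * z powr (1 - r)) = h x powr r"
      using z by (simp add: y_def powr_add[symmetric])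
    ultimately show ?thesis by simp
  qed
  have "(\<integral>\<^sup>+x. ennreal (h x powr r) \<partial>N) \<le> (\<integral>\<^sup>+x. ennreal (y * r) * ennreal (h x) + ennreal (y * (1 - r) * z) \<partial>N)"
  proof (rule nn_integral_mono)
    fix x
    have "ennreal (h x powr r) \<le> ennreal (y * (r * h x + (1 - r) * z))" by (rule ennreal_leI[OF le])
    also have "\<dots> = ennreal (y * r) * ennreal (h x) + ennreal (y * (1 - r) * z)"
      using y z r h(2)[of x]
      by (simp add: ennreal_mult[symmetric] ennreal_plus[symmetric] algebra_simps less_imp_le mult_right_mono mult_left_le del: ennreal_plus)
    finally show "ennreal (h x powr r) \<le> \<dots>" .
  qed
  also have "\<dots> = ennreal (y * r) * (\<integral>\<^sup>+x. ennreal (h x) \<partial>N) + ennreal (y * (1 - r) * z)"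
    using h(1) by (subst nn_integral_add) (auto simp: nn_integral_cmult emeasure_space_1)
  also have "\<dots> \<le> ennreal (y * r) * ennreal z + ennreal (y * (1 - r) * z)"
    by (intro add_mono mult_left_mono z(2)) auto
  also have "\<dots> = ennreal (y * z)"
    using y z r by (simp add: ennreal_mult[symmetric] ennreal_plus[symmetric] algebra_simps less_imp_le mult_left_le del: ennreal_plus)
  finally show ?thesis by (simp add: y(2))
qed

section \<open>Harris' theorem\<close>

text \<open>Kernels contract the oscillation \<open>sup |g x - g y| / (2 + \<beta> V x + \<beta> V y)\<close>
  (Hairer and Mattingly); subtracting a constant from \<open>P g\<close> then makes \<open>P\<close> a contraction
  on functionals of total mass zero.\<close>

lemma Harris_oscillation:
  assumes P: "P \<in> M \<rightarrow>\<^sub>M prob_algebra M" and \<nu>: "\<nu> \<in> space (prob_algebra M)"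
    and V: "V \<in> borel_measurable M" "\<And>x. x \<in> space M \<Longrightarrow> 0 \<le> V x"
    and drift: "\<And>x. x \<in> space M \<Longrightarrow> (\<integral>\<^sup>+y. ennreal (V y) \<partial>P x) \<le> ennreal (lam * V x + b)"
    and lam: "0 \<le> lam" "0 \<le> b"
    and minor: "\<And>x A. x \<in> space M \<Longrightarrow> V x \<le> r \<Longrightarrow> A \<in> sets M \<Longrightarrow> ennreal \<eta> * emeasure \<nu> A \<le> emeasure (P x) A"
    and \<eta>: "0 < \<eta>" and \<beta>: "0 < \<beta>" "2 * \<beta> * b \<le> \<eta>"
    and \<alpha>: "lam \<le> \<alpha>" "2 * (1 - \<alpha>) + 2 * \<beta> * b \<le> (\<alpha> - lam) * \<beta> * r" "1 - \<eta> / 2 \<le> \<alpha>"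
    and g: "g \<in> weighted_ball M (\<lambda>x. 1 + \<beta> * V x)"
    and x: "x \<in> space M" and y: "y \<in> space M"
  shows "(\<integral>z. g z \<partial>P x) - (\<integral>z. g z \<partial>P y) \<le> \<alpha> * (2 + \<beta> * V x + \<beta> * V y)"
proof -
  have sets: "sets (P z) = sets M" and prob: "prob_space (P z)" if "z \<in> space M" for z
    using measurable_space[OF P that] by (auto simp: space_prob_algebra)
  have V_int: "integrable (P z) V" and V_le: "(\<integral>a. V a \<partial>P z) \<le> lam * V z + b" if z: "z \<in> space M" for z
  proof -
    have Vm: "V \<in> borel_measurable (P z)" using V(1) measurable_cong_sets[OF sets[OF z] refl] by blast
    have V0: "AE a in P z. 0 \<le> V a" using V(2) sets_eq_imp_space_eq[OF sets[OF z]] by (intro AE_I2) simp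
    show int: "integrable (P z) V"
      by (rule integrableI_nonneg[OF Vm V0]) (use drift[OF z] in \<open>auto simp: less_top[symmetric] top_unique\<close>)
    show "(\<integral>a. V a \<partial>P z) \<le> lam * V z + b"
      using drift[OF z] lam V(2)[OF z] by (simp add: nn_integral_eq_integral[OF int V0] del: ennreal_plus)
  qed
  have W_int: "integrable (P z) (\<lambda>a. 1 + \<beta> * V a)" if z: "z \<in> space M" for z
    using V_int[OF z] prob_space.finite_measure[OF prob[OF z]] by (simp add: finite_measure.integrable_const)
  have g_int: "integrable (P z) g" if z: "z \<in> space M" for z
    by (rule integrable_weighted_fun[OF sets[OF z] W_int[OF z] weighted_ball_fun[OF g]])
  have W_val: "(\<integral>a. 1 + \<beta> * V a \<partial>P z) = 1 + \<beta> * (\<integral>a. V a \<partial>P z)" if z: "z \<in> space M" for z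
    using V_int[OF z] prob_space.prob_space[OF prob[OF z]] prob_space.finite_measure[OF prob[OF z]]
    by (subst Bochner_Integration.integral_add) (auto simp: finite_measure.integrable_const)
  have W_le: "(\<integral>a. 1 + \<beta> * V a \<partial>P z) \<le> 1 + \<beta> * (lam * V z + b)" if z: "z \<in> space M" for z
    using V_le[OF z] \<beta> by (simp add: W_val[OF z])
  have g_le: "\<bar>g a\<bar> \<le> 1 + \<beta> * V a" if "a \<in> space M" for a
    using weighted_ballD(2)[OF g that] .
  have upper: "(\<integral>a. g a \<partial>P z) \<le> (\<integral>a. 1 + \<beta> * V a \<partial>P z)" "- (\<integral>a. 1 + \<beta> * V a \<partial>P z) \<le> (\<integral>a. g a \<partial>P z)"
    if z: "z \<in> space M" for z
  proof -
    have "a \<in> space (P z) \<Longrightarrow> \<bar>g a\<bar> \<le> 1 + \<beta> * V a" for a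
      using g_le sets_eq_imp_space_eq[OF sets[OF z]] by simp
    then have le: "a \<in> space (P z) \<Longrightarrow> g a \<le> 1 + \<beta> * V a" "a \<in> space (P z) \<Longrightarrow> - g a \<le> 1 + \<beta> * V a" for a
      by (auto simp: abs_le_iff)
    show "(\<integral>a. g a \<partial>P z) \<le> (\<integral>a. 1 + \<beta> * V a \<partial>P z)"
      by (intro integral_mono g_int W_int z le(1))
    have "(\<integral>a. - g a \<partial>P z) \<le> (\<integral>a. 1 + \<beta> * V a \<partial>P z)"
      by (intro integral_mono g_int W_int z le(2) integrable_minus)
    then show "- (\<integral>a. 1 + \<beta> * V a \<partial>P z) \<le> (\<integral>a. g a \<partial>P z)" by simp
  qed
  define S where "S = V x + V y"
  have S0: "0 \<le> S" using V(2)[OF x] V(2)[OF y] by (simp add: S_def)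
  have Sx: "\<beta> * V x + \<beta> * V y = \<beta> * S" by (simp add: S_def algebra_simps)
  show ?thesis
  proof (cases "S \<ge> r")
    case True
    \<comment> \<open>Far out, where \<open>V x + V y \<ge> r\<close>, the drift suffices: the
      surplus \<open>(\<alpha> - lam) * \<beta> * r\<close> pays for the constant terms.\<close>
    have "(\<integral>z. g z \<partial>P x) - (\<integral>z. g z \<partial>P y) \<le> 2 + \<beta> * (lam * S + 2 * b)"
      using upper(1)[OF x] upper(2)[OF y] W_le[OF x] W_le[OF y] by (simp add: S_def algebra_simps)
    also have "\<dots> \<le> \<alpha> * (2 + \<beta> * S)"
    proof -
      have "(\<alpha> - lam) * \<beta> * r \<le> (\<alpha> - lam) * \<beta> * S"
        using True \<alpha>(1) \<beta>(1) by (intro mult_left_mono) auto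
      then show ?thesis using \<alpha>(2) by (simp add: algebra_simps)
    qed
    finally show ?thesis using Sx by (simp add: add.assoc)
  next
    case False
    then have small: "V x \<le> r" "V y \<le> r" using V(2)[OF x] V(2)[OF y] by (auto simp: S_def)
    have \<nu>s: "sets \<nu> = sets M" and \<nu>p: "prob_space \<nu>" using \<nu> by (auto simp: space_prob_algebra)
    have nn_le: "ennreal \<eta> * (\<integral>\<^sup>+a. h a \<partial>\<nu>) \<le> (\<integral>\<^sup>+a. h a \<partial>P z)"
      if z: "z \<in> space M" "V z \<le> r" and h: "h \<in> borel_measurable M" for z and h :: "_ \<Rightarrow> ennreal"
    proof -
      have "ennreal \<eta> * (\<integral>\<^sup>+a. h a \<partial>\<nu>) = (\<integral>\<^sup>+a. h a \<partial>scale_measure (ennreal \<eta>) \<nu>)"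
        using h measurable_cong_sets[OF \<nu>s refl] by (subst nn_integral_scale_measure) auto
      also have "\<dots> \<le> (\<integral>\<^sup>+a. h a \<partial>P z)"
      proof (rule nn_integral_mono_measure)
        show "sets (scale_measure (ennreal \<eta>) \<nu>) = sets (P z)" using \<nu>s sets[OF z(1)] by simp
        show "scale_measure (ennreal \<eta>) \<nu> \<le> P z"
          using minor[OF z] \<nu>s sets[OF z(1)]
          by (subst le_measure) (auto simp: )
      qed
      finally show ?thesis .
    qed
    \<comment> \<open>The minorization at the point \<open>x\<close>, where
      \<open>V x \<le> r\<close>, transfers integrability of \<open>V\<close> from
      \<open>P x\<close> to \<open>\<nu>\<close>.\<close>
    have V\<nu>: "integrable \<nu> V"
    proof (rule integrableI_nonneg)
      show "V \<in> borel_measurable \<nu>" using V(1) measurable_cong_sets[OF \<nu>s refl] by blast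
      show "AE a in \<nu>. 0 \<le> V a" using V(2) sets_eq_imp_space_eq[OF \<nu>s] by (intro AE_I2) simp
      have "ennreal \<eta> * (\<integral>\<^sup>+a. ennreal (V a) \<partial>\<nu>) \<le> ennreal (lam * V x + b)"
        using nn_le[OF x small(1), of "\<lambda>a. ennreal (V a)"] V(1) drift[OF x] by (auto intro: order_trans)
      then have "ennreal \<eta> * (\<integral>\<^sup>+a. ennreal (V a) \<partial>\<nu>) < \<infinity>" by (auto simp: less_top[symmetric] top_unique)
      then show "(\<integral>\<^sup>+a. ennreal (V a) \<partial>\<nu>) < \<infinity>" using \<eta> by (auto simp: ennreal_mult_less_top)
    qed
    have W\<nu>: "integrable \<nu> (\<lambda>a. 1 + \<beta> * V a)"
      using V\<nu> prob_space.finite_measure[OF \<nu>p] by (simp add: finite_measure.integrable_const)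
    have g\<nu>: "integrable \<nu> g" by (rule integrable_weighted_fun[OF \<nu>s W\<nu> weighted_ball_fun[OF g]])
    have ge: "\<eta> * (\<integral>a. h a \<partial>\<nu>) \<le> (\<integral>a. h a \<partial>P z)"
      if z: "z \<in> space M" "V z \<le> r" and h: "h \<in> borel_measurable M" "\<And>a. a \<in> space M \<Longrightarrow> 0 \<le> h a"
        "integrable \<nu> h" "integrable (P z) h" for z h
    proof -
      have a1: "AE a in \<nu>. 0 \<le> h a" using h(2) sets_eq_imp_space_eq[OF \<nu>s] by (intro AE_I2) simp
      have a2: "AE a in P z. 0 \<le> h a" using h(2) sets_eq_imp_space_eq[OF sets[OF z(1)]] by (intro AE_I2) simp
      have "ennreal \<eta> * ennreal (\<integral>a. h a \<partial>\<nu>) \<le> ennreal (\<integral>a. h a \<partial>P z)"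
        using nn_le[OF z, of "\<lambda>a. ennreal (h a)"] h(1)
        by (simp add: nn_integral_eq_integral[OF h(3) a1] nn_integral_eq_integral[OF h(4) a2])
      then show ?thesis
        using \<eta> a1 a2 by (simp add: ennreal_mult[symmetric] integral_nonneg_AE)
    qed
    \<comment> \<open>Minorization is applied to the nonnegative functions \<open>W - g\<close> at
      \<open>x\<close> and \<open>W + g\<close> at \<open>y\<close>, where
      \<open>W = 1 + \<beta> * V\<close>. On adding, the integrals of \<open>g\<close> against
      \<open>\<nu>\<close> cancel and twice \<open>\<eta>\<close> times the integral of
      \<open>W\<close> is gained, which is at least \<open>2 * \<eta>\<close>.\<close>
    have "\<eta> * (\<integral>a. (1 + \<beta> * V a) - g a \<partial>\<nu>) \<le> (\<integral>a. (1 + \<beta> * V a) - g a \<partial>P x)"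
    proof (rule ge[OF x small(1)])
      show "(\<lambda>a. (1 + \<beta> * V a) - g a) \<in> borel_measurable M" using V(1) weighted_ballD(1)[OF g] by simp
      show "0 \<le> (1 + \<beta> * V a) - g a" if "a \<in> space M" for a using g_le[OF that] by simp
    qed (use W\<nu> g\<nu> W_int[OF x] g_int[OF x] in auto)
    moreover have "\<eta> * (\<integral>a. (1 + \<beta> * V a) + g a \<partial>\<nu>) \<le> (\<integral>a. (1 + \<beta> * V a) + g a \<partial>P y)"
    proof (rule ge[OF y small(2)])
      show "(\<lambda>a. (1 + \<beta> * V a) + g a) \<in> borel_measurable M" using V(1) weighted_ballD(1)[OF g] by simp
      show "0 \<le> (1 + \<beta> * V a) + g a" if "a \<in> space M" for a using g_le[OF that] by simp
    qed (use W\<nu> g\<nu> W_int[OF y] g_int[OF y] in auto)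
    moreover have "(\<integral>a. (1 + \<beta> * V a) - g a \<partial>\<nu>) = (\<integral>a. 1 + \<beta> * V a \<partial>\<nu>) - (\<integral>a. g a \<partial>\<nu>)"
      "(\<integral>a. (1 + \<beta> * V a) + g a \<partial>\<nu>) = (\<integral>a. 1 + \<beta> * V a \<partial>\<nu>) + (\<integral>a. g a \<partial>\<nu>)"
      "(\<integral>a. (1 + \<beta> * V a) - g a \<partial>P x) = (\<integral>a. 1 + \<beta> * V a \<partial>P x) - (\<integral>a. g a \<partial>P x)"
      "(\<integral>a. (1 + \<beta> * V a) + g a \<partial>P y) = (\<integral>a. 1 + \<beta> * V a \<partial>P y) + (\<integral>a. g a \<partial>P y)"
      using W\<nu> g\<nu> W_int[OF x] g_int[OF x] W_int[OF y] g_int[OF y] by simp_all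
    moreover have "1 \<le> (\<integral>a. 1 + \<beta> * V a \<partial>\<nu>)"
    proof -
      have "(\<integral>a. 1 \<partial>\<nu>) \<le> (\<integral>a. 1 + \<beta> * V a \<partial>\<nu>)"
        using \<beta> V(2) sets_eq_imp_space_eq[OF \<nu>s] prob_space.finite_measure[OF \<nu>p]
        by (intro integral_mono W\<nu>) (auto simp: finite_measure.integrable_const)
      then show ?thesis using prob_space.prob_space[OF \<nu>p] by simp
    qed
    then have "\<eta> * 1 \<le> \<eta> * (\<integral>a. 1 + \<beta> * V a \<partial>\<nu>)" using \<eta> by (intro mult_left_mono) auto
    ultimately have "(\<integral>z. g z \<partial>P x) - (\<integral>z. g z \<partial>P y) \<le> 2 + \<beta> * (lam * S + 2 * b) - 2 * \<eta>"
      using W_le[OF x] W_le[OF y] by (simp add: S_def algebra_simps)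
    \<comment> \<open>Since \<open>2 * \<beta> * b \<le> \<eta>\<close>, the constant terms are at
      most \<open>2 - \<eta>\<close>, hence at most \<open>2 * \<alpha>\<close>.\<close>
    also have "\<dots> \<le> \<alpha> * (2 + \<beta> * S)"
    proof -
      have "lam * (\<beta> * S) \<le> \<alpha> * (\<beta> * S)" using \<alpha>(1) \<beta>(1) S0 by (intro mult_right_mono) auto
      then show ?thesis using \<alpha>(3) \<beta>(2) by (simp add: algebra_simps)
    qed
    finally show ?thesis using Sx by (simp add: add.assoc)
  qed
qed

lemma Harris_contraction:
  assumes P: "P \<in> M \<rightarrow>\<^sub>M prob_algebra M" and \<nu>: "\<nu> \<in> space (prob_algebra M)"
    and V: "V \<in> borel_measurable M" "\<And>x. x \<in> space M \<Longrightarrow> 0 \<le> V x"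
    and drift: "\<And>x. x \<in> space M \<Longrightarrow> (\<integral>\<^sup>+y. ennreal (V y) \<partial>P x) \<le> ennreal (lam * V x + b)"
    and lam: "0 \<le> lam" "0 \<le> b"
    and minor: "\<And>x A. x \<in> space M \<Longrightarrow> V x \<le> r \<Longrightarrow> A \<in> sets M \<Longrightarrow> ennreal \<eta> * emeasure \<nu> A \<le> emeasure (P x) A"
    and \<eta>: "0 < \<eta>" and \<beta>: "0 < \<beta>" "2 * \<beta> * b \<le> \<eta>"
    and \<alpha>: "lam \<le> \<alpha>" "2 * (1 - \<alpha>) + 2 * \<beta> * b \<le> (\<alpha> - lam) * \<beta> * r" "1 - \<eta> / 2 \<le> \<alpha>"
    and T: "weighted_functional M (\<lambda>x. 1 + \<beta> * V x) T" "T (\<lambda>_. 1) = 0"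
      "dual_bound M (\<lambda>x. 1 + \<beta> * V x) T e"
  shows "dual_bound M (\<lambda>x. 1 + \<beta> * V x) (\<lambda>g. T (\<lambda>x. \<integral>y. g y \<partial>P x)) (\<alpha> * e)"
  unfolding dual_bound_def
proof
  fix g assume g: "g \<in> weighted_ball M (\<lambda>x. 1 + \<beta> * V x)"
  let ?h = "\<lambda>x. \<integral>y. g y \<partial>P x" and ?W = "\<lambda>x. 1 + \<beta> * V x"
  have W0: "0 \<le> ?W x" if "x \<in> space M" for x using V(2)[OF that] \<beta> by simp
  have "sets \<nu> = sets M" "prob_space \<nu>" using \<nu> by (auto simp: space_prob_algebra)
  then have ne: "space M \<noteq> {}" using prob_space.not_empty sets_eq_imp_space_eq by metis
  have osc: "?h x - \<alpha> * ?W x \<le> ?h y + \<alpha> * ?W y" if "x \<in> space M" "y \<in> space M" for x y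
  proof -
    have "?h x - ?h y \<le> \<alpha> * (2 + \<beta> * V x + \<beta> * V y)"
      by (rule Harris_oscillation[OF P \<nu> V drift lam minor \<eta> \<beta> \<alpha> g that])
    then show ?thesis by (simp add: algebra_simps)
  qed
  \<comment> \<open>The oscillation bound places every \<open>?h x - \<alpha> * ?W x\<close> below
    every \<open>?h y + \<alpha> * ?W y\<close>, so their supremum \<open>c\<close> separates the
    two families.\<close>
  define c where "c = (SUP x\<in>space M. ?h x - \<alpha> * ?W x)"
  have le1: "?h x - \<alpha> * ?W x \<le> c" if "x \<in> space M" for x
    unfolding c_def
  proof (rule cSUP_upper[OF that])
    show "bdd_above ((\<lambda>x. ?h x - \<alpha> * ?W x) ` space M)" by (rule bdd_aboveI2) (rule osc[OF _ that])
  qed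
  have le2: "c \<le> ?h x + \<alpha> * ?W x" if "x \<in> space M" for x
    unfolding c_def by (rule cSUP_least[OF ne]) (rule osc[OF _ that])
  have hm: "?h \<in> borel_measurable M"
    by (rule measurable_compose[OF measurable_prob_algebraD[OF P] integral_measurable_subprob_algebra[OF weighted_ballD(1)[OF g]]])
  have \<alpha>0: "0 \<le> \<alpha>" using \<alpha>(1) lam(1) by simp
  have bound: "\<bar>?h x - c\<bar> \<le> \<alpha> * ?W x" if "x \<in> space M" for x
    using le1[OF that] le2[OF that] by (simp add: abs_le_iff)
  have hc: "(\<lambda>x. ?h x - c) \<in> weighted_fun M ?W" by (rule weighted_funI[OF _ bound]) (use hm in simp)
  have one: "(\<lambda>_. 1) \<in> weighted_fun M ?W" by (rule weighted_funI[where c=1]) (use V(2) \<beta> in auto)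
  have "T ?h = T (\<lambda>x. c * 1 + (?h x - c))" by simp
  also have "\<dots> = T (\<lambda>x. ?h x - c)" by (subst functional_linear[OF T(1) one hc]) (simp add: T(2))
  finally show "\<bar>T ?h\<bar> \<le> \<alpha> * e"
    using dual_boundD[OF T(3,1) _ \<alpha>0 bound W0] hm by simp
qed

text \<open>\<open>\<beta> = \<eta> / (2 * b)\<close> makes \<open>2 * \<beta> * b = \<eta>\<close>.
  At the level \<open>4 * b / (1 - lam)\<close> the gain for \<open>\<alpha> = 1\<close> is
  \<open>4 * \<beta> * b\<close>, twice the required \<open>2 * \<beta> * b\<close>; the slack
  admits \<open>\<alpha> = 1 - \<delta>\<close> for small \<open>\<delta>\<close>, the last entry of
  the minimum being this condition solved for \<open>\<delta>\<close>.\<close>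

lemma Harris_constants:
  fixes lam b \<eta> :: real
  assumes "0 \<le> lam" "lam < 1" "0 < b" "0 < \<eta>"
  obtains \<alpha> \<beta> where "0 \<le> \<alpha>" "\<alpha> < 1" "0 < \<beta>" "2 * \<beta> * b \<le> \<eta>" "lam \<le> \<alpha>"
    "2 * (1 - \<alpha>) + 2 * \<beta> * b \<le> (\<alpha> - lam) * \<beta> * (4 * b / (1 - lam))" "1 - \<eta> / 2 \<le> \<alpha>"
proof -
  define \<beta> where "\<beta> = \<eta> / (2 * b)"
  define r where "r = 4 * b / (1 - lam)"
  define \<delta> where "\<delta> = Min {\<eta> / 2, 1 - lam, 2 * \<beta> * b / (2 + \<beta> * r)}"
  have \<beta>: "\<beta> > 0" "2 * \<beta> * b = \<eta>" using assms by (auto simp: \<beta>_def)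
  have r: "r > 0" "(1 - lam) * r = 4 * b" using assms by (auto simp: r_def)
  have p: "2 + \<beta> * r > 0" using \<beta> r by (simp add: add_pos_pos)
  have \<delta>: "\<delta> > 0" "\<delta> \<le> \<eta> / 2" "\<delta> \<le> 1 - lam" "\<delta> \<le> 2 * \<beta> * b / (2 + \<beta> * r)"
    using assms \<beta> p by (auto simp: \<delta>_def)
  have "\<delta> * (2 + \<beta> * r) \<le> 2 * \<beta> * b" using \<delta>(4) p by (simp add: le_divide_eq)
  moreover have "(1 - lam) * \<beta> * r = 4 * \<beta> * b" using r(2) by (simp add: mult.left_commute mult.assoc)
  ultimately have "2 * (1 - (1 - \<delta>)) + 2 * \<beta> * b \<le> (1 - \<delta> - lam) * \<beta> * r"
    by (simp add: algebra_simps)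
  then show ?thesis
    using \<delta> \<beta> assms by (intro that[of "1 - \<delta>" \<beta>]) (auto simp: r_def)
qed

section \<open>The invariant measures\<close>

text \<open>The inequality between \<open>d1 + q * k\<close> and \<open>d0\<close> ties the two
  groups of hypotheses together: it makes each weight of the scale a power at most 1 of the Lyapunov
  function.\<close>

locale ergodic_kernel = smooth_kernel \<gamma> Q D \<phi> k d1 q C0
  for \<gamma> :: "'a::topological_space \<Rightarrow> 'a measure"
    and Q :: "real \<Rightarrow> 'a \<Rightarrow> 'a measure"
    and D :: "nat \<Rightarrow> real \<Rightarrow> 'a \<Rightarrow> 'a \<Rightarrow> real"
    and \<phi> :: "'a \<Rightarrow> real" and k :: nat and d1 q C0 :: real +
  fixes \<pi> :: "real \<Rightarrow> 'a measure" and m :: nat and d0 \<epsilon> lam b :: real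
    and \<eta> :: "real \<Rightarrow> real" and \<nu> :: "real \<Rightarrow> 'a measure"
  assumes k: "k \<ge> 1" and d1_pos: "d1 > 0" and d0: "d1 + q * real k \<le> d0"
    and \<pi>: "\<And>u. u \<in> {0..1} \<Longrightarrow> invariant_prob (Q u) (\<pi> u)"
    and params: "m \<ge> 1" "\<epsilon> > 0" "0 < lam" "lam < 1" "b > 0"
    and \<eta>: "\<And>r. r > 0 \<Longrightarrow> \<eta> r > 0"
    and \<nu>: "\<And>r. r > 0 \<Longrightarrow> \<nu> r \<in> space (prob_algebra borel)"
    and drift: "\<And>us x. length us = m \<Longrightarrow> set us \<subseteq> {0..1} \<Longrightarrow>
          (\<forall>v\<in>set us. \<forall>w\<in>set us. \<bar>v - w\<bar> < \<epsilon>) \<Longrightarrow>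
          (\<integral>\<^sup>+ y. ennreal (\<phi> y powr d0) \<partial>kernel_prod Q us x) \<le> ennreal (lam * \<phi> x powr d0 + b)"
    and minorization: "\<And>r us x A. r > 0 \<Longrightarrow> length us = m \<Longrightarrow> set us \<subseteq> {0..1} \<Longrightarrow>
          (\<forall>v\<in>set us. \<forall>w\<in>set us. \<bar>v - w\<bar> < \<epsilon>) \<Longrightarrow>
          \<phi> x powr d0 \<le> r \<Longrightarrow> A \<in> sets borel \<Longrightarrow>
          ennreal (\<eta> r) * emeasure (\<nu> r) A \<le> emeasure (kernel_prod Q us x) A"
begin

definition weight :: "nat \<Rightarrow> 'a \<Rightarrow> real" where
  "weight s x = \<phi> x powr deg s"

definition Kop :: "nat \<Rightarrow> real \<Rightarrow> ('a \<Rightarrow> real) \<Rightarrow> 'a \<Rightarrow> real" where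
  "Kop = kernel_op (\<lambda>x. x) (\<lambda>x y. y)"

definition Pop :: "real list \<Rightarrow> ('a \<Rightarrow> real) \<Rightarrow> 'a \<Rightarrow> real" where
  "Pop us g = foldr (Kop 0) us g"

lemma weight_ge_1: "1 \<le> weight s x"
  unfolding weight_def by (rule \<phi>_powr_ge_1[OF deg_nonneg])

lemma weight_nonneg: "0 \<le> weight s x"
  using weight_ge_1[of s x] by simp

lemma weight_measurable[measurable]: "weight s \<in> borel_measurable borel"
  unfolding weight_def by measurable

lemma weight_mono: "s \<le> t \<Longrightarrow> weight s x \<le> weight t x"
  unfolding weight_def by (intro \<phi>_powr_mono deg_mono)

text \<open>Here \<open>cX = 1\<close>, because \<open>weight (s + l)\<close> is exactly
  \<open>weight s\<close> times \<open>\<phi>\<close> to the power \<open>q * l\<close>; hence the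
  constant \<open>C0 * (1 + 1)\<close>.\<close>

sublocale E: smooth_operators k borel weight borel weight Kop "C0 * (1 + 1)"
  unfolding Kop_def
proof (rule smooth_operators_kernel_op)
  show "weight s x * \<phi> x powr (q * real l) \<le> 1 * weight (s + l) x" for s l x
    by (simp add: weight_def deg_add powr_add)
  show "weight s y \<le> weight s x + \<phi> y powr deg s" for s x y
    using weight_nonneg[of s x] by (simp add: weight_def)
qed (auto simp: weight_def \<phi>_powr_ge_1[OF deg_nonneg])

section \<open>Markov operators and their products\<close>

lemma Q_space: "u \<in> {0..1} \<Longrightarrow> sets (Q u x) = sets borel \<and> prob_space (Q u x)"
  using measurable_space[OF Q_markov, of u x] by (simp add: space_prob_algebra)

lemma Kop_0: "u \<in> {0..1} \<Longrightarrow> g \<in> borel_measurable borel \<Longrightarrow> Kop 0 u g x = (\<integral>y. g y \<partial>Q u x)"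
  unfolding Kop_def by (rule kernel_op_0)

lemma Kop_0_one: "u \<in> {0..1} \<Longrightarrow> Kop 0 u (\<lambda>_. 1) = (\<lambda>_. 1)"
  using Q_space by (auto simp: Kop_0 prob_space.prob_space)

lemma Kop_Suc_const:
  assumes l: "l < k" and u: "u \<in> {0..1}" and eq: "\<And>v. v \<in> {0..1} \<Longrightarrow> Kop l v (\<lambda>_. 1) x = a"
  shows "Kop (Suc l) u (\<lambda>_. 1) x = 0"
proof -
  have "u islimpt {0..1}" using u by (simp add: islimpt_Icc)
  then have ne: "at u within {0..1} \<noteq> bot" by (simp add: trivial_limit_within)
  have "((\<lambda>v. (Kop l v (\<lambda>_. 1) x - Kop l u (\<lambda>_. 1) x) / (v - u)) \<longlongrightarrow> Kop (Suc l) u (\<lambda>_. 1) x) (at u within {0..1})"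
    by (rule E.K_deriv_tendsto[where s=0]) (use l u in \<open>auto intro!: weighted_ballI simp: weight_ge_1\<close>)
  moreover have "((\<lambda>v. (Kop l v (\<lambda>_. 1) x - Kop l u (\<lambda>_. 1) x) / (v - u)) \<longlongrightarrow> 0) (at u within {0..1})"
  proof (rule tendsto_eventually)
    show "\<forall>\<^sub>F v in at u within {0..1}. (Kop l v (\<lambda>_. 1) x - Kop l u (\<lambda>_. 1) x) / (v - u) = 0"
      using eventually_at_within_self
    proof eventually_elim
      case (elim v)
      then show ?case using eq[of v] eq[OF u] by simp
    qed
  qed
  ultimately show ?thesis by (rule tendsto_unique[OF ne])
qed

text \<open>All \<open>Q u\<close> have mass 1, so differentiating in \<open>u\<close> kills
  constants. This keeps the right-hand sides of the differentiated equations in the space of mass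
  zero, where \<open>I - Q u\<close> can be inverted.\<close>

lemma Kop_Suc_one: "l < k \<Longrightarrow> u \<in> {0..1} \<Longrightarrow> Kop (Suc l) u (\<lambda>_. 1) x = 0"
proof (induction l arbitrary: u)
  case 0
  then show ?case by (intro Kop_Suc_const[of 0 u x 1]) (auto simp: Kop_0_one)
next
  case (Suc l)
  then show ?case by (intro Kop_Suc_const[of "Suc l" u x 0]) auto
qed

lemma kernel_prod_measurable:
  "set us \<subseteq> {0..1} \<Longrightarrow> kernel_prod Q us \<in> borel \<rightarrow>\<^sub>M prob_algebra borel"
proof (induction us)
  case (Cons u us)
  then show ?case using measurable_bind_prob_space[OF Q_markov[of u]] by simp
qed simp

lemma Q_nn_weight:
  assumes "u \<in> {0..1}" "s \<le> k"
  shows "(\<integral>\<^sup>+y. ennreal (weight s y) \<partial>Q u x) \<le> ennreal (C0 * weight s x)"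
proof -
  have "(\<integral>\<^sup>+y. ennreal (weight s y) \<partial>Q u x) = (\<integral>\<^sup>+y. ennreal (D 0 u x y) * ennreal (weight s y) \<partial>\<gamma> x)"
    unfolding Q_density[OF assms(1)]
    using D_measurable[of 0 u x x] assms borel_measurable_\<gamma>[OF weight_measurable]
    by (intro nn_integral_density) auto
  also have "\<dots> = (\<integral>\<^sup>+y. ennreal (\<phi> y powr deg s * \<bar>D 0 u x y\<bar>) \<partial>\<gamma> x)"
    using D0_nonneg[OF assms(1)]
    by (intro nn_integral_cong) (simp add: ennreal_mult[symmetric] weight_def mult.commute)
  also have "\<dots> \<le> ennreal (C0 * \<phi> x powr (deg s + q * real 0))"
    using deg_mono[OF assms(2)] assms deg_nonneg by (intro D_bound) (auto simp: deg_def)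
  finally show ?thesis by (simp add: weight_def)
qed

lemma Q_integrable: "u \<in> {0..1} \<Longrightarrow> s \<le> k \<Longrightarrow> integrable (Q u x) (weight s)"
proof (rule integrableI_nonneg)
  assume u: "u \<in> {0..1}" "s \<le> k"
  show "weight s \<in> borel_measurable (Q u x)"
    using Q_space[OF u(1)] weight_measurable measurable_cong_sets[of "Q u x" borel borel borel] by blast
  show "(\<integral>\<^sup>+y. ennreal (weight s y) \<partial>Q u x) < \<infinity>"
    using Q_nn_weight[OF u, of x] by (auto simp: less_top[symmetric] top_unique)
qed (simp add: weight_nonneg)

lemma kernel_prod_space:
  "set us \<subseteq> {0..1} \<Longrightarrow> sets (kernel_prod Q us x) = sets borel \<and> prob_space (kernel_prod Q us x)"
  using measurable_space[OF kernel_prod_measurable, of us x] by (simp add: space_prob_algebra)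

lemma kernel_prod_nn_weight:
  assumes "set us \<subseteq> {0..1}" "s \<le> k"
  shows "(\<integral>\<^sup>+y. ennreal (weight s y) \<partial>kernel_prod Q us x) \<le> ennreal (C0 ^ length us * weight s x)"
  using assms(1)
proof (induction us arbitrary: x)
  case Nil
  then show ?case by (simp add: nn_integral_return)
next
  case (Cons u us)
  then have u: "u \<in> {0..1}" "set us \<subseteq> {0..1}" by auto
  have "(\<integral>\<^sup>+y. ennreal (weight s y) \<partial>kernel_prod Q (u # us) x)
      = (\<integral>\<^sup>+z. \<integral>\<^sup>+y. ennreal (weight s y) \<partial>kernel_prod Q us z \<partial>Q u x)"
    using measurable_prob_algebraD[OF kernel_prod_measurable[OF u(2)]] Q_space[OF u(1), of x]
    by (subst kernel_prod.simps, subst nn_integral_bind[where B=borel]) (auto cong: measurable_cong_sets)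
  also have "\<dots> \<le> (\<integral>\<^sup>+z. ennreal (C0 ^ length us) * ennreal (weight s z) \<partial>Q u x)"
    using Cons.IH[OF u(2)] C0 by (intro nn_integral_mono) (simp add: ennreal_mult weight_nonneg)
  also have "\<dots> = ennreal (C0 ^ length us) * (\<integral>\<^sup>+z. ennreal (weight s z) \<partial>Q u x)"
    using borel_measurable_integrable[OF Q_integrable[OF u(1) assms(2), of x]] by (intro nn_integral_cmult) simp
  also have "\<dots> \<le> ennreal (C0 ^ length us) * ennreal (C0 * weight s x)"
    by (intro mult_left_mono Q_nn_weight u assms(2)) simp
  also have "\<dots> = ennreal (C0 ^ length (u # us) * weight s x)"
    using C0 by (simp add: ennreal_mult[symmetric] weight_nonneg ac_simps)
  finally show ?case .
qed

lemma kernel_prod_integrable: "set us \<subseteq> {0..1} \<Longrightarrow> s \<le> k \<Longrightarrow> integrable (kernel_prod Q us x) (weight s)"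
proof (rule integrableI_nonneg)
  assume u: "set us \<subseteq> {0..1}" "s \<le> k"
  show "weight s \<in> borel_measurable (kernel_prod Q us x)"
    using kernel_prod_space[OF u(1)] weight_measurable measurable_cong_sets[of "kernel_prod Q us x" borel borel borel] by blast
  show "(\<integral>\<^sup>+y. ennreal (weight s y) \<partial>kernel_prod Q us x) < \<infinity>"
    using kernel_prod_nn_weight[OF u, of x] by (auto simp: less_top[symmetric] top_unique)
qed (simp add: weight_nonneg)

lemma Pop_Nil[simp]: "Pop [] g = g"
  by (simp add: Pop_def)

lemma Pop_Cons[simp]: "Pop (u # us) g = Kop 0 u (Pop us g)"
  by (simp add: Pop_def)

lemma Pop_append: "Pop (us @ vs) g = Pop us (Pop vs g)"
  by (simp add: Pop_def)

lemma Pop_one: "set us \<subseteq> {0..1} \<Longrightarrow> Pop us (\<lambda>_. 1) = (\<lambda>_. 1)"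
  by (induction us) (auto simp: Kop_0_one)

lemma Pop_weighted_fun:
  "set us \<subseteq> {0..1} \<Longrightarrow> s \<le> k \<Longrightarrow> g \<in> weighted_fun borel (weight s) \<Longrightarrow> Pop us g \<in> weighted_fun borel (weight s)"
proof (induction us)
  case (Cons u us)
  then show ?case using E.K_weighted_fun[of s 0 u "Pop us g"] by simp
qed simp

lemma Pop_functional:
  "set us \<subseteq> {0..1} \<Longrightarrow> s \<le> k \<Longrightarrow> weighted_functional borel (weight s) T \<Longrightarrow>
    weighted_functional borel (weight s) (\<lambda>g. T (Pop us g))"
proof (induction us arbitrary: T)
  case (Cons u us)
  then show ?case using E.comp_functional[of s 0 u T] Cons.IH[of "\<lambda>g. T (Kop 0 u g)"] by simp
qed simp

lemma Pop_bound:
  "set us \<subseteq> {0..1} \<Longrightarrow> s \<le> k \<Longrightarrow> weighted_functional borel (weight s) T \<Longrightarrow>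
    dual_bound borel (weight s) T e \<Longrightarrow>
    dual_bound borel (weight s) (\<lambda>g. T (Pop us g)) ((C0 * (1 + 1)) ^ length us * e)"
proof (induction us arbitrary: T e)
  case (Cons u us)
  then show ?case
    using E.comp_functional[of s 0 u T] E.comp_bound[of s 0 u T e]
      Cons.IH[of "\<lambda>g. T (Kop 0 u g)" "C0 * (1 + 1) * e"] by (simp add: ac_simps)
qed simp

text \<open>Connects the products of kernels, for which drift and minorization are assumed, with the
  products of operators used in all computations with functionals.\<close>

lemma kernel_prod_integral:
  assumes "set us \<subseteq> {0..1}" "s \<le> k" "g \<in> weighted_fun borel (weight s)"
  shows "(\<integral>y. g y \<partial>kernel_prod Q us x) = Pop us g x"
  using assms(1)
proof (induction us arbitrary: x)
  case Nil
  then show ?case using weighted_fun_measurable[OF assms(3)] by (simp add: integral_return)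
next
  case (Cons u us)
  then have u: "u \<in> {0..1}" "set us \<subseteq> {0..1}" by auto
  have "(\<integral>y. g y \<partial>(Q u x \<bind> kernel_prod Q us)) = (\<integral>z. \<integral>y. g y \<partial>kernel_prod Q us z \<partial>Q u x)"
  proof (rule integral_bind_weighted(1)[OF _ _ _ _ assms(3)])
    show "kernel_prod Q us \<in> Q u x \<rightarrow>\<^sub>M subprob_algebra borel"
      using measurable_prob_algebraD[OF kernel_prod_measurable[OF u(2)]] Q_space[OF u(1), of x]
      by (simp cong: measurable_cong_sets)
    show "space (Q u x) \<noteq> {}" using Q_space[OF u(1), of x] prob_space.not_empty by blast
    show "integrable (Q u x \<bind> kernel_prod Q us) (weight s)"
      using kernel_prod_integrable[OF Cons.prems assms(2), of x] by simp
    show "integrable (kernel_prod Q us z) (weight s)" for z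
      by (rule kernel_prod_integrable[OF u(2) assms(2)])
  qed
  also have "\<dots> = (\<integral>z. Pop us g z \<partial>Q u x)" using Cons.IH[OF u(2)] by simp
  also have "\<dots> = Kop 0 u (Pop us g) x"
    using weighted_fun_measurable[OF Pop_weighted_fun[OF u(2) assms(2,3)]] by (simp add: Kop_0[OF u(1)])
  finally show ?case by simp
qed

text \<open>The contraction of a block of \<open>m\<close> kernels takes place in the equivalent
  norm with weight \<open>1 + \<beta> * weight s\<close>. \<open>\<alpha>\<close> and
  \<open>\<beta>\<close> serve all blocks of nearby parameters at once, the source of all uniformity
  in \<open>u\<close> and \<open>n\<close>.\<close>

definition contracting :: "nat \<Rightarrow> real \<Rightarrow> real \<Rightarrow> bool" where
  "contracting s \<alpha> \<beta> \<longleftrightarrow> (\<forall>us T e. length us = m \<longrightarrow> set us \<subseteq> {0..1} \<longrightarrow>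
     (\<forall>v\<in>set us. \<forall>w\<in>set us. \<bar>v - w\<bar> < \<epsilon>) \<longrightarrow>
     weighted_functional borel (weight s) T \<longrightarrow> T (\<lambda>_. 1) = 0 \<longrightarrow>
     dual_bound borel (\<lambda>x. 1 + \<beta> * weight s x) T e \<longrightarrow>
     dual_bound borel (\<lambda>x. 1 + \<beta> * weight s x) (\<lambda>g. T (Pop us g)) (\<alpha> * e))"

lemma contractingD:
  "contracting s \<alpha> \<beta> \<Longrightarrow> length us = m \<Longrightarrow> set us \<subseteq> {0..1} \<Longrightarrow>
   (\<forall>v\<in>set us. \<forall>w\<in>set us. \<bar>v - w\<bar> < \<epsilon>) \<Longrightarrow>
   weighted_functional borel (weight s) T \<Longrightarrow> T (\<lambda>_. 1) = 0 \<Longrightarrow>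
   dual_bound borel (\<lambda>x. 1 + \<beta> * weight s x) T e \<Longrightarrow>
   dual_bound borel (\<lambda>x. 1 + \<beta> * weight s x) (\<lambda>g. T (Pop us g)) (\<alpha> * e)"
  unfolding contracting_def by blast

text \<open>Harris' theorem for \<open>V = weight s\<close>, the power \<open>r = deg s / d0\<close>
  of the Lyapunov function. Jensen's inequality and subadditivity turn the drift constants into
  \<open>lam powr r\<close> and \<open>b powr r\<close>; the sublevel set of \<open>V\<close> at
  \<open>R\<close> is that of \<open>\<phi> powr d0\<close> at
  \<open>R powr (d0 / deg s)\<close>.\<close>

lemma contraction:
  assumes s: "s \<le> k"
  obtains \<alpha> \<beta> where "0 \<le> \<alpha>" "\<alpha> < 1" "0 < \<beta>" "contracting s \<alpha> \<beta>"
proof -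
  have deg_pos: "0 < deg s" using d1_pos q by (simp add: deg_def add_pos_nonneg)
  have deg_le: "deg s \<le> d0" using deg_mono[OF s] d0 by (simp add: deg_def)
  define r where "r = deg s / d0"
  have r: "0 < r" "r \<le> 1" "d0 * r = deg s" using deg_pos deg_le by (auto simp: r_def)
  have d0_pos: "d0 > 0" using deg_pos deg_le by simp
  define lam' where "lam' = lam powr r"
  define b' where "b' = b powr r"
  have "lam powr r < 1 powr r" using params r by (intro powr_less_mono2) auto
  then have lam': "0 \<le> lam'" "lam' < 1" by (auto simp: lam'_def)
  have b': "0 < b'" using params by (simp add: b'_def)
  define R where "R = 4 * b' / (1 - lam')"
  have R: "R > 0" using b' lam' by (simp add: R_def)
  define R' where "R' = R powr (d0 / deg s)"
  have R': "R' > 0" using R by (simp add: R'_def)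
  obtain \<alpha> \<beta> where \<alpha>\<beta>: "0 \<le> \<alpha>" "\<alpha> < 1" "0 < \<beta>" "2 * \<beta> * b' \<le> \<eta> R'" "lam' \<le> \<alpha>"
    "2 * (1 - \<alpha>) + 2 * \<beta> * b' \<le> (\<alpha> - lam') * \<beta> * R" "1 - \<eta> R' / 2 \<le> \<alpha>"
    using Harris_constants[OF lam' b' \<eta>[OF R']] unfolding R_def by blast
  show ?thesis
  proof (rule that[OF \<alpha>\<beta>(1-3)], unfold contracting_def, intro allI impI)
    fix us and T :: "('a \<Rightarrow> real) \<Rightarrow> real" and e
    assume us: "length us = m" "set us \<subseteq> {0..1}" "\<forall>v\<in>set us. \<forall>w\<in>set us. \<bar>v - w\<bar> < \<epsilon>"
      and T: "weighted_functional borel (weight s) T" "T (\<lambda>_. 1) = 0"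
        "dual_bound borel (\<lambda>x. 1 + \<beta> * weight s x) T e"
    have T': "weighted_functional borel (\<lambda>x. 1 + \<beta> * weight s x) T"
    proof (rule functional_mono[OF T(1), of "1 + \<beta>"])
      show "1 + \<beta> * weight s x \<le> (1 + \<beta>) * weight s x" for x
        using weight_ge_1[of s x] by (simp add: algebra_simps)
    qed (use \<alpha>\<beta>(3) weight_nonneg in auto)
    have "dual_bound borel (\<lambda>x. 1 + \<beta> * weight s x) (\<lambda>g. T (\<lambda>x. \<integral>y. g y \<partial>kernel_prod Q us x)) (\<alpha> * e)"
    proof (rule Harris_contraction[where lam=lam' and b=b' and r=R and \<eta>="\<eta> R'" and \<nu>="\<nu> R'"])
      show "(\<integral>\<^sup>+y. ennreal (weight s y) \<partial>kernel_prod Q us x) \<le> ennreal (lam' * weight s x + b')" for x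
      proof -
        have pos: "0 < \<phi> x powr d0" for x using \<phi>_ge_1[of x] by simp
        have powr: "(\<phi> x powr d0) powr r = weight s x" for x by (simp add: powr_powr r weight_def)
        have "(\<integral>\<^sup>+y. ennreal ((\<phi> y powr d0) powr r) \<partial>kernel_prod Q us x) \<le> ennreal ((lam * \<phi> x powr d0 + b) powr r)"
        proof (rule nn_integral_powr_le)
          show "prob_space (kernel_prod Q us x)" using kernel_prod_space[OF us(2)] by simp
          have "(\<lambda>y. \<phi> y powr d0) \<in> borel_measurable borel" by measurable
          then show "(\<lambda>y. \<phi> y powr d0) \<in> borel_measurable (kernel_prod Q us x)"
            using kernel_prod_space[OF us(2), of x] measurable_cong_sets[of "kernel_prod Q us x" borel borel borel] by blast
          show "0 < lam * \<phi> x powr d0 + b" using pos[of x] params by (simp add: add_pos_pos)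
        qed (use pos drift[OF us] r in auto)
        also have "\<dots> \<le> ennreal (lam' * weight s x + b')"
        proof (rule ennreal_leI)
          have "(lam * \<phi> x powr d0 + b) powr r \<le> (lam * \<phi> x powr d0) powr r + b powr r"
            using pos[of x] params r by (intro powr_add_le) auto
          also have "\<dots> = lam' * weight s x + b'"
            using params by (simp add: powr_mult lam'_def b'_def powr)
          finally show "(lam * \<phi> x powr d0 + b) powr r \<le> lam' * weight s x + b'" .
        qed
        finally show ?thesis by (simp add: powr)
      qed
      show "ennreal (\<eta> R') * emeasure (\<nu> R') A \<le> emeasure (kernel_prod Q us x) A"
        if "weight s x \<le> R" "A \<in> sets borel" for x A
      proof (rule minorization[OF R' us _ that(2)])
        have "weight s x powr (d0 / deg s) \<le> R powr (d0 / deg s)"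
          using that(1) weight_nonneg d0_pos deg_pos by (intro powr_mono2) auto
        then show "\<phi> x powr d0 \<le> R'" using deg_pos by (simp add: weight_def powr_powr R'_def)
      qed
    qed (use kernel_prod_measurable[OF us(2)] \<nu>[OF R'] \<eta>[OF R'] lam' b' \<alpha>\<beta> T T' weight_nonneg in auto)
    moreover have "(\<lambda>x. \<integral>y. g y \<partial>kernel_prod Q us x) = Pop us g"
      if "g \<in> weighted_ball borel (\<lambda>x. 1 + \<beta> * weight s x)" for g
    proof -
      have "g \<in> weighted_fun borel (weight s)"
      proof (rule weighted_fun_mono[OF weighted_ball_fun[OF that]])
        show "1 + \<beta> * weight s x \<le> (1 + \<beta>) * weight s x" for x
          using weight_ge_1[of s x] by (simp add: algebra_simps)
      qed (use \<alpha>\<beta>(3) weight_nonneg in auto)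
      then show ?thesis by (intro ext kernel_prod_integral[OF us(2) s])
    qed
    ultimately show "dual_bound borel (\<lambda>x. 1 + \<beta> * weight s x) (\<lambda>g. T (Pop us g)) (\<alpha> * e)"
      by (simp add: dual_bound_def)
  qed
qed

section \<open>Stability of \<open>I - Q u\<close> and its resolvent\<close>

lemma equiv_weight_le:
  assumes "0 < \<beta>"
  shows "1 + \<beta> * weight s x \<le> (1 + \<beta>) * weight s x" "weight s x \<le> (1 / \<beta>) * (1 + \<beta> * weight s x)"
  using weight_ge_1[of s x] assms by (auto simp: field_simps)

lemma equiv_functional:
  assumes "0 < \<beta>" "weighted_functional borel (weight s) T"
  shows "weighted_functional borel (\<lambda>x. 1 + \<beta> * weight s x) T"
  by (rule functional_mono[OF assms(2), of "1 + \<beta>"]) (use assms equiv_weight_le weight_nonneg in auto)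

lemma bound_to_equiv:
  assumes "0 < \<beta>" "weighted_functional borel (weight s) T" "dual_bound borel (weight s) T e"
  shows "dual_bound borel (\<lambda>x. 1 + \<beta> * weight s x) T ((1 + \<beta>) * e)"
  by (rule dual_bound_mono[OF assms(3,2)]) (use assms(1) equiv_weight_le weight_nonneg in auto)

lemma bound_from_equiv:
  assumes "0 < \<beta>" "weighted_functional borel (weight s) T" "dual_bound borel (\<lambda>x. 1 + \<beta> * weight s x) T e"
  shows "dual_bound borel (weight s) T ((1 / \<beta>) * e)"
  by (rule dual_bound_mono[OF assms(3) equiv_functional[OF assms(1,2)]])
    (use assms(1) equiv_weight_le[OF assms(1)] weight_nonneg in \<open>auto simp: add_nonneg_nonneg\<close>)

lemma replicate_close: "u \<in> {0..1} \<Longrightarrow> set (replicate n u) \<subseteq> {0..1} \<and>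
    (\<forall>v\<in>set (replicate n u). \<forall>w\<in>set (replicate n u). \<bar>v - w\<bar> < \<epsilon>)"
  using params by (auto simp: set_replicate_conv_if)

text \<open>Let \<open>P\<close> be the \<open>m\<close>-th iterate and \<open>c\<close> the norm
  bound \<open>C0 * (1 + 1)\<close> of one step. Telescoping bounds \<open>S - S P\<close> by the
  sum of \<open>c ^ i * e\<close>, and \<open>S P\<close> is contracted; so a bound \<open>B\<close>
  on the first part gives \<open>B / (1 - \<alpha>)\<close> for \<open>S\<close> in the equivalent
  norm. The remaining factors of \<open>c2\<close> come from changing norms.\<close>

lemma stable:
  assumes s: "s \<le> k"
  obtains c2 where "c2 > 0" "\<And>u S e. u \<in> {0..1} \<Longrightarrow> weighted_functional borel (weight s) S \<Longrightarrow>
      S (\<lambda>_. 1) = 0 \<Longrightarrow> dual_bound borel (weight s) (\<lambda>g. S g - S (Kop 0 u g)) e \<Longrightarrow>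
      dual_bound borel (weight s) S (c2 * e)"
proof -
  obtain \<alpha> \<beta> where \<alpha>: "0 \<le> \<alpha>" "\<alpha> < 1" and \<beta>: "0 < \<beta>" and contr: "contracting s \<alpha> \<beta>"
    using contraction[OF s] by blast
  define c where "c = C0 * (1 + 1)"
  have c: "c > 0" using C0 by (simp add: c_def)
  define c2 where "c2 = (1 / \<beta>) * ((1 + \<beta>) * (\<Sum>i<m. c ^ i) / (1 - \<alpha>))"
  have "(\<Sum>i<m. c ^ i) > 0" using c params(1) by (intro sum_pos) (auto simp: lessThan_empty_iff)
  then have "c2 > 0" using \<alpha> \<beta> by (simp add: c2_def)
  then show ?thesis
  proof (rule that)
    fix u S e
    assume u: "u \<in> {0..1}" and S: "weighted_functional borel (weight s) S" "S (\<lambda>_. 1) = 0"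
      and e: "dual_bound borel (weight s) (\<lambda>g. S g - S (Kop 0 u g)) e"
    let ?W = "\<lambda>x. 1 + \<beta> * weight s x" and ?P = "Pop (replicate m u)"
    have rep: "set (replicate n u) \<subseteq> {0..1}" for n using replicate_close[OF u] by blast
    have d: "weighted_functional borel (weight s) (\<lambda>g. S g - S (Kop 0 u g))"
      using functional_minus[OF S(1) E.comp_functional[of s 0 u S]] s u S by simp
    have "dual_bound borel (weight s) (\<lambda>g. \<Sum>i<m. S (Pop (replicate i u) g) - S (Kop 0 u (Pop (replicate i u) g)))
        (\<Sum>i<m. c ^ i * e)"
      using Pop_bound[OF rep s d e] by (intro dual_bound_sum) (simp add: c_def)
    moreover have "(\<Sum>i<m. S (Pop (replicate i u) g) - S (Kop 0 u (Pop (replicate i u) g))) = S g - S (?P g)" for g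
      using sum_lessThan_telescope'[of "\<lambda>i. S (Pop (replicate i u) g)" m] by simp
    ultimately have "dual_bound borel (weight s) (\<lambda>g. S g - S (?P g)) ((\<Sum>i<m. c ^ i) * e)"
      by (simp add: sum_distrib_right)
    then have B: "dual_bound borel ?W (\<lambda>g. S g - S (?P g)) ((1 + \<beta>) * ((\<Sum>i<m. c ^ i) * e))"
      by (intro bound_to_equiv[OF \<beta>] functional_minus S Pop_functional rep s)
    define B where "B = (1 + \<beta>) * ((\<Sum>i<m. c ^ i) * e)"
    have W0: "0 \<le> ?W x" for x using \<beta> weight_nonneg[of s x] by simp
    obtain e0 where "e0 > 0" and e0: "dual_bound borel ?W S e0"
      using functional_bounded[OF equiv_functional[OF \<beta> S(1)] W0] by blast
    \<comment> \<open>From some finite bound \<open>e0\<close>, each use of the contraction shrinks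
      the excess over the fixed point \<open>B / (1 - \<alpha>)\<close> of
      \<open>B + \<alpha> * t\<close> by the factor \<open>\<alpha>\<close>.\<close>
    have iter: "dual_bound borel ?W S (B / (1 - \<alpha>) + \<alpha> ^ n * e0)" for n
    proof (induction n)
      case 0
      have "0 \<le> B" unfolding B_def by (rule dual_bound_nonneg[OF B W0])
      then show ?case using \<alpha> by (auto intro: dual_bound_le[OF e0])
    next
      case (Suc n)
      have "dual_bound borel ?W (\<lambda>g. S (?P g)) (\<alpha> * (B / (1 - \<alpha>) + \<alpha> ^ n * e0))"
        using replicate_close[OF u, of m] by (intro contractingD[OF contr] S Suc) auto
      from dual_bound_add[OF B[folded B_def] this]
      have "dual_bound borel ?W S (B + \<alpha> * (B / (1 - \<alpha>) + \<alpha> ^ n * e0))" by simp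
      moreover have "B + \<alpha> * (B / (1 - \<alpha>) + \<alpha> ^ n * e0) = B / (1 - \<alpha>) + \<alpha> ^ Suc n * e0"
        using \<alpha> by (simp add: field_simps)
      ultimately show ?case by simp
    qed
    have "dual_bound borel ?W S (B / (1 - \<alpha>))"
      unfolding dual_bound_def
    proof
      fix g assume g: "g \<in> weighted_ball borel ?W"
      have "(\<lambda>n. B / (1 - \<alpha>) + \<alpha> ^ n * e0) \<longlonglongrightarrow> B / (1 - \<alpha>) + 0 * e0"
        using \<alpha> by (intro tendsto_intros LIMSEQ_power_zero) auto
      then have "\<bar>S g\<bar> \<le> B / (1 - \<alpha>) + 0 * e0"
        using iter g by (intro tendsto_lowerbound[OF _ always_eventually]) (auto simp: dual_bound_def)
      then show "\<bar>S g\<bar> \<le> B / (1 - \<alpha>)" by simp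
    qed
    from bound_from_equiv[OF \<beta> S(1) this]
    show "dual_bound borel (weight s) S (c2 * e)" by (simp add: c2_def B_def mult.assoc)
  qed
qed

text \<open>The Neumann series of \<open>(I - Q\<^sub>u)\<^sup>-\<^sup>1\<close>, summed in blocks of length \<open>m\<close>.\<close>

definition resolvent :: "real \<Rightarrow> (('a \<Rightarrow> real) \<Rightarrow> real) \<Rightarrow> ('a \<Rightarrow> real) \<Rightarrow> real" where
  "resolvent u S g = (\<Sum>j. \<Sum>i<m. S (Pop (replicate (m * j + i) u) g))"

text \<open>On mass zero the blocks decay geometrically, so the series converges to a functional of
  the same weight; composing with \<open>Kop 0 u\<close> shifts the iterates by one, and the
  difference telescopes to \<open>S\<close>.\<close>

lemma resolvent:
  assumes s: "s \<le> k" and u: "u \<in> {0..1}" and S: "weighted_functional borel (weight s) S" "S (\<lambda>_. 1) = 0"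
  shows "weighted_functional borel (weight s) (resolvent u S)" "resolvent u S (\<lambda>_. 1) = 0"
    "g \<in> weighted_fun borel (weight s) \<Longrightarrow> resolvent u S g - resolvent u S (Kop 0 u g) = S g"
proof -
  obtain \<alpha> \<beta> where \<alpha>: "0 \<le> \<alpha>" "\<alpha> < 1" and \<beta>: "0 < \<beta>" and contr: "contracting s \<alpha> \<beta>"
    using contraction[OF s] by blast
  let ?W = "\<lambda>x. 1 + \<beta> * weight s x"
  have rep: "set (replicate n u) \<subseteq> {0..1}" for n using replicate_close[OF u] by blast
  have W0: "0 \<le> ?W x" for x using \<beta> weight_nonneg[of s x] by simp
  obtain e0 where "e0 > 0" and e0: "dual_bound borel ?W S e0"
    using functional_bounded[OF equiv_functional[OF \<beta> S(1)] W0] by blast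
  define c where "c = C0 * (1 + 1)"
  define Sj where "Sj j g = S (Pop (replicate (m * j) u) g)" for j g
  have Sj_wf: "weighted_functional borel (weight s) (Sj j)" for j
    unfolding Sj_def by (rule Pop_functional[OF rep s S(1)])
  have Sj_one: "Sj j (\<lambda>_. 1) = 0" for j by (simp add: Sj_def Pop_one[OF rep] S(2))
  have Sj_Suc: "Sj (Suc j) g = Sj j (Pop (replicate m u) g)" for j g
  proof -
    have "replicate (m * Suc j) u = replicate (m * j) u @ replicate m u"
      by (simp add: replicate_add[symmetric] add.commute)
    then show ?thesis by (simp only: Sj_def Pop_append)
  qed
  have Sj_bound: "dual_bound borel ?W (Sj j) (\<alpha> ^ j * e0)" for j
  proof (induction j)
    case 0
    then show ?case using e0 by (simp add: Sj_def)
  next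
    case (Suc j)
    have "dual_bound borel ?W (\<lambda>g. Sj j (Pop (replicate m u) g)) (\<alpha> * (\<alpha> ^ j * e0))"
      using replicate_close[OF u, of m] by (intro contractingD[OF contr] Sj_wf Sj_one Suc) auto
    then show ?case by (simp add: Sj_Suc[abs_def] mult.assoc)
  qed
  define U where "U j g = (\<Sum>i<m. Sj j (Pop (replicate i u) g))" for j g
  have U_eq: "(\<Sum>i<m. S (Pop (replicate (m * j + i) u) g)) = U j g" for j g
    by (simp add: U_def Sj_def replicate_add Pop_append)
  have U_wf: "weighted_functional borel (weight s) (U j)" for j
    unfolding U_def by (intro functional_Sum Pop_functional rep s Sj_wf)
  have U_bound: "dual_bound borel (weight s) (U j) (\<Sum>i<m. c ^ i * ((1 / \<beta>) * (\<alpha> ^ j * e0)))" for j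
    unfolding U_def
    using Pop_bound[OF rep s Sj_wf bound_from_equiv[OF \<beta> Sj_wf Sj_bound]]
    by (intro dual_bound_sum) (simp add: c_def)
  have "summable (\<lambda>j. \<alpha> ^ j)" using \<alpha> by (intro summable_geometric) auto
  then have "summable (\<lambda>j. (\<Sum>i<m. c ^ i * (1 / \<beta>) * e0) * \<alpha> ^ j)" by (rule summable_mult)
  then have sm: "summable (\<lambda>j. \<Sum>i<m. c ^ i * ((1 / \<beta>) * (\<alpha> ^ j * e0)))"
    by (simp add: sum_distrib_left sum_distrib_right ac_simps)
  have res: "resolvent u S = (\<lambda>g. \<Sum>j. U j g)"
    by (simp add: resolvent_def U_eq fun_eq_iff)
  show "weighted_functional borel (weight s) (resolvent u S)"
    unfolding res by (rule functional_suminf(1)[OF U_wf U_bound sm]) (rule weight_nonneg)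
  show "resolvent u S (\<lambda>_. 1) = 0"
    by (simp add: res U_def Pop_one[OF rep] Sj_one)
  assume g: "g \<in> weighted_fun borel (weight s)"
  have Kg: "Kop 0 u g \<in> weighted_fun borel (weight s)"
    using E.K_weighted_fun[of s 0 u g] s u g by simp
  have summ: "summable (\<lambda>j. U j h)" if "h \<in> weighted_fun borel (weight s)" for h
    by (rule functional_suminf(2)[OF U_wf U_bound sm _ that]) (rule weight_nonneg)
  have shift: "Pop (replicate i u) (Kop 0 u g) = Pop (replicate (Suc i) u) g" for i
    using Pop_append[of "replicate i u" "[u]" g] by (simp add: replicate_append_same)
  \<comment> \<open>Inside a block the terms telescope, leaving the first iterate of block
    \<open>j\<close> minus that of block \<open>Suc j\<close>.\<close>
  have diff: "U j g - U j (Kop 0 u g) = Sj j g - Sj (Suc j) g" for j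
    unfolding U_def shift sum_subtractf[symmetric] Sj_Suc
    using sum_lessThan_telescope'[of "\<lambda>i. Sj j (Pop (replicate i u) g)" m] by simp
  have "(\<lambda>j. Sj j g) \<longlonglongrightarrow> 0"
  proof -
    obtain a where a: "a > 0" "(\<lambda>x. g x / a) \<in> weighted_ball borel (weight s)"
      using weighted_fun_ball[OF g weight_nonneg] by blast
    have "norm (Sj j g) \<le> \<alpha> ^ j * ((1 / \<beta>) * e0 * a)" for j
    proof -
      have "\<bar>Sj j (\<lambda>x. g x / a)\<bar> \<le> (1 / \<beta>) * (\<alpha> ^ j * e0)"
        using bound_from_equiv[OF \<beta> Sj_wf Sj_bound, of j] a(2) by (simp add: dual_bound_def)
      moreover have "Sj j (\<lambda>x. g x / a) = Sj j g / a"
        using functional_scale[OF Sj_wf g, of j "1/a"] by simp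
      ultimately show ?thesis using a(1) by (simp add: divide_le_eq ac_simps)
    qed
    moreover have "(\<lambda>j. \<alpha> ^ j * ((1 / \<beta>) * e0 * a)) \<longlonglongrightarrow> 0"
      using \<alpha> by (intro tendsto_mult_left_zero LIMSEQ_power_zero) auto
    ultimately show ?thesis by (rule Lim_null_comparison[OF always_eventually[OF allI]])
  qed
  from telescope_sums'[OF this] have "(\<Sum>j. Sj j g - Sj (Suc j) g) = S g"
    by (simp add: sums_iff Sj_def)
  moreover have "(\<Sum>j. U j g) - (\<Sum>j. U j (Kop 0 u g)) = (\<Sum>j. U j g - U j (Kop 0 u g))"
    by (rule suminf_diff[OF summ[OF g] summ[OF Kg]])
  ultimately show "resolvent u S g - resolvent u S (Kop 0 u g) = S g"
    by (simp add: res diff)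
qed

section \<open>Moments, Lipschitz continuity and derivatives of the invariant measures\<close>

lemma \<pi>_space: "u \<in> {0..1} \<Longrightarrow> sets (\<pi> u) = sets borel \<and> prob_space (\<pi> u)"
  using \<pi>[of u] by (simp add: invariant_prob_def space_prob_algebra)

lemma \<pi>_one: "u \<in> {0..1} \<Longrightarrow> (\<integral>x. 1 \<partial>\<pi> u) = (1 :: real)"
  using \<pi>_space[of u] by (simp add: prob_space.prob_space)

lemma \<pi>_bind: "u \<in> {0..1} \<Longrightarrow> \<pi> u \<bind> kernel_prod Q (replicate n u) = \<pi> u"
proof (induction n)
  case 0
  then show ?case using \<pi>_space[of u] by (simp add: bind_return'')
next
  case (Suc n)
  have "\<pi> u \<bind> kernel_prod Q (replicate (Suc n) u) = (\<pi> u \<bind> Q u) \<bind> kernel_prod Q (replicate n u)"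
    unfolding replicate_Suc kernel_prod.simps
  proof (rule bind_assoc[symmetric])
    show "Q u \<in> \<pi> u \<rightarrow>\<^sub>M subprob_algebra borel"
      using measurable_prob_algebraD[OF Q_markov[OF Suc.prems]] \<pi>_space[OF Suc.prems]
      by (simp cong: measurable_cong_sets)
    show "kernel_prod Q (replicate n u) \<in> borel \<rightarrow>\<^sub>M subprob_algebra borel"
      by (intro measurable_prob_algebraD kernel_prod_measurable) (use replicate_close[OF Suc.prems] in blast)
  qed
  also have "\<pi> u \<bind> Q u = \<pi> u" using \<pi>[OF Suc.prems] by (simp add: invariant_prob_def)
  finally show ?case using Suc by simp
qed

text \<open>Integrability of \<open>V = \<phi>\<^sup>d\<^sup>0\<close> is not known beforehand, so the drift condition is applied
  to the concave truncation \<open>min V R\<close>.\<close>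

lemma \<pi>_moment:
  assumes u: "u \<in> {0..1}"
  shows "(\<integral>\<^sup>+x. ennreal (\<phi> x powr d0) \<partial>\<pi> u) \<le> ennreal (b / (1 - lam))"
proof -
  interpret \<pi>: prob_space "\<pi> u" using \<pi>_space[OF u] by simp
  define V where "V x = \<phi> x powr d0" for x
  let ?P = "kernel_prod Q (replicate m u)"
  have V[measurable]: "V \<in> borel_measurable borel" unfolding V_def by measurable
  have mb: "h \<in> borel_measurable (\<pi> u)" if "h \<in> borel_measurable borel" for h :: "'a \<Rightarrow> real"
    using that \<pi>_space[OF u] measurable_cong_sets[of "\<pi> u" borel borel borel] by blast
  have V0: "0 \<le> V x" for x by (simp add: V_def)
  have rep: "set (replicate m u) \<subseteq> {0..1}" using replicate_close[OF u] by blast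
  have P_drift: "(\<integral>\<^sup>+y. ennreal (V y) \<partial>?P x) \<le> ennreal (lam * V x + b)" for x
    unfolding V_def using replicate_close[OF u, of m] by (intro drift) auto
  \<comment> \<open>The fixed point of \<open>t \<mapsto> lam * t + b\<close>; above it the right
    side of the drift condition lies below \<open>t\<close>.\<close>
  define N0 where "N0 = b / (1 - lam)"
  have N0: "N0 > 0" using params by (simp add: N0_def)
  have trunc: "(\<integral>\<^sup>+x. ennreal (V x) * indicator {x. V x < R} x \<partial>\<pi> u) \<le> ennreal N0" if R: "R \<ge> N0" for R
  proof -
    have R0: "0 < R" using R N0 by simp
    define g1 where "g1 x = min (V x) R" for x
    define g2 where "g2 x = min (lam * V x + b) R" for x
    have int: "integrable (\<pi> u) g1" "integrable (\<pi> u) g2" "integrable (\<pi> u) (\<lambda>x. V x * indicator {x. V x < R} x)"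
      "integrable (\<pi> u) (\<lambda>x. (indicator {x. V x < R} x :: real))"
    proof -
      have "g1 \<in> borel_measurable borel" "g2 \<in> borel_measurable borel"
        "(\<lambda>x. V x * indicator {x. V x < R} x) \<in> borel_measurable borel"
        "(\<lambda>x. (indicator {x. V x < R} x :: real)) \<in> borel_measurable borel"
        unfolding g1_def g2_def by measurable
      then show "integrable (\<pi> u) g1" "integrable (\<pi> u) g2" "integrable (\<pi> u) (\<lambda>x. V x * indicator {x. V x < R} x)"
        "integrable (\<pi> u) (\<lambda>x. (indicator {x. V x < R} x :: real))"
      proof (auto intro!: \<pi>.integrable_const_bound[where B="R + 1"] mb AE_I2)
        have "0 \<le> lam * V x + b" for x using V0[of x] params by simp
        then show "\<bar>g2 x\<bar> \<le> R + 1" for x using R0 by (auto simp: g2_def min_def)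
      qed (use V0 R0 in \<open>auto simp: g1_def indicator_def min_def\<close>)
    qed
    \<comment> \<open>By invariance the integral of \<open>min V R\<close> equals that of its image
      under the block kernel. The image is bounded both by \<open>lam * V + b\<close> and by
      \<open>R\<close>, hence by \<open>g2\<close>.\<close>
    have "ennreal (\<integral>x. g1 x \<partial>\<pi> u) = (\<integral>\<^sup>+x. ennreal (g1 x) \<partial>\<pi> u)"
      using V0 R0 by (intro nn_integral_eq_integral[symmetric] int) (auto simp: g1_def)
    also have "\<dots> = (\<integral>\<^sup>+x. \<integral>\<^sup>+y. ennreal (g1 y) \<partial>?P x \<partial>\<pi> u)"
    proof -
      have "?P \<in> \<pi> u \<rightarrow>\<^sub>M subprob_algebra borel"
        using measurable_prob_algebraD[OF kernel_prod_measurable[OF rep]] \<pi>_space[OF u]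
        by (simp cong: measurable_cong_sets)
      moreover have "(\<lambda>x. ennreal (g1 x)) \<in> borel_measurable borel" unfolding g1_def by measurable
      ultimately have "(\<integral>\<^sup>+x. ennreal (g1 x) \<partial>(\<pi> u \<bind> ?P)) = (\<integral>\<^sup>+x. \<integral>\<^sup>+y. ennreal (g1 y) \<partial>?P x \<partial>\<pi> u)"
        by (intro nn_integral_bind[where B=borel])
      then show ?thesis by (simp add: \<pi>_bind[OF u])
    qed
    also have "\<dots> \<le> (\<integral>\<^sup>+x. ennreal (g2 x) \<partial>\<pi> u)"
    proof (rule nn_integral_mono)
      fix x
      interpret P: prob_space "?P x" using kernel_prod_space[OF rep] by blast
      have "(\<integral>\<^sup>+y. ennreal (g1 y) \<partial>?P x) \<le> (\<integral>\<^sup>+y. ennreal (V y) \<partial>?P x)"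
        by (intro nn_integral_mono ennreal_leI) (simp add: g1_def)
      also have "\<dots> \<le> ennreal (lam * V x + b)" by (rule P_drift)
      finally have 1: "(\<integral>\<^sup>+y. ennreal (g1 y) \<partial>?P x) \<le> ennreal (lam * V x + b)" .
      have "(\<integral>\<^sup>+y. ennreal (g1 y) \<partial>?P x) \<le> (\<integral>\<^sup>+y. ennreal R \<partial>?P x)"
        by (intro nn_integral_mono ennreal_leI) (simp add: g1_def)
      then have 2: "(\<integral>\<^sup>+y. ennreal (g1 y) \<partial>?P x) \<le> ennreal R" by (simp add: P.emeasure_space_1)
      show "(\<integral>\<^sup>+y. ennreal (g1 y) \<partial>?P x) \<le> ennreal (g2 x)"
        using 1 2 by (simp add: g2_def min_def)
    qed
    also have "\<dots> = ennreal (\<integral>x. g2 x \<partial>\<pi> u)"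
      using V0 R0 params by (intro nn_integral_eq_integral int) (auto simp: g2_def add_nonneg_nonneg)
    finally have le: "(\<integral>x. g1 x \<partial>\<pi> u) \<le> (\<integral>x. g2 x \<partial>\<pi> u)"
    proof -
      assume "ennreal (\<integral>x. g1 x \<partial>\<pi> u) \<le> ennreal (\<integral>x. g2 x \<partial>\<pi> u)"
      moreover have "0 \<le> (\<integral>x. g2 x \<partial>\<pi> u)"
        using V0 R0 params by (intro Bochner_Integration.integral_nonneg) (auto simp: g2_def add_nonneg_nonneg)
      ultimately show ?thesis by (simp add: ennreal_le_iff)
    qed
    \<comment> \<open>If \<open>V x < R\<close>, then \<open>R \<ge> N0\<close> gives
      \<open>lam * V x + b \<le> R\<close>, so neither minimum is active and equality holds.
      Otherwise the left side is 0 and \<open>g1 x = R \<ge> g2 x\<close>.\<close>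
    have point: "(1 - lam) * (V x * indicator {x. V x < R} x) - b * indicator {x. V x < R} x \<le> g1 x - g2 x" for x
    proof (cases "V x < R")
      case True
      have "N0 * (1 - lam) = b" using params by (simp add: N0_def)
      moreover have "N0 * (1 - lam) \<le> R * (1 - lam)" using R params by (intro mult_right_mono) auto
      moreover have "lam * V x \<le> lam * R" using True params by (intro mult_left_mono) auto
      ultimately have "lam * V x + b \<le> R" by (simp add: algebra_simps)
      then show ?thesis using True by (simp add: g1_def g2_def algebra_simps)
    next
      case False
      then show ?thesis by (simp add: g1_def g2_def)
    qed
    have "(1 - lam) * (\<integral>x. V x * indicator {x. V x < R} x \<partial>\<pi> u) - b * (\<integral>x. indicator {x. V x < R} x \<partial>\<pi> u)
        = (\<integral>x. (1 - lam) * (V x * indicator {x. V x < R} x) - b * indicator {x. V x < R} x \<partial>\<pi> u)"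
      using int by simp
    also have "\<dots> \<le> (\<integral>x. g1 x - g2 x \<partial>\<pi> u)"
      using int by (intro integral_mono point Bochner_Integration.integrable_diff integrable_mult_right) auto
    also have "\<dots> \<le> 0" using le int by simp
    finally have "(1 - lam) * (\<integral>x. V x * indicator {x. V x < R} x \<partial>\<pi> u) \<le> b * (\<integral>x. indicator {x. V x < R} x \<partial>\<pi> u)"
      by simp
    also have "\<dots> \<le> b * (\<integral>x. 1 \<partial>\<pi> u)"
      using params int by (intro mult_left_mono integral_mono) (auto simp: indicator_def)
    finally have "(\<integral>x. V x * indicator {x. V x < R} x \<partial>\<pi> u) \<le> N0"
      using params by (simp add: N0_def \<pi>.prob_space le_divide_eq mult.commute)
    then have "ennreal (\<integral>x. V x * indicator {x. V x < R} x \<partial>\<pi> u) \<le> ennreal N0" by (rule ennreal_leI)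
    also have "ennreal (\<integral>x. V x * indicator {x. V x < R} x \<partial>\<pi> u)
        = (\<integral>\<^sup>+x. ennreal (V x * indicator {x. V x < R} x) \<partial>\<pi> u)"
      using V0 by (intro nn_integral_eq_integral[symmetric] int) auto
    also have "\<dots> = (\<integral>\<^sup>+x. ennreal (V x) * indicator {x. V x < R} x \<partial>\<pi> u)"
      by (intro nn_integral_cong) (simp add: indicator_def)
    finally show ?thesis .
  qed
  have "(\<integral>\<^sup>+x. ennreal (V x) \<partial>\<pi> u) = (\<integral>\<^sup>+x. (SUP n. ennreal (V x) * indicator {x. V x < N0 + real n} x) \<partial>\<pi> u)"
  proof (intro nn_integral_cong antisym SUP_least)
    fix x
    obtain n where "V x < real n" using reals_Archimedean2 by blast
    then have "V x < N0 + real n" using N0 by simp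
    then show "ennreal (V x) \<le> (SUP n. ennreal (V x) * indicator {x. V x < N0 + real n} x)"
      by (intro SUP_upper2[of n]) (auto simp: indicator_def)
  qed (auto simp: indicator_def)
  also have "\<dots> = (SUP n. \<integral>\<^sup>+x. ennreal (V x) * indicator {x. V x < N0 + real n} x \<partial>\<pi> u)"
  proof (rule nn_integral_monotone_convergence_SUP)
    show "incseq (\<lambda>n x. ennreal (V x) * indicator {x. V x < N0 + real n} x)"
      by (auto simp: incseq_def le_fun_def indicator_def)
    show "(\<lambda>x. ennreal (V x) * indicator {x. V x < N0 + real n} x) \<in> borel_measurable (\<pi> u)" for n
    proof -
      have "(\<lambda>x. ennreal (V x) * indicator {x. V x < N0 + real n} x) \<in> borel_measurable borel" by measurable
      then show ?thesis using \<pi>_space[OF u] measurable_cong_sets[of "\<pi> u" borel borel borel] by blast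
    qed
  qed
  also have "\<dots> \<le> ennreal N0" by (intro SUP_least trunc) simp
  finally show ?thesis by (simp add: V_def N0_def)
qed

lemma \<pi>_integrable: "u \<in> {0..1} \<Longrightarrow> s \<le> k \<Longrightarrow> integrable (\<pi> u) (weight s)"
  and \<pi>_weight_le: "u \<in> {0..1} \<Longrightarrow> s \<le> k \<Longrightarrow> (\<integral>x. weight s x \<partial>\<pi> u) \<le> b / (1 - lam)"
proof -
  assume u: "u \<in> {0..1}" and s: "s \<le> k"
  have "deg s \<le> d0" using deg_mono[OF s] d0 by (simp add: deg_def)
  then have "(\<integral>\<^sup>+x. ennreal (weight s x) \<partial>\<pi> u) \<le> (\<integral>\<^sup>+x. ennreal (\<phi> x powr d0) \<partial>\<pi> u)"
    unfolding weight_def by (intro nn_integral_mono ennreal_leI \<phi>_powr_mono)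
  also have "\<dots> \<le> ennreal (b / (1 - lam))" by (rule \<pi>_moment[OF u])
  finally have le: "(\<integral>\<^sup>+x. ennreal (weight s x) \<partial>\<pi> u) \<le> ennreal (b / (1 - lam))" .
  show int: "integrable (\<pi> u) (weight s)"
  proof (rule integrableI_nonneg)
    show "weight s \<in> borel_measurable (\<pi> u)"
      using weight_measurable \<pi>_space[OF u] measurable_cong_sets[of "\<pi> u" borel borel borel] by blast
    show "(\<integral>\<^sup>+x. ennreal (weight s x) \<partial>\<pi> u) < \<infinity>" using le by (auto simp: less_top[symmetric] top_unique)
  qed (simp add: weight_nonneg)
  show "(\<integral>x. weight s x \<partial>\<pi> u) \<le> b / (1 - lam)"
    using le params by (subst (asm) nn_integral_eq_integral[OF int]) (auto simp: weight_nonneg)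
qed

lemma \<pi>_functional: "u \<in> {0..1} \<Longrightarrow> s \<le> k \<Longrightarrow> weighted_functional borel (weight s) (\<lambda>g. \<integral>x. g x \<partial>\<pi> u)"
  using \<pi>_space \<pi>_integrable by (intro integral_functional) auto

lemma \<pi>_dual_bound: "u \<in> {0..1} \<Longrightarrow> s \<le> k \<Longrightarrow> dual_bound borel (weight s) (\<lambda>g. \<integral>x. g x \<partial>\<pi> u) (b / (1 - lam))"
  using \<pi>_space \<pi>_integrable \<pi>_weight_le by (intro integral_dual_bound) auto

lemma \<pi>_Kop:
  assumes u: "u \<in> {0..1}" and s: "s \<le> k" and g: "g \<in> weighted_fun borel (weight s)"
  shows "(\<integral>x. Kop 0 u g x \<partial>\<pi> u) = (\<integral>x. g x \<partial>\<pi> u)"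
proof -
  have inv: "\<pi> u \<bind> Q u = \<pi> u" using \<pi>[OF u] by (simp add: invariant_prob_def)
  have "(\<integral>x. g x \<partial>(\<pi> u \<bind> Q u)) = (\<integral>x. \<integral>y. g y \<partial>Q u x \<partial>\<pi> u)"
  proof (rule integral_bind_weighted(1)[OF _ _ _ _ g])
    show "Q u \<in> \<pi> u \<rightarrow>\<^sub>M subprob_algebra borel"
      using measurable_prob_algebraD[OF Q_markov[OF u]] \<pi>_space[OF u] by (simp cong: measurable_cong_sets)
    show "space (\<pi> u) \<noteq> {}" using \<pi>_space[OF u] prob_space.not_empty by blast
  qed (use \<pi>_integrable Q_integrable u s inv in auto)
  then show ?thesis using weighted_fun_measurable[OF g] by (simp add: inv Kop_0[OF u])
qed

text \<open>Invariance gives \<open>(\<pi> v - \<pi> u) (I - Q v) = \<pi> u (Q v - Q u)\<close>. The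
  right side is of order \<open>\<bar>v - u\<bar>\<close> at the cost of one level, and
  \<open>\<pi> u\<close> integrates \<open>weight 1\<close> uniformly since
  \<open>k \<ge> 1\<close>; stability concludes.\<close>

lemma \<pi>_Lipschitz:
  obtains L where "L > 0" "\<And>u v. u \<in> {0..1} \<Longrightarrow> v \<in> {0..1} \<Longrightarrow>
    dual_bound borel (weight 0) (\<lambda>g. (\<integral>x. g x \<partial>\<pi> v) - (\<integral>x. g x \<partial>\<pi> u)) (L * \<bar>v - u\<bar>)"
proof -
  obtain c2 where c2: "c2 > 0" "\<And>u S e. u \<in> {0..1} \<Longrightarrow> weighted_functional borel (weight 0) S \<Longrightarrow>
      S (\<lambda>_. 1) = 0 \<Longrightarrow> dual_bound borel (weight 0) (\<lambda>g. S g - S (Kop 0 u g)) e \<Longrightarrow>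
      dual_bound borel (weight 0) S (c2 * e)"
    using stable[of 0] by blast
  define L where "L = c2 * (C0 * (1 + 1) * (b / (1 - lam)))"
  have "L > 0" using c2 C0 params by (simp add: L_def)
  then show ?thesis
  proof (rule that)
    fix u v :: real assume uv: "u \<in> {0..1}" "v \<in> {0..1}"
    let ?S = "\<lambda>g :: 'a \<Rightarrow> real. (\<integral>x. g x \<partial>\<pi> v) - (\<integral>x. g x \<partial>\<pi> u)"
    have "dual_bound borel (weight 0) ?S (c2 * (\<bar>v - u\<bar> * (C0 * (1 + 1)) * (b / (1 - lam))))"
    proof (rule c2(2)[OF uv(2)])
      show "weighted_functional borel (weight 0) ?S" by (intro functional_minus \<pi>_functional uv) auto
      show "?S (\<lambda>_. 1) = 0" using \<pi>_one[OF uv(1)] \<pi>_one[OF uv(2)] by simp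
      show "dual_bound borel (weight 0) (\<lambda>g. ?S g - ?S (Kop 0 v g)) (\<bar>v - u\<bar> * (C0 * (1 + 1)) * (b / (1 - lam)))"
        unfolding dual_bound_def
      proof
        fix g assume g: "g \<in> weighted_ball borel (weight 0)"
        note gf = weighted_ball_fun[OF g]
        have K: "Kop 0 w g \<in> weighted_fun borel (weight 0)" if "w \<in> {0..1}" for w
          using E.K_weighted_fun[of 0 0 w g] that gf by simp
        have "?S g - ?S (Kop 0 v g) = (\<integral>x. Kop 0 v g x \<partial>\<pi> u) - (\<integral>x. Kop 0 u g x \<partial>\<pi> u)"
          using \<pi>_Kop[OF uv(1) _ gf] \<pi>_Kop[OF uv(2) _ gf] by simp
        also have "\<dots> = (\<integral>x. Kop 0 v g x - Kop 0 u g x \<partial>\<pi> u)"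
          using functional_diff[OF \<pi>_functional[OF uv(1), of 0] K[OF uv(2)] K[OF uv(1)]] by simp
        finally have eq: "?S g - ?S (Kop 0 v g) = (\<integral>x. Kop 0 v g x - Kop 0 u g x \<partial>\<pi> u)" .
        have "\<bar>\<integral>x. Kop 0 v g x - Kop 0 u g x \<partial>\<pi> u\<bar> \<le> (\<bar>v - u\<bar> * (C0 * (1 + 1))) * (b / (1 - lam))"
        proof (rule dual_boundD[OF \<pi>_dual_bound[OF uv(1) k] \<pi>_functional[OF uv(1) k]])
          show "(\<lambda>x. Kop 0 v g x - Kop 0 u g x) \<in> borel_measurable borel"
            using weighted_fun_measurable[OF K] uv by simp
          show "\<bar>Kop 0 v g x - Kop 0 u g x\<bar> \<le> \<bar>v - u\<bar> * (C0 * (1 + 1)) * weight 1 x" for x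
            using E.K_Lipschitz[of 0 0 u v x] uv k g by (simp add: dual_bound_def mult.assoc)
        qed (use C0 weight_nonneg in auto)
        then show "\<bar>?S g - ?S (Kop 0 v g)\<bar> \<le> \<bar>v - u\<bar> * (C0 * (1 + 1)) * (b / (1 - lam))"
          unfolding eq .
      qed
    qed
    then show "dual_bound borel (weight 0) ?S (L * \<bar>v - u\<bar>)" by (simp add: L_def ac_simps)
  qed
qed

text \<open>The invariance equation, differentiated \<open>Suc l\<close> times by the Leibniz rule,
  is solved for its highest derivative; the shifted index \<open>Suc i\<close> leaves out the term
  that the resolvent inverts. That these functionals are derivatives is proved in
  \<open>dual_Ck_\<pi>\<close>.\<close>

fun deriv_\<pi> :: "nat \<Rightarrow> real \<Rightarrow> ('a \<Rightarrow> real) \<Rightarrow> real" where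
  "deriv_\<pi> 0 u g = (\<integral>x. g x \<partial>\<pi> u)"
| "deriv_\<pi> (Suc l) u g =
     resolvent u (\<lambda>h. \<Sum>i\<le>l. real (Suc l choose Suc i) * deriv_\<pi> (l - i) u (Kop (Suc i) u h)) g"

text \<open>The right-hand side has mass zero because derivatives of the kernel kill constants, so
  the resolvent applies at level \<open>k - Suc l\<close>.\<close>

lemma deriv_\<pi>_props:
  assumes u: "u \<in> {0..1}"
  shows "l \<le> k \<Longrightarrow> weighted_functional borel (weight (k - l)) (deriv_\<pi> l u) \<and> (l > 0 \<longrightarrow> deriv_\<pi> l u (\<lambda>_. 1) = 0)"
    "l < k \<Longrightarrow> g \<in> weighted_fun borel (weight (k - Suc l)) \<Longrightarrow> deriv_\<pi> (Suc l) u g - deriv_\<pi> (Suc l) u (Kop 0 u g)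
       = (\<Sum>i\<le>l. real (Suc l choose Suc i) * deriv_\<pi> (l - i) u (Kop (Suc i) u g))"
proof -
  have S: "weighted_functional borel (weight (k - Suc l))
       (\<lambda>h. \<Sum>i\<le>l. real (Suc l choose Suc i) * deriv_\<pi> (l - i) u (Kop (Suc i) u h)) \<and>
      (\<Sum>i\<le>l. real (Suc l choose Suc i) * deriv_\<pi> (l - i) u (Kop (Suc i) u (\<lambda>_. 1))) = 0"
    if l: "l < k" and wf: "\<And>i. i \<le> l \<Longrightarrow> weighted_functional borel (weight (k - i)) (deriv_\<pi> i u)" for l
  proof (intro conjI functional_Sum functional_times)
    fix i assume i: "i \<in> {..l}"
    have idx: "k - Suc l + Suc i = k - (l - i)" using i l by auto
    have "weighted_functional borel (weight (k - Suc l + Suc i)) (deriv_\<pi> (l - i) u)"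
      unfolding idx by (rule wf) simp
    then show "weighted_functional borel (weight (k - Suc l)) (\<lambda>h. deriv_\<pi> (l - i) u (Kop (Suc i) u h))"
      using i l by (intro E.comp_functional u) auto
  next
    have "Kop (Suc i) u (\<lambda>_. 1) = (\<lambda>_. 0)" if "i \<le> l" for i
      using Kop_Suc_one[of i u] that l u by auto
    moreover have "deriv_\<pi> (l - i) u (\<lambda>_. 0) = 0" if "i \<le> l" for i
      by (rule functional_zero[OF wf]) simp
    ultimately show "(\<Sum>i\<le>l. real (Suc l choose Suc i) * deriv_\<pi> (l - i) u (Kop (Suc i) u (\<lambda>_. 1))) = 0"
      by (intro sum.neutral) auto
  qed
  have all: "l \<le> k \<longrightarrow> weighted_functional borel (weight (k - l)) (deriv_\<pi> l u) \<and> (l > 0 \<longrightarrow> deriv_\<pi> l u (\<lambda>_. 1) = 0)" for l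
  proof (induction l rule: less_induct)
    case (less l)
    show ?case
    proof (cases l)
      case 0
      then show ?thesis using \<pi>_functional[OF u, of k] by (simp add: deriv_\<pi>.simps[abs_def])
    next
      case (Suc p)
      show ?thesis
      proof
        assume l: "l \<le> k"
        have wf: "weighted_functional borel (weight (k - i)) (deriv_\<pi> i u)" if "i \<le> p" for i
          using less[of i] that Suc l by auto
        have s: "k - l \<le> k" by simp
        note S' = S[of p, OF _ wf]
        have pk: "p < k" using Suc l by simp
        show "weighted_functional borel (weight (k - l)) (deriv_\<pi> l u) \<and> (l > 0 \<longrightarrow> deriv_\<pi> l u (\<lambda>_. 1) = 0)"
          using resolvent(1,2)[OF s u, folded Suc] S'[OF pk] resolvent(1,2)[OF s u, of "\<lambda>h. \<Sum>i\<le>p. real (Suc p choose Suc i) * deriv_\<pi> (p - i) u (Kop (Suc i) u h)"]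
          unfolding Suc deriv_\<pi>.simps[abs_def] by auto
      qed
    qed
  qed
  then show "l \<le> k \<Longrightarrow> weighted_functional borel (weight (k - l)) (deriv_\<pi> l u) \<and> (l > 0 \<longrightarrow> deriv_\<pi> l u (\<lambda>_. 1) = 0)"
    by blast
  assume l: "l < k" and g: "g \<in> weighted_fun borel (weight (k - Suc l))"
  have "k - Suc l \<le> k" by simp
  moreover note S[OF l] all
  ultimately show "deriv_\<pi> (Suc l) u g - deriv_\<pi> (Suc l) u (Kop 0 u g)
       = (\<Sum>i\<le>l. real (Suc l choose Suc i) * deriv_\<pi> (l - i) u (Kop (Suc i) u g))"
    unfolding deriv_\<pi>.simps using l by (intro resolvent(3)[OF _ u _ _ g]) auto
qed

lemma dual_Ck_\<pi>: "dual_Ck k borel weight deriv_\<pi>"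
proof -
  have "\<exists>c2>0. \<forall>u S e. u \<in> {0..1} \<longrightarrow> weighted_functional borel (weight s) S \<longrightarrow>
      S (\<lambda>_. 1) = 0 \<longrightarrow> dual_bound borel (weight s) (\<lambda>g. S g - S (Kop 0 u g)) e \<longrightarrow>
      dual_bound borel (weight s) S (c2 * e)" if "s \<le> k" for s
    by (rule stable[OF that]) blast
  then have "\<forall>s. \<exists>c2. s \<le> k \<longrightarrow> c2 > 0 \<and> (\<forall>u S e. u \<in> {0..1} \<longrightarrow> weighted_functional borel (weight s) S \<longrightarrow>
      S (\<lambda>_. 1) = 0 \<longrightarrow> dual_bound borel (weight s) (\<lambda>g. S g - S (Kop 0 u g)) e \<longrightarrow>
      dual_bound borel (weight s) S (c2 * e))"
    by blast
  from choice[OF this] obtain c2' where c2': "\<And>s. s \<le> k \<Longrightarrow> c2' s > 0" "\<And>s u S e. s \<le> k \<Longrightarrow> u \<in> {0..1} \<Longrightarrow> weighted_functional borel (weight s) S \<Longrightarrow>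
      S (\<lambda>_. 1) = 0 \<Longrightarrow> dual_bound borel (weight s) (\<lambda>g. S g - S (Kop 0 u g)) e \<Longrightarrow>
      dual_bound borel (weight s) S (c2' s * e)"
    by blast
  \<comment> \<open>The general lemma asks for a positive constant at every level; the value 1
    beyond \<open>k\<close> is a filler.\<close>
  define stab where "stab s = (if s \<le> k then c2' s else 1)" for s
  show ?thesis
  proof (rule dual_Ck_fixpoint[where stab=stab, OF E.smooth_operators_axioms])
    show "weight s x \<le> weight (Suc s) x" for s x by (rule weight_mono) simp
    show "weighted_functional borel (weight (k - l)) (deriv_\<pi> l u)" if "l \<le> k" "u \<in> {0..1}" for l u
      using deriv_\<pi>_props(1)[OF that(2,1)] by simp
    show "deriv_\<pi> (Suc l) u (\<lambda>_. 1) = 0" if "l < k" "u \<in> {0..1}" for l u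
      using deriv_\<pi>_props(1)[OF that(2), of "Suc l"] that by (simp del: deriv_\<pi>.simps)
    show "deriv_\<pi> l u (\<lambda>_. 1) = deriv_\<pi> l v (\<lambda>_. 1)" if "l \<le> k" "u \<in> {0..1}" "v \<in> {0..1}" for l u v
      using deriv_\<pi>_props(1)[OF that(2,1)] deriv_\<pi>_props(1)[OF that(3,1)] \<pi>_one[OF that(2)] \<pi>_one[OF that(3)]
      by (cases l) (auto simp del: deriv_\<pi>.simps(2))
    show "deriv_\<pi> l u g = leibniz deriv_\<pi> Kop l u g"
      if l: "l \<le> k" "u \<in> {0..1}" and g: "g \<in> weighted_ball borel (weight (k - l))" for l u g
    proof (cases l)
      case 0
      then show ?thesis using \<pi>_Kop[OF l(2) _ weighted_ball_fun[OF g]] by (simp add: leibniz_def)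
    next
      case (Suc p)
      have "leibniz deriv_\<pi> Kop (Suc p) u g = deriv_\<pi> (Suc p) u (Kop 0 u g)
          + (\<Sum>i\<le>p. real (Suc p choose Suc i) * deriv_\<pi> (p - i) u (Kop (Suc i) u g))"
        unfolding leibniz_def by (subst sum.atMost_Suc_shift) (simp del: deriv_\<pi>.simps binomial_Suc_Suc)
      then show ?thesis
        using deriv_\<pi>_props(2)[OF l(2), of p g] g Suc l weighted_ball_fun[of g] by (simp del: deriv_\<pi>.simps binomial_Suc_Suc)
    qed
    show "stab s > 0" for s using c2'(1)[of s] by (simp add: stab_def)
    show "dual_bound borel (weight s) S (stab s * e)"
      if "s \<le> k" "u \<in> {0..1}" "weighted_functional borel (weight s) S" "S (\<lambda>_. 1) = 0"
        "dual_bound borel (weight s) (\<lambda>g. S g - S (Kop 0 u g)) e" for s u S e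
      using c2'(2)[OF that] that(1) by (simp add: stab_def)
  qed
qed

end

section \<open>Finite-dimensional laws\<close>

text \<open>Names the kernel in the recursion of \<open>path_law\<close>. Windows of the array
  satisfy the same recursion with the kernel of the current time, so both are handled by the same
  lemmas.\<close>

definition push :: "nat \<Rightarrow> ('a::topological_space \<Rightarrow> 'a measure) \<Rightarrow> (nat \<Rightarrow> 'a) \<Rightarrow> (nat \<Rightarrow> 'a) measure" where
  "push j \<kappa> x = distr (\<kappa> (x j)) (pow_space (Suc (Suc j))) (\<lambda>y. x(Suc j := y))"

lemma measurable_upd_pow_space:
  "(\<lambda>(x, y). x(Suc j := y)) \<in> pow_space (Suc j) \<Otimes>\<^sub>M borel \<rightarrow>\<^sub>M pow_space (Suc (Suc j))"
  using measurable_add_dim[of "Suc j" "{..<Suc j}" "\<lambda>_. borel"] by (simp add: lessThan_Suc)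

lemma measurable_upd_pow_space1:
  "x \<in> space (pow_space (Suc j)) \<Longrightarrow> (\<lambda>y. x(Suc j := y)) \<in> borel \<rightarrow>\<^sub>M pow_space (Suc (Suc j))"
  using measurable_compose[OF measurable_Pair1' measurable_upd_pow_space] by simp

lemma measurable_last_pow_space: "(\<lambda>x. x j) \<in> pow_space (Suc j) \<rightarrow>\<^sub>M borel"
  by (rule measurable_component_singleton) simp

lemma push_measurable:
  assumes "\<kappa> \<in> borel \<rightarrow>\<^sub>M prob_algebra borel"
  shows "push j \<kappa> \<in> pow_space (Suc j) \<rightarrow>\<^sub>M prob_algebra (pow_space (Suc (Suc j)))"
  unfolding push_def
  by (rule measurable_distr_prob_space2[OF measurable_compose[OF measurable_last_pow_space assms]
        measurable_upd_pow_space])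

lemma path_law_push: "path_law \<mu> \<kappa> (Suc (Suc j)) = path_law \<mu> \<kappa> (Suc j) \<bind> push j \<kappa>"
  by (simp add: push_def[abs_def])

lemma window_measurable:
  assumes "\<And>s. s \<le> n \<Longrightarrow> Y s \<in> M \<rightarrow>\<^sub>M borel" "t + j \<le> n + 1"
  shows "(\<lambda>\<omega>. \<lambda>i\<in>{..<j}. Y (t + i) \<omega>) \<in> M \<rightarrow>\<^sub>M pow_space j"
  using assms by (intro measurable_restrict) auto

text \<open>The Markov property speaks about conditional probabilities given the whole past. The
  joint law of the window and the next state is identified on rectangles
  \<open>B \<times> A\<close>, where it reduces to integrating that conditional probability over an
  event of the past.\<close>

lemma window_law_push:
  assumes M: "prob_space M" and chain: "markov_chain M n Y \<mu> \<kappa>"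
    and \<kappa>: "\<And>t. t \<in> {1..n} \<Longrightarrow> \<kappa> t \<in> borel \<rightarrow>\<^sub>M prob_algebra borel" and t: "t + Suc j \<le> n"
  shows "window_law M Y t (Suc (Suc j)) = window_law M Y t (Suc j) \<bind> push j (\<kappa> (t + Suc j))"
proof -
  interpret M: prob_space M by fact
  define t' where "t' = t + Suc j"
  have t': "t' \<in> {1..n}" using t by (simp add: t'_def)
  let ?X = "pow_space (Suc j) :: (nat \<Rightarrow> 'b) measure" and ?Z = "past_algebra M Y t'"
  let ?W = "\<lambda>\<omega>. \<lambda>i\<in>{..<Suc j}. Y (t + i) \<omega>"
  have Y: "Y s \<in> M \<rightarrow>\<^sub>M borel" if "s \<le> n" for s
    using chain that by (simp add: markov_chain_def)
  have Yt': "Y t' \<in> M \<rightarrow>\<^sub>M borel" using Y t' by simp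
  have W: "?W \<in> M \<rightarrow>\<^sub>M ?X" by (rule window_measurable[OF Y]) (use t in auto)
  have \<kappa>t: "\<kappa> t' \<in> borel \<rightarrow>\<^sub>M prob_algebra borel" by (rule \<kappa>[OF t'])
  have past: "(\<lambda>\<omega>. \<lambda>s\<in>{..<t'}. Y s \<omega>) \<in> M \<rightarrow>\<^sub>M pow_space t'"
    using Y t' by (intro measurable_restrict) auto
  have sub: "subalgebra M ?Z"
    unfolding subalgebra_def past_algebra_def
    using measurable_sets[OF past] by (auto simp: sets_vimage_algebra2 measurable_space[OF past])
  interpret finite_measure_subalgebra M ?Z by standard (rule sub)
  have WZ: "?W \<in> ?Z \<rightarrow>\<^sub>M ?X"
  proof -
    have "(\<lambda>\<omega>. \<lambda>s\<in>{..<t'}. Y s \<omega>) \<in> ?Z \<rightarrow>\<^sub>M pow_space t'"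
      unfolding past_algebra_def
      using measurable_space[OF past] by (intro measurable_vimage_algebra1) auto
    moreover have "(\<lambda>x. \<lambda>i\<in>{..<Suc j}. x (t + i)) \<in> pow_space t' \<rightarrow>\<^sub>M ?X"
      by (intro measurable_restrict measurable_component_singleton) (auto simp: t'_def)
    ultimately have "(\<lambda>\<omega>. \<lambda>i\<in>{..<Suc j}. (\<lambda>s\<in>{..<t'}. Y s \<omega>) (t + i)) \<in> ?Z \<rightarrow>\<^sub>M ?X"
      by (rule measurable_compose)
    moreover have "(\<lambda>\<omega>. \<lambda>i\<in>{..<Suc j}. (\<lambda>s\<in>{..<t'}. Y s \<omega>) (t + i)) = ?W"
      by (intro ext) (auto simp: restrict_def t'_def)
    ultimately show ?thesis by simp
  qed
  let ?P = "?X \<Otimes>\<^sub>M (borel :: 'b measure)"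
  let ?\<kappa> = "\<lambda>x. distr (\<kappa> t' (x j)) ?P (\<lambda>y. (x, y))"
  let ?L1 = "distr M ?P (\<lambda>\<omega>. (?W \<omega>, Y t' \<omega>))" and ?L2 = "distr M ?X ?W \<bind> ?\<kappa>"
  have \<kappa>j: "(\<lambda>x. \<kappa> t' (x j)) \<in> ?X \<rightarrow>\<^sub>M prob_algebra borel"
    by (rule measurable_compose[OF measurable_last_pow_space \<kappa>t])
  have \<kappa>P: "?\<kappa> \<in> ?X \<rightarrow>\<^sub>M prob_algebra ?P"
    by (rule measurable_distr_prob_space2[OF \<kappa>j]) simp
  have XM: "space (distr M ?X ?W) \<noteq> {}"
    using measurable_space[OF W] M.not_empty by auto
  have dW: "distr M ?X ?W \<in> space (prob_algebra ?X)"
    using M.prob_space_distr[OF W] by (simp add: space_prob_algebra)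
  have pair: "(\<lambda>\<omega>. (?W \<omega>, Y t' \<omega>)) \<in> M \<rightarrow>\<^sub>M ?P" using W Yt' by (rule measurable_Pair)
  have "?L1 = ?L2"
  proof (rule measure_eqI_generator_eq[OF Int_stable_pair_measure_generator[of ?X borel]])
    show "{a \<times> b |a b. a \<in> sets ?X \<and> b \<in> sets (borel :: 'b measure)} \<subseteq> Pow (space ?X \<times> space borel)"
      using sets.sets_into_space[of _ ?X] by auto
    show "sets ?L1 = sigma_sets (space ?X \<times> space borel) {a \<times> b |a b. a \<in> sets ?X \<and> b \<in> sets (borel :: 'b measure)}"
      by (simp add: sets_pair_measure)
    show "sets ?L2 = sigma_sets (space ?X \<times> space borel) {a \<times> b |a b. a \<in> sets ?X \<and> b \<in> sets (borel :: 'b measure)}"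
      by (subst sets_bind'[OF dW \<kappa>P]) (simp add: sets_pair_measure)
    show "range (\<lambda>_ :: nat. space ?X \<times> space borel) \<subseteq> {a \<times> b |a b. a \<in> sets ?X \<and> b \<in> sets (borel :: 'b measure)}"
      using sets.top[of ?X] sets.top[of "borel :: 'b measure"] by blast
    have "prob_space ?L1" by (rule M.prob_space_distr[OF pair])
    then show "emeasure ?L1 (space ?X \<times> space borel) \<noteq> \<infinity>"
      by (simp add: finite_measure.emeasure_finite prob_space.finite_measure)
  next
    fix R assume "R \<in> {a \<times> b |a b. a \<in> sets ?X \<and> b \<in> sets (borel :: 'b measure)}"
    then obtain B A where R: "R = B \<times> A" and B: "B \<in> sets ?X" and A: "A \<in> sets (borel :: 'b measure)" by auto
    let ?C = "?W -` B \<inter> space M"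
    \<comment> \<open>The window ends at time \<open>t' - 1\<close>, so the event that it lies in
      \<open>B\<close> belongs to the past and the conditional expectation may be integrated over
      it.\<close>
    have C: "?C \<in> sets ?Z" using measurable_sets[OF WZ B] by (simp add: past_algebra_def)
    have CM: "?C \<in> sets M" by (rule measurable_sets[OF W B])
    have DM: "Y t' -` A \<inter> space M \<in> sets M" by (rule measurable_sets[OF Yt' A])
    have last: "Y (t' - 1) \<omega> = ?W \<omega> j" for \<omega> by (simp add: t'_def)
    have "emeasure ?L1 R = emeasure M (?C \<inter> (Y t' -` A \<inter> space M))"
      using A B by (subst emeasure_distr[OF pair]) (auto simp: R intro!: arg_cong[where f="emeasure M"])
    also have "\<dots> = ennreal (measure M (?C \<inter> (Y t' -` A \<inter> space M)))"
      by (rule M.emeasure_eq_measure)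
    also have "measure M (?C \<inter> (Y t' -` A \<inter> space M))
        = (\<integral>\<omega>\<in>?C. indicator (Y t' -` A \<inter> space M) \<omega> \<partial>M)"
    proof -
      have "(\<integral>\<omega>\<in>?C. indicator (Y t' -` A \<inter> space M) \<omega> \<partial>M) = (\<integral>\<omega>. indicator (?C \<inter> (Y t' -` A \<inter> space M)) \<omega> \<partial>M)"
        unfolding set_lebesgue_integral_def by (intro Bochner_Integration.integral_cong) (auto simp: indicator_def)
      also have "\<dots> = measure M (?C \<inter> (Y t' -` A \<inter> space M) \<inter> space M)" by simp
      also have "?C \<inter> (Y t' -` A \<inter> space M) \<inter> space M = ?C \<inter> (Y t' -` A \<inter> space M)" by auto
      finally show ?thesis by (rule sym)
    qed
    also have "\<dots> = (\<integral>\<omega>\<in>?C. real_cond_exp M ?Z (indicator (Y t' -` A \<inter> space M)) \<omega> \<partial>M)"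
      by (rule real_cond_exp_intA[OF _ C]) (use DM in \<open>simp add: M.emeasure_eq_measure\<close>)
    also have "\<dots> = (\<integral>\<omega>\<in>?C. measure (\<kappa> t' (?W \<omega> j)) A \<partial>M)"
    proof -
      have "AE \<omega> in M. real_cond_exp M ?Z (indicator (Y t' -` A \<inter> space M)) \<omega> = measure (\<kappa> t' (?W \<omega> j)) A"
      proof -
        have "\<forall>t\<in>{1..n}. \<forall>A\<in>sets borel. AE \<omega> in M.
            real_cond_exp M (past_algebra M Y t) (indicator (Y t -` A \<inter> space M)) \<omega> = measure (\<kappa> t (Y (t - 1) \<omega>)) A"
          using chain unfolding markov_chain_def by (elim conjE)
        from bspec[OF bspec[OF this t'] A] show ?thesis unfolding last .
      qed
      moreover have "(\<lambda>\<omega>. measure (\<kappa> t' (?W \<omega> j)) A) \<in> borel_measurable M"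
        by (rule measurable_compose[OF W measurable_compose[OF \<kappa>j measurable_measure_prob_algebra[OF A]]])
      ultimately show ?thesis
        unfolding set_lebesgue_integral_def using CM borel_measurable_cond_exp2
        by (intro integral_cong_AE borel_measurable_scaleR) auto
    qed
    also have "ennreal \<dots> = (\<integral>\<^sup>+\<omega>. indicator B (?W \<omega>) * emeasure (\<kappa> t' (?W \<omega> j)) A \<partial>M)"
    proof -
      have m: "(\<lambda>\<omega>. measure (\<kappa> t' (?W \<omega> j)) A) \<in> borel_measurable M"
        by (rule measurable_compose[OF W measurable_compose[OF \<kappa>j measurable_measure_prob_algebra[OF A]]])
      have p: "prob_space (\<kappa> t' z)" for z
        using measurable_space[OF \<kappa>t, of z] by (simp add: space_prob_algebra)
      have "ennreal (\<integral>\<omega>\<in>?C. measure (\<kappa> t' (?W \<omega> j)) A \<partial>M)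
          = (\<integral>\<^sup>+\<omega>. ennreal (indicator ?C \<omega> * measure (\<kappa> t' (?W \<omega> j)) A) \<partial>M)"
        unfolding set_lebesgue_integral_def real_scaleR_def
      proof (intro nn_integral_eq_integral[symmetric] M.integrable_const_bound[where B=1])
        show "(\<lambda>\<omega>. indicator ?C \<omega> * measure (\<kappa> t' (?W \<omega> j)) A) \<in> borel_measurable M"
          using CM m by (intro borel_measurable_times borel_measurable_indicator)
      qed (use p in \<open>auto simp: indicator_def prob_space.prob_le_1\<close>)
      also have "\<dots> = (\<integral>\<^sup>+\<omega>. indicator B (?W \<omega>) * emeasure (\<kappa> t' (?W \<omega> j)) A \<partial>M)"
        using p by (intro nn_integral_cong)
          (auto simp: indicator_def finite_measure.emeasure_eq_measure prob_space.finite_measure)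
      finally show ?thesis .
    qed
    also have "\<dots> = (\<integral>\<^sup>+x. indicator B x * emeasure (\<kappa> t' (x j)) A \<partial>distr M ?X ?W)"
      using B measurable_compose[OF measurable_prob_algebraD[OF \<kappa>j] measurable_emeasure_subprob_algebra[OF A]]
      by (intro nn_integral_distr[OF W, symmetric]) auto
    also have "\<dots> = (\<integral>\<^sup>+x. emeasure (?\<kappa> x) R \<partial>distr M ?X ?W)"
    proof (rule nn_integral_cong)
      fix x assume x: "x \<in> space (distr M ?X ?W)"
      have s: "sets (\<kappa> t' (x j)) = sets borel"
        using measurable_space[OF \<kappa>t, of "x j"] by (simp add: space_prob_algebra)
      have "(\<lambda>y. (x, y)) \<in> borel \<rightarrow>\<^sub>M ?P" using x by (intro measurable_Pair1') simp
      then have "(\<lambda>y. (x, y)) \<in> \<kappa> t' (x j) \<rightarrow>\<^sub>M ?P" using measurable_cong_sets[OF s refl] by blast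
      then have "emeasure (?\<kappa> x) R = emeasure (\<kappa> t' (x j)) ((\<lambda>y. (x, y)) -` R \<inter> space (\<kappa> t' (x j)))"
        using A B by (intro emeasure_distr) (auto simp: R)
      also have "(\<lambda>y. (x, y)) -` R \<inter> space (\<kappa> t' (x j)) = (if x \<in> B then A else {})"
        using sets_eq_imp_space_eq[OF s] by (auto simp: R)
      finally show "indicator B x * emeasure (\<kappa> t' (x j)) A = emeasure (?\<kappa> x) R" by simp
    qed
    also have "\<dots> = emeasure ?L2 R"
      by (rule emeasure_bind_prob_algebra[OF dW \<kappa>P, symmetric]) (use A B in \<open>simp add: R\<close>)
    finally show "emeasure ?L1 R = emeasure ?L2 R" .
  qed simp
  let ?Y = "pow_space (Suc (Suc j)) :: (nat \<Rightarrow> 'b) measure"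
  let ?upd = "\<lambda>(x, y). x(Suc j := y)"
  have "window_law M Y t (Suc (Suc j)) = distr ?L1 ?Y ?upd"
  proof -
    have "?upd \<circ> (\<lambda>\<omega>. (?W \<omega>, Y t' \<omega>)) = (\<lambda>\<omega>. \<lambda>i\<in>{..<Suc (Suc j)}. Y (t + i) \<omega>)"
      by (intro ext) (auto simp: restrict_def t'_def)
    then show ?thesis
      unfolding window_law_def by (subst distr_distr[OF measurable_upd_pow_space pair]) simp
  qed
  also have "\<dots> = distr M ?X ?W \<bind> (\<lambda>x. distr (?\<kappa> x) ?Y ?upd)"
    unfolding \<open>?L1 = ?L2\<close>
    by (rule distr_bind[OF _ XM measurable_upd_pow_space]) (use measurable_prob_algebraD[OF \<kappa>P] in simp)
  also have "\<dots> = distr M ?X ?W \<bind> push j (\<kappa> t')"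
  proof (rule bind_cong[OF refl])
    fix x assume "x \<in> space (distr M ?X ?W)"
    then have x: "x \<in> space ?X" by simp
    have s: "sets (\<kappa> t' (x j)) = sets borel"
      using measurable_space[OF \<kappa>t, of "x j"] by (simp add: space_prob_algebra)
    have "(\<lambda>y. (x, y)) \<in> borel \<rightarrow>\<^sub>M ?P" using x by (intro measurable_Pair1')
    then have "(\<lambda>y. (x, y)) \<in> \<kappa> t' (x j) \<rightarrow>\<^sub>M ?P" using measurable_cong_sets[OF s refl] by blast
    then show "distr (?\<kappa> x) ?Y ?upd = push j (\<kappa> t') x"
      unfolding push_def by (subst distr_distr[OF measurable_upd_pow_space]) (simp_all add: comp_def)
  qed
  finally show ?thesis by (simp add: window_law_def t'_def)
qed

lemma window_law_space:
  assumes M: "prob_space M" and chain: "markov_chain M n Y \<mu> \<kappa>" and t: "t + j \<le> n + 1"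
  shows "sets (window_law M Y t j) = sets (pow_space j)" "prob_space (window_law M Y t j)"
proof -
  have "(\<lambda>\<omega>. \<lambda>i\<in>{..<j}. Y (t + i) \<omega>) \<in> M \<rightarrow>\<^sub>M pow_space j"
    by (rule window_measurable[OF _ t]) (use chain in \<open>simp add: markov_chain_def\<close>)
  then show "sets (window_law M Y t j) = sets (pow_space j)" "prob_space (window_law M Y t j)"
    unfolding window_law_def by (simp_all add: prob_space.prob_space_distr[OF M])
qed

lemma path_law_space:
  assumes \<mu>: "\<mu> \<in> space (prob_algebra borel)" and \<kappa>: "\<kappa> \<in> borel \<rightarrow>\<^sub>M prob_algebra borel"
  shows "path_law \<mu> \<kappa> (Suc j) \<in> space (prob_algebra (pow_space (Suc j)))"
proof (induction j)
  case 0
  have "(\<lambda>x. \<lambda>i\<in>{..<Suc 0}. x) \<in> \<mu> \<rightarrow>\<^sub>M pow_space (Suc 0)"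
    using \<mu> by (intro measurable_restrict) (auto simp: space_prob_algebra cong: measurable_cong_sets)
  then show ?case using \<mu> by (simp add: space_prob_algebra prob_space.prob_space_distr)
next
  case (Suc j)
  then show ?case
    unfolding path_law_push
    using prob_space_bind'[OF Suc push_measurable[OF \<kappa>]] sets_bind'[OF Suc push_measurable[OF \<kappa>]]
    by (simp add: space_prob_algebra)
qed

text \<open>Moves smoothness from laws on the state space to laws of paths with one coordinate,
  which are functions on a singleton index set.\<close>

lemma dual_Ck_image:
  assumes T: "dual_Ck k M WM T" and f: "f \<in> M \<rightarrow>\<^sub>M N"
    and W: "\<And>s x. x \<in> space M \<Longrightarrow> WN s (f x) = WM s x"
  shows "dual_Ck k N WN (\<lambda>l u g. T l u (\<lambda>x. g (f x)))"
proof -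
  have ball: "(\<lambda>x. g (f x)) \<in> weighted_ball M (WM s)" if "g \<in> weighted_ball N (WN s)" for g s
    using that measurable_compose[OF f, of g] measurable_space[OF f] W by (fastforce simp: weighted_ball_def)
  have fn: "(\<lambda>x. g (f x)) \<in> weighted_fun M (WM s)" if "g \<in> weighted_fun N (WN s)" for g s
    using that measurable_compose[OF f, of g] measurable_space[OF f] W by (fastforce simp: weighted_fun_def)
  have wf: "weighted_functional N (WN s) (\<lambda>g. S (\<lambda>x. g (f x)))"
    if S: "weighted_functional M (WM s) S" for s S
    unfolding weighted_functional_def
  proof (intro conjI ballI allI impI)
    fix g h and a :: real assume "g \<in> weighted_fun N (WN s)" "h \<in> weighted_fun N (WN s)"
    then show "S (\<lambda>x. a * g (f x) + h (f x)) = a * S (\<lambda>x. g (f x)) + S (\<lambda>x. h (f x))"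
      by (intro functional_linear[OF S] fn)
  next
    fix G :: "nat \<Rightarrow> _" and g
    assume "\<forall>n. G n \<in> weighted_ball N (WN s)" "g \<in> borel_measurable N" "\<forall>x\<in>space N. (\<lambda>n. G n x) \<longlonglongrightarrow> g x"
    then show "(\<lambda>n. S (\<lambda>x. G n (f x))) \<longlonglongrightarrow> S (\<lambda>x. g (f x))"
      using measurable_compose[OF f, of g] measurable_space[OF f] by (intro functional_tendsto[OF S] ball) auto
  qed
  have bound: "dual_bound N (WN s) (\<lambda>g. S (\<lambda>x. g (f x))) e" if "dual_bound M (WM s) S e" for s S e
    using that ball by (auto simp: dual_bound_def)
  have vanish: "dual_vanish F N (WN s) (\<lambda>v g. S v (\<lambda>x. g (f x)))" if "dual_vanish F M (WM s) S" for s S and F :: "real filter"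
    using that unfolding dual_vanish_def by (blast intro: eventually_mono bound)
  show ?thesis
    unfolding dual_Ck_def
  proof (intro conjI allI impI ballI)
    fix l and u :: real assume l: "l \<le> k" and u: "u \<in> {0..1}"
    have "weighted_functional M (WM (k - l)) (T l u)"
      "dual_vanish (at u within {0..1}) M (WM (k - l)) (\<lambda>v g. T l v g - T l u g)"
      using T l u by (simp_all add: dual_Ck_def)
    from wf[OF this(1)] vanish[OF this(2)]
    show "weighted_functional N (WN (k - l)) (\<lambda>g. T l u (\<lambda>x. g (f x)))"
      "dual_vanish (at u within {0..1}) N (WN (k - l)) (\<lambda>v g. T l v (\<lambda>x. g (f x)) - T l u (\<lambda>x. g (f x)))"
      by auto
  next
    fix l and u :: real assume l: "l < k" and u: "u \<in> {0..1}"
    have "dual_vanish (at u within {0..1}) M (WM (k - Suc l)) (\<lambda>v g. (T l v g - T l u g) / (v - u) - T (Suc l) u g)"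
      using T l u by (simp add: dual_Ck_def)
    from vanish[OF this]
    show "dual_vanish (at u within {0..1}) N (WN (k - Suc l))
       (\<lambda>v g. (T l v (\<lambda>x. g (f x)) - T l u (\<lambda>x. g (f x))) / (v - u) - T (Suc l) u (\<lambda>x. g (f x)))" .
  qed
qed

section \<open>Smoothness of the stationary path laws\<close>

context ergodic_kernel begin

text \<open>Index \<open>j\<close> refers to paths with \<open>Suc j\<close> coordinates, so that
  \<open>x j\<close> is the last one; \<open>path_op\<close>, \<open>stationary_law\<close> and
  \<open>deriv_path\<close> share this shift.\<close>

definition path_weight :: "nat \<Rightarrow> nat \<Rightarrow> (nat \<Rightarrow> 'a) \<Rightarrow> real" where
  "path_weight j s = sum_weight (weight s) (Suc j)"

definition path_op :: "nat \<Rightarrow> nat \<Rightarrow> real \<Rightarrow> ((nat \<Rightarrow> 'a) \<Rightarrow> real) \<Rightarrow> (nat \<Rightarrow> 'a) \<Rightarrow> real" where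
  "path_op j = kernel_op (\<lambda>x. x j) (\<lambda>x y. x(Suc j := y))"

text \<open>The general constant \<open>C0 * (cX + 1)\<close> with the value
  \<open>cX = j + 2\<close> found in \<open>path_operators\<close>.\<close>

definition path_const :: "nat \<Rightarrow> real" where
  "path_const j = C0 * ((real j + 2) + 1)"

lemma path_weight_ge: "i \<le> j \<Longrightarrow> weight s (x i) \<le> path_weight j s x"
  unfolding path_weight_def sum_weight_def
  by (rule member_le_sum) (auto simp: weight_nonneg)

lemma path_weight_ge_1: "1 \<le> path_weight j s x"
  using path_weight_ge[of 0 j s x] weight_ge_1[of s "x 0"] by simp

lemma path_weight_nonneg: "0 \<le> path_weight j s x"
  using path_weight_ge_1[of j s x] by simp

lemma path_weight_mono: "s \<le> t \<Longrightarrow> path_weight j s x \<le> path_weight j t x"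
  unfolding path_weight_def sum_weight_def by (intro sum_mono weight_mono)

lemma path_weight_measurable: "path_weight j s \<in> borel_measurable (pow_space (Suc j))"
  unfolding path_weight_def sum_weight_def
  by (intro borel_measurable_sum measurable_compose[OF _ weight_measurable] measurable_component_singleton) auto

lemma path_weight_upd: "path_weight (Suc j) s (x(Suc j := y)) = path_weight j s x + weight s y"
proof -
  have "(\<Sum>i<Suc j. weight s ((x(Suc j := y)) i)) = (\<Sum>i<Suc j. weight s (x i))"
    by (intro sum.cong) auto
  then show ?thesis unfolding path_weight_def sum_weight_def by (subst sum.lessThan_Suc) simp
qed

text \<open>Replacing the smaller of \<open>\<phi> a\<close> and \<open>\<phi> z\<close> by the
  larger makes the exponents add up to one weight of level \<open>s + l\<close>.\<close>

lemma weight_mult_le: "weight s a * \<phi> z powr (q * real l) \<le> weight (s + l) a + weight (s + l) z"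
proof -
  have q0: "0 \<le> q * real l" using q by simp
  have eq: "weight (s + l) x = weight s x * \<phi> x powr (q * real l)" for x
    by (simp add: weight_def deg_add powr_add)
  have pos: "0 \<le> \<phi> x" for x using \<phi>_ge_1[of x] by simp
  show ?thesis
  proof (cases "\<phi> a \<le> \<phi> z")
    case True
    have "weight s a \<le> weight s z"
      unfolding weight_def using True pos deg_nonneg by (intro powr_mono2) auto
    then have "weight s a * \<phi> z powr (q * real l) \<le> weight (s + l) z" unfolding eq by (intro mult_right_mono) auto
    then show ?thesis using weight_nonneg[of "s + l" a] by simp
  next
    case False
    then have "\<phi> z powr (q * real l) \<le> \<phi> a powr (q * real l)" using pos q0 by (intro powr_mono2) auto
    then have "weight s a * \<phi> z powr (q * real l) \<le> weight (s + l) a"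
      unfolding eq by (intro mult_left_mono) (auto simp: weight_nonneg)
    then show ?thesis using weight_nonneg[of "s + l" z] by simp
  qed
qed

text \<open>Each of the \<open>Suc j\<close> coordinates absorbs the factor of the derivative into
  its own next weight plus that of the last coordinate. The total is one path weight plus
  \<open>Suc j\<close> times another, hence \<open>j + 2\<close>.\<close>

lemma path_operators:
  "smooth_operators k (pow_space (Suc j)) (path_weight j) (pow_space (Suc (Suc j))) (path_weight (Suc j))
     (path_op j) (path_const j)"
  unfolding path_op_def path_const_def
proof (rule smooth_operators_kernel_op[OF measurable_last_pow_space measurable_upd_pow_space])
  fix s l and x :: "nat \<Rightarrow> 'a"
  show "path_weight (Suc j) s (x(Suc j := y)) \<le> path_weight j s x + \<phi> y powr deg s" for y
    by (simp add: path_weight_upd weight_def)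
  show "\<phi> (x j) powr deg s \<le> path_weight j s x"
    using path_weight_ge[of j j s x] by (simp add: weight_def)
  have "path_weight j s x * \<phi> (x j) powr (q * real l)
      = (\<Sum>i<Suc j. weight s (x i) * \<phi> (x j) powr (q * real l))"
    by (simp only: path_weight_def sum_weight_def sum_distrib_right)
  also have "\<dots> \<le> (\<Sum>i<Suc j. weight (s + l) (x i) + weight (s + l) (x j))"
    by (intro sum_mono weight_mult_le)
  also have "\<dots> = path_weight j (s + l) x + real (Suc j) * weight (s + l) (x j)"
    by (simp add: path_weight_def sum_weight_def sum.distrib algebra_simps del: sum.lessThan_Suc)
  also have "\<dots> \<le> path_weight j (s + l) x + real (Suc j) * path_weight j (s + l) x"
    by (intro add_left_mono mult_left_mono path_weight_ge) auto
  also have "\<dots> = (real j + 2) * path_weight j (s + l) x" by (simp add: algebra_simps)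
  finally show "path_weight j s x * \<phi> (x j) powr (q * real l) \<le> (real j + 2) * path_weight j (s + l) x" .
qed (auto simp: path_weight_ge_1 intro: add_nonneg_pos)

text \<open>\<open>N\<close> is arbitrary so that the lemma serves the stationary laws as well as
  the windows of the array.\<close>

lemma push_integral:
  assumes u: "u \<in> {0..1}" and N: "sets N = sets (pow_space (Suc j))" "prob_space N"
    and s: "s \<le> k" and int: "integrable N (path_weight j s)"
  shows "integrable (N \<bind> push j (Q u)) (path_weight (Suc j) s)"
    and "(\<integral>x. path_weight (Suc j) s x \<partial>(N \<bind> push j (Q u))) \<le> (1 + C0) * (\<integral>x. path_weight j s x \<partial>N)"
    and "g \<in> weighted_fun (pow_space (Suc (Suc j))) (path_weight (Suc j) s) \<Longrightarrow>
      (\<integral>x. g x \<partial>(N \<bind> push j (Q u))) = (\<integral>x. path_op j 0 u g x \<partial>N)"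
proof -
  let ?Y = "pow_space (Suc (Suc j)) :: (nat \<Rightarrow> 'a) measure" and ?W = "path_weight (Suc j) s"
  have sp: "space N = space (pow_space (Suc j))" by (rule sets_eq_imp_space_eq[OF N(1)])
  have pm: "push j (Q u) \<in> N \<rightarrow>\<^sub>M subprob_algebra ?Y"
    using measurable_prob_algebraD[OF push_measurable[OF Q_markov[OF u]]] measurable_cong_sets[OF N(1) refl] by blast
  have ne: "space N \<noteq> {}" using prob_space.not_empty[OF N(2)] .
  have sets_bind: "sets (N \<bind> push j (Q u)) = sets ?Y" using sets_kernel[OF pm] ne by (intro sets_bind)
  have upd: "(\<lambda>y. x(Suc j := y)) \<in> Q u z \<rightarrow>\<^sub>M ?Y" if "x \<in> space N" for x z
    using measurable_upd_pow_space1[of x j] that Q_space[OF u, of z] measurable_cong_sets[of "Q u z" borel ?Y ?Y]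
    by (auto simp: sp)
  have nn_push: "(\<integral>\<^sup>+y. ennreal (?W y) \<partial>push j (Q u) x) \<le> ennreal ((1 + C0) * path_weight j s x)"
    if x: "x \<in> space N" for x
  proof -
    interpret Q: prob_space "Q u (x j)" using Q_space[OF u] by blast
    have "(\<integral>\<^sup>+y. ennreal (?W y) \<partial>push j (Q u) x) = (\<integral>\<^sup>+y. ennreal (?W (x(Suc j := y))) \<partial>Q u (x j))"
      unfolding push_def using path_weight_measurable[of "Suc j" s] by (intro nn_integral_distr[OF upd[OF x]]) simp
    also have "\<dots> = (\<integral>\<^sup>+y. ennreal (path_weight j s x) + ennreal (weight s y) \<partial>Q u (x j))"
      by (intro nn_integral_cong) (simp add: path_weight_upd path_weight_nonneg weight_nonneg)
    also have "\<dots> = ennreal (path_weight j s x) + (\<integral>\<^sup>+y. ennreal (weight s y) \<partial>Q u (x j))"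
      using borel_measurable_integrable[OF Q_integrable[OF u s, of "x j"]]
      by (subst nn_integral_add) (auto simp: Q.emeasure_space_1)
    also have "\<dots> \<le> ennreal (path_weight j s x) + ennreal (C0 * path_weight j s x)"
      using Q_nn_weight[OF u s, of "x j"] path_weight_ge[of j j s x] C0
      by (intro add_left_mono) (auto intro!: ennreal_leI mult_left_mono intro: order_trans)
    also have "\<dots> = ennreal ((1 + C0) * path_weight j s x)"
      using C0 path_weight_nonneg[of j s x] by (simp add: algebra_simps)
    finally show ?thesis .
  qed
  have nn: "(\<integral>\<^sup>+x. ennreal (?W x) \<partial>(N \<bind> push j (Q u))) \<le> ennreal ((1 + C0) * (\<integral>x. path_weight j s x \<partial>N))"
  proof -
    have "(\<integral>\<^sup>+x. ennreal (?W x) \<partial>(N \<bind> push j (Q u))) = (\<integral>\<^sup>+x. \<integral>\<^sup>+y. ennreal (?W y) \<partial>push j (Q u) x \<partial>N)"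
      by (rule nn_integral_bind[OF _ pm]) (use path_weight_measurable[of "Suc j" s] in simp)
    also have "\<dots> \<le> (\<integral>\<^sup>+x. ennreal ((1 + C0) * path_weight j s x) \<partial>N)"
      by (intro nn_integral_mono nn_push)
    also have "\<dots> = ennreal (\<integral>x. (1 + C0) * path_weight j s x \<partial>N)"
      using int C0 by (intro nn_integral_eq_integral) (auto simp: path_weight_nonneg)
    finally show ?thesis by simp
  qed
  have Wm: "?W \<in> borel_measurable (N \<bind> push j (Q u))"
    using path_weight_measurable[of "Suc j" s] measurable_cong_sets[OF sets_bind refl] by blast
  show bint: "integrable (N \<bind> push j (Q u)) ?W"
    by (rule integrableI_nonneg[OF Wm]) (use nn in \<open>auto simp: path_weight_nonneg less_top[symmetric] top_unique\<close>)
  show "(\<integral>x. ?W x \<partial>(N \<bind> push j (Q u))) \<le> (1 + C0) * (\<integral>x. path_weight j s x \<partial>N)"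
  proof -
    have "0 \<le> (\<integral>x. path_weight j s x \<partial>N)"
      by (intro Bochner_Integration.integral_nonneg) (rule path_weight_nonneg)
    then have "0 \<le> (1 + C0) * (\<integral>x. path_weight j s x \<partial>N)" using C0 by simp
    then show ?thesis
      using nn by (subst (asm) nn_integral_eq_integral[OF bint]) (simp_all add: path_weight_nonneg ennreal_le_iff)
  qed
  have pint: "integrable (push j (Q u) x) ?W" if x: "x \<in> space N" for x
  proof (rule integrableI_nonneg)
    show "?W \<in> borel_measurable (push j (Q u) x)"
      using path_weight_measurable[of "Suc j" s] by (simp add: push_def)
  qed (use nn_push[OF x] in \<open>auto simp: path_weight_nonneg less_top[symmetric] top_unique\<close>)
  assume g: "g \<in> weighted_fun ?Y ?W"
  have gm: "g \<in> borel_measurable ?Y" by (rule weighted_fun_measurable[OF g])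
  have "(\<integral>x. g x \<partial>(N \<bind> push j (Q u))) = (\<integral>x. \<integral>y. g y \<partial>push j (Q u) x \<partial>N)"
    by (rule integral_bind_weighted(1)[OF pm ne bint pint g])
  also have "\<dots> = (\<integral>x. path_op j 0 u g x \<partial>N)"
  proof (rule Bochner_Integration.integral_cong[OF refl])
    fix x assume x: "x \<in> space N"
    have "(\<integral>y. g y \<partial>push j (Q u) x) = (\<integral>y. g (x(Suc j := y)) \<partial>Q u (x j))"
      unfolding push_def by (rule integral_distr[OF upd[OF x] gm])
    also have "\<dots> = path_op j 0 u g x"
      unfolding path_op_def
    proof (rule kernel_op_0[OF u, symmetric])
      show "(\<lambda>y. g (x(Suc j := y))) \<in> borel_measurable borel"
        by (rule measurable_compose[OF measurable_upd_pow_space1 gm]) (use x sp in blast)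
    qed
    finally show "(\<integral>y. g y \<partial>push j (Q u) x) = path_op j 0 u g x" .
  qed
  finally show "(\<integral>x. g x \<partial>(N \<bind> push j (Q u))) = (\<integral>x. path_op j 0 u g x \<partial>N)" .
qed

abbreviation stationary_law :: "real \<Rightarrow> nat \<Rightarrow> (nat \<Rightarrow> 'a) measure" where
  "stationary_law u j \<equiv> path_law (\<pi> u) (Q u) (Suc j)"

lemma singleton_measurable: "(\<lambda>x. \<lambda>i\<in>{..<Suc 0}. x) \<in> borel \<rightarrow>\<^sub>M pow_space (Suc 0)"
  by (intro measurable_restrict) simp

lemma singleton_measurable_\<pi>: "u \<in> {0..1} \<Longrightarrow> (\<lambda>x. \<lambda>i\<in>{..<Suc 0}. x) \<in> \<pi> u \<rightarrow>\<^sub>M pow_space (Suc 0)"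
  using singleton_measurable \<pi>_space[of u] measurable_cong_sets[of "\<pi> u" borel "pow_space (Suc 0)" "pow_space (Suc 0)"]
  by blast

lemma path_weight_singleton: "path_weight 0 s (\<lambda>i\<in>{..<Suc 0}. x) = weight s x"
  by (simp add: path_weight_def sum_weight_def)

lemma stationary_law_space:
  assumes "u \<in> {0..1}"
  shows "sets (stationary_law u j) = sets (pow_space (Suc j))" "prob_space (stationary_law u j)"
  using path_law_space[OF _ Q_markov[OF assms], of "\<pi> u" j] \<pi>_space[OF assms]
  by (simp_all add: space_prob_algebra)

lemma stationary_law_integrable:
  assumes u: "u \<in> {0..1}" and s: "s \<le> k"
  shows "integrable (stationary_law u j) (path_weight j s) \<and>
    (\<integral>x. path_weight j s x \<partial>stationary_law u j) \<le> (1 + C0) ^ j * (b / (1 - lam))"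
proof (induction j)
  case 0
  note sm = singleton_measurable_\<pi>[OF u] path_weight_measurable[of 0 s]
  show ?case
    using \<pi>_integrable[OF u s] \<pi>_weight_le[OF u s]
    by (simp add: integrable_distr_eq[OF sm] integral_distr[OF sm] path_weight_singleton del: restrict_apply)
next
  case (Suc j)
  note p = push_integral[OF u stationary_law_space[OF u, of j] s, folded path_law_push]
  have "(\<integral>x. path_weight (Suc j) s x \<partial>stationary_law u (Suc j)) \<le> (1 + C0) * (\<integral>x. path_weight j s x \<partial>stationary_law u j)"
    using p(2) Suc by blast
  also have "\<dots> \<le> (1 + C0) * ((1 + C0) ^ j * (b / (1 - lam)))"
    using Suc C0 by (intro mult_left_mono) auto
  finally show ?case using p(1) Suc by (simp add: mult.assoc)
qed

lemma stationary_law_functional: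
  "u \<in> {0..1} \<Longrightarrow> s \<le> k \<Longrightarrow> weighted_functional (pow_space (Suc j)) (path_weight j s) (\<lambda>g. \<integral>x. g x \<partial>stationary_law u j)"
  using stationary_law_space stationary_law_integrable by (intro integral_functional) auto

lemma stationary_law_step:
  assumes "u \<in> {0..1}" "s \<le> k" "g \<in> weighted_fun (pow_space (Suc (Suc j))) (path_weight (Suc j) s)"
  shows "(\<integral>x. g x \<partial>stationary_law u (Suc j)) = (\<integral>x. path_op j 0 u g x \<partial>stationary_law u j)"
  unfolding path_law_push
  by (rule push_integral(3)[OF assms(1) stationary_law_space[OF assms(1)] assms(2) _ assms(3)])
    (use stationary_law_integrable[OF assms(1,2)] in blast)

primrec deriv_path :: "nat \<Rightarrow> nat \<Rightarrow> real \<Rightarrow> ((nat \<Rightarrow> 'a) \<Rightarrow> real) \<Rightarrow> real" where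
  "deriv_path 0 = (\<lambda>l u g. deriv_\<pi> l u (\<lambda>x. g (\<lambda>i\<in>{..<Suc 0}. x)))"
| "deriv_path (Suc j) = leibniz (deriv_path j) (path_op j)"

lemma dual_Ck_path: "dual_Ck k (pow_space (Suc j)) (path_weight j) (deriv_path j)"
proof (induction j)
  case 0
  show ?case
    unfolding deriv_path.simps
    by (rule dual_Ck_image[where WN="path_weight 0", OF dual_Ck_\<pi> singleton_measurable])
      (rule path_weight_singleton)
next
  case (Suc j)
  show ?case
    unfolding deriv_path.simps
    by (rule smooth_operators.dual_Ck_comp[OF path_operators Suc]) (rule path_weight_mono, simp)
qed

lemma deriv_path_0:
  assumes u: "u \<in> {0..1}" and s: "s \<le> k"
  shows "g \<in> weighted_fun (pow_space (Suc j)) (path_weight j s) \<Longrightarrow>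
    deriv_path j 0 u g = (\<integral>x. g x \<partial>stationary_law u j)"
proof (induction j arbitrary: g)
  case 0
  then show ?case
    using integral_distr[OF singleton_measurable_\<pi>[OF u] weighted_fun_measurable[OF 0]]
    by (simp only: deriv_path.simps deriv_\<pi>.simps path_law.simps)
next
  case (Suc j)
  have "path_op j 0 u g \<in> weighted_fun (pow_space (Suc j)) (path_weight j s)"
    using smooth_operators.K_weighted_fun[OF path_operators, of s 0 u g j] s u Suc.prems by simp
  from Suc.IH[OF this] show ?case
    using stationary_law_step[OF u s Suc.prems] by (simp add: leibniz_def del: path_law.simps)
qed

lemma indicator_path_weighted:
  "A \<in> sets (pow_space (Suc j)) \<Longrightarrow> indicator A \<in> weighted_fun (pow_space (Suc j)) (path_weight j s)"
  by (intro weighted_ball_fun indicator_weighted_ball path_weight_ge_1)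

theorem stationary_law_C_k:
  "weighted_C_k (pow_space (Suc j)) (path_weight j 0) k (\<lambda>u. measure (stationary_law u j))"
proof -
  let ?M = "pow_space (Suc j) :: (nat \<Rightarrow> 'a) measure" and ?W = "path_weight j 0" and ?T = "deriv_path j"
  \<comment> \<open>By convention a signed measure is a set function that is 0 off the
    \<sigma>-algebra.\<close>
  define D where "D l u A = (if A \<in> sets ?M then ?T l u (indicator A) else 0)" for l u A
  have le: "path_weight j 0 x \<le> path_weight j s x" for s x by (rule path_weight_mono) simp
  \<comment> \<open>Order \<open>l\<close> was obtained at the larger weight of level
    \<open>k - l\<close>; all orders are now restricted to level 0, the weight of the
    theorem.\<close>
  have wf: "weighted_functional ?M ?W (?T l u)" if "l \<le> k" "u \<in> {0..1}" for l u
    by (rule functional_mono[where a=1 and W="path_weight j (k - l)"])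
      (use dual_Ck_path[of j] that le path_weight_nonneg in \<open>auto simp: dual_Ck_def\<close>)
  show ?thesis
    unfolding weighted_C_k_def
  proof (intro exI[of _ D] conjI ballI allI impI)
    fix u :: real assume u: "u \<in> {0..1}"
    show "D 0 u = measure (stationary_law u j)"
    proof
      fix A
      show "D 0 u A = measure (stationary_law u j) A"
      proof (cases "A \<in> sets ?M")
        case True
        then have "A \<inter> space (stationary_law u j) = A"
          using sets.sets_into_space[of A ?M] sets_eq_imp_space_eq[OF stationary_law_space(1)[OF u, of j]] by auto
        then show ?thesis
          using True deriv_path_0[OF u le0 indicator_path_weighted[OF True]] by (simp add: D_def del: path_law.simps)
      next
        case False
        then show ?thesis
          using stationary_law_space(1)[OF u, of j] by (simp add: D_def measure_notin_sets del: path_law.simps)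
      qed
    qed
    show "D l u \<in> weighted_measures ?M ?W" if "l \<le> k" for l
      by (rule weighted_measures_functional[OF wf[OF that u] path_weight_ge_1 path_weight_measurable])
        (auto simp: D_def)
    show "((\<lambda>v. weighted_norm ?M ?W (\<lambda>A. (D l v A - D l u A) / (v - u) - D (Suc l) u A)) \<longlongrightarrow> 0) (at u within {0..1})"
      if l: "l < k" for l
    proof (rule weighted_norm_tendsto_zero[OF _ _ path_weight_ge_1 path_weight_measurable])
      show "dual_vanish (at u within {0..1}) ?M ?W (\<lambda>v g. (?T l v g - ?T l u g) / (v - u) - ?T (Suc l) u g)"
        by (rule dual_vanish_mono[where W="path_weight j (k - Suc l)"])
          (use dual_Ck_path[of j] l u le in \<open>auto simp: dual_Ck_def\<close>)
      show "\<forall>\<^sub>F v in at u within {0..1}. weighted_functional ?M ?W (\<lambda>g. (?T l v g - ?T l u g) / (v - u) - ?T (Suc l) u g)"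
        using eventually_at_within_self
      proof eventually_elim
        case (elim v)
        then have v: "v \<in> {0..1}" by simp
        show ?case
          using functional_minus[OF functional_times[OF functional_minus[OF wf[OF _ v, of l] wf[OF _ u, of l]], of "1/(v-u)"]
              wf[OF _ u, of "Suc l"]] l by simp
      qed
    qed (auto simp: D_def)
    show "((\<lambda>v. weighted_norm ?M ?W (\<lambda>A. D k v A - D k u A)) \<longlongrightarrow> 0) (at u within {0..1})"
    proof (rule weighted_norm_tendsto_zero[OF _ _ path_weight_ge_1 path_weight_measurable])
      show "dual_vanish (at u within {0..1}) ?M ?W (\<lambda>v g. ?T k v g - ?T k u g)"
        by (rule dual_vanish_mono[where W="path_weight j (k - k)"])
          (use dual_Ck_path[of j] u le in \<open>auto simp: dual_Ck_def\<close>)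
      show "\<forall>\<^sub>F v in at u within {0..1}. weighted_functional ?M ?W (\<lambda>g. ?T k v g - ?T k u g)"
        using eventually_at_within_self by eventually_elim (auto intro!: functional_minus wf u)
    qed (auto simp: D_def)
  qed
qed

end

section \<open>Local stationarity\<close>

locale ergodic_array = ergodic_kernel \<gamma> Q D \<phi> k d1 q C0 \<pi> m d0 \<epsilon> lam b \<eta> \<nu>
  for \<gamma> :: "'a::topological_space \<Rightarrow> 'a measure"
    and Q :: "real \<Rightarrow> 'a \<Rightarrow> 'a measure"
    and D :: "nat \<Rightarrow> real \<Rightarrow> 'a \<Rightarrow> 'a \<Rightarrow> real"
    and \<phi> :: "'a \<Rightarrow> real" and k :: nat and d1 q C0 :: real
    and \<pi> :: "real \<Rightarrow> 'a measure" and m :: nat and d0 \<epsilon> lam b :: real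
    and \<eta> :: "real \<Rightarrow> real" and \<nu> :: "real \<Rightarrow> 'a measure" +
  fixes M :: "'w measure" and X :: "nat \<Rightarrow> nat \<Rightarrow> 'w \<Rightarrow> 'a"
  assumes M_prob: "prob_space M"
    and chain: "\<And>n. n \<ge> 1 \<Longrightarrow> markov_chain M n (X n) (\<pi> 0) (\<lambda>t. Q (real t / real n))"
begin

abbreviation "array_law n t j \<equiv> window_law M (X n) t (Suc j)"

definition "marginal n t = distr M borel (X n t)"

lemma time_in_unit: "n \<ge> 1 \<Longrightarrow> t \<le> n \<Longrightarrow> real t / real n \<in> {0..1}"
  by simp

lemma grid_in_unit:
  assumes "n \<ge> 1" "t + r \<le> n"
  shows "set (map (\<lambda>i. real i / real n) [Suc t..<Suc (t + r)]) \<subseteq> {0..1}"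
proof
  fix x assume "x \<in> set (map (\<lambda>i. real i / real n) [Suc t..<Suc (t + r)])"
  then obtain i where "x = real i / real n" "i \<in> {Suc t..<Suc (t + r)}"
    by (simp only: set_map set_upt) blast
  then show "x \<in> {0..1}" using time_in_unit[OF assms(1), of i] assms(2) by simp
qed

lemma X_measurable: "n \<ge> 1 \<Longrightarrow> t \<le> n \<Longrightarrow> X n t \<in> M \<rightarrow>\<^sub>M borel"
  using chain[of n] by (simp add: markov_chain_def)

lemma array_law_space:
  assumes "n \<ge> 1" "t + j \<le> n"
  shows "sets (array_law n t j) = sets (pow_space (Suc j))" "prob_space (array_law n t j)"
  using window_law_space[OF M_prob chain[OF assms(1)], of t "Suc j"] assms by auto

lemma array_law_push:
  assumes "n \<ge> 1" "t + Suc j \<le> n"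
  shows "array_law n t (Suc j) = array_law n t j \<bind> push j (Q (real (t + Suc j) / real n))"
  by (rule window_law_push[OF M_prob chain[OF assms(1)] _ assms(2)])
    (use assms in \<open>auto intro!: Q_markov\<close>)

lemma array_law_integral:
  fixes g :: "(nat \<Rightarrow> 'a) \<Rightarrow> real"
  assumes "n \<ge> 1" "t + j \<le> n" "g \<in> borel_measurable (pow_space (Suc j))"
  shows "(\<integral>x. g x \<partial>array_law n t j) = (\<integral>\<omega>. g (\<lambda>i\<in>{..<Suc j}. X n (t + i) \<omega>) \<partial>M)"
    and "integrable (array_law n t j) g \<longleftrightarrow> integrable M (\<lambda>\<omega>. g (\<lambda>i\<in>{..<Suc j}. X n (t + i) \<omega>))"
proof -
  have w: "(\<lambda>\<omega>. \<lambda>i\<in>{..<Suc j}. X n (t + i) \<omega>) \<in> M \<rightarrow>\<^sub>M pow_space (Suc j)"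
    by (rule window_measurable[OF X_measurable[OF assms(1)]]) (use assms in auto)
  show "(\<integral>x. g x \<partial>array_law n t j) = (\<integral>\<omega>. g (\<lambda>i\<in>{..<Suc j}. X n (t + i) \<omega>) \<partial>M)"
    unfolding window_law_def by (rule integral_distr[OF w assms(3)])
  show "integrable (array_law n t j) g \<longleftrightarrow> integrable M (\<lambda>\<omega>. g (\<lambda>i\<in>{..<Suc j}. X n (t + i) \<omega>))"
    unfolding window_law_def by (rule integrable_distr_eq[OF w assms(3)])
qed

lemma path_weight_0: "path_weight 0 s x = weight s (x 0)"
  by (simp add: path_weight_def sum_weight_def)

lemma path_weight_1: "path_weight (Suc 0) s x = weight s (x 0) + weight s (x (Suc 0))"
  by (simp add: path_weight_def sum_weight_def)

text \<open>Qualitative only: the moment is propagated step by step through windows of length two.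
  Uniform control in \<open>n\<close> and \<open>t\<close> is achieved in
  \<open>gap_bound\<close>.\<close>

lemma X_integrable:
  assumes n: "n \<ge> 1" and s: "s \<le> k"
  shows "t \<le> n \<Longrightarrow> integrable M (\<lambda>\<omega>. weight s (X n t \<omega>))"
proof (induction t)
  case 0
  have "distr M borel (X n 0) = \<pi> 0" using chain[OF n] by (simp add: markov_chain_def)
  then show ?case
    using \<pi>_integrable[of 0 s] s integrable_distr_eq[OF X_measurable[OF n] weight_measurable, of 0 s] by simp
next
  case (Suc t)
  then have t: "t + 0 \<le> n" "t + Suc 0 \<le> n" by auto
  have "integrable (array_law n t 0) (path_weight 0 s)"
    using Suc by (subst array_law_integral(2)[OF n t(1) path_weight_measurable]) (simp add: path_weight_0)
  from push_integral(1)[OF _ array_law_space[OF n t(1)] s this, of "real (t + Suc 0) / real n"]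
  have "integrable (array_law n t (Suc 0)) (path_weight (Suc 0) s)"
    using t n by (simp add: array_law_push)
  then have "integrable M (\<lambda>\<omega>. weight s (X n t \<omega>) + weight s (X n (Suc t) \<omega>))"
    by (subst (asm) array_law_integral(2)[OF n t(2) path_weight_measurable]) (simp add: path_weight_1)
  then show ?case
  proof (rule Bochner_Integration.integrable_bound)
    show "(\<lambda>\<omega>. weight s (X n (Suc t) \<omega>)) \<in> borel_measurable M"
      by (rule measurable_compose[OF X_measurable weight_measurable]) (use n Suc in auto)
  qed (simp add: weight_nonneg)
qed

lemma array_law_integrable:
  assumes n: "n \<ge> 1" and s: "s \<le> k"
  shows "t + j \<le> n \<Longrightarrow> integrable (array_law n t j) (path_weight j s)"
proof (induction j)
  case 0
  then show ?case
    using X_integrable[OF n s, of t]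
    by (subst array_law_integral(2)[OF n 0 path_weight_measurable]) (simp add: path_weight_0)
next
  case (Suc j)
  then have t: "t + j \<le> n" by simp
  show ?case
    unfolding array_law_push[OF n Suc.prems]
    by (rule push_integral(1)[OF _ array_law_space[OF n t] s Suc.IH[OF t]]) (rule time_in_unit[OF n Suc.prems])
qed

lemma array_law_functional:
  "n \<ge> 1 \<Longrightarrow> t + j \<le> n \<Longrightarrow> s \<le> k \<Longrightarrow>
    weighted_functional (pow_space (Suc j)) (path_weight j s) (\<lambda>g. \<integral>x. g x \<partial>array_law n t j)"
  using array_law_space array_law_integrable by (intro integral_functional) auto

lemma array_law_step:
  assumes "n \<ge> 1" "t + Suc j \<le> n" "s \<le> k" "g \<in> weighted_fun (pow_space (Suc (Suc j))) (path_weight (Suc j) s)"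
  shows "(\<integral>x. g x \<partial>array_law n t (Suc j)) = (\<integral>x. path_op j 0 (real (t + Suc j) / real n) g x \<partial>array_law n t j)"
proof -
  have t: "t + j \<le> n" using assms by simp
  show ?thesis
    unfolding array_law_push[OF assms(1,2)]
    by (rule push_integral(3)[OF _ array_law_space[OF assms(1) t] assms(3) array_law_integrable[OF assms(1,3) t] assms(4)])
      (rule time_in_unit[OF assms(1,2)])
qed

lemma marginal_integral:
  fixes g :: "'a \<Rightarrow> real"
  shows "n \<ge> 1 \<Longrightarrow> t \<le> n \<Longrightarrow> g \<in> borel_measurable borel \<Longrightarrow> (\<integral>x. g x \<partial>marginal n t) = (\<integral>\<omega>. g (X n t \<omega>) \<partial>M)"
  unfolding marginal_def by (rule integral_distr[OF X_measurable])

lemma marginal_functional: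
  assumes "n \<ge> 1" "t \<le> n" "s \<le> k"
  shows "weighted_functional borel (weight s) (\<lambda>g. \<integral>x. g x \<partial>marginal n t)"
proof (rule integral_functional)
  show "integrable (marginal n t) (weight s)"
    unfolding marginal_def integrable_distr_eq[OF X_measurable[OF assms(1,2)] weight_measurable]
    by (rule X_integrable[OF assms(1,3,2)])
qed (simp add: marginal_def)

text \<open>Read off from the window of length two, with test functions that depend on the second
  coordinate alone.\<close>

lemma marginal_step:
  assumes n: "n \<ge> 1" and t: "Suc t \<le> n" and s: "s \<le> k" and g: "g \<in> weighted_fun borel (weight s)"
  shows "(\<integral>x. g x \<partial>marginal n (Suc t)) = (\<integral>x. Kop 0 (real (Suc t) / real n) g x \<partial>marginal n t)"
proof -
  let ?u = "real (Suc t) / real n"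
  have u: "?u \<in> {0..1}" by (rule time_in_unit[OF n t])
  have gm: "g \<in> borel_measurable borel" by (rule weighted_fun_measurable[OF g])
  have Kg: "Kop 0 ?u g \<in> borel_measurable borel"
    using weighted_fun_measurable[OF E.K_weighted_fun[of s 0 ?u g]] s u g by simp
  obtain c where c: "\<And>x. \<bar>g x\<bar> \<le> c * weight s x" using g by (auto simp: weighted_fun_def)
  have c0: "0 \<le> c" using c[of undefined] weight_ge_1[of s undefined]
    by (smt (verit) mult_neg_pos)
  have pm: "(\<lambda>x. x (Suc 0)) \<in> pow_space (Suc (Suc 0)) \<rightarrow>\<^sub>M borel" "(\<lambda>x. x 0) \<in> pow_space (Suc 0) \<rightarrow>\<^sub>M borel"
    by (auto intro!: measurable_component_singleton)
  have hm: "(\<lambda>x. g (x (Suc 0))) \<in> borel_measurable (pow_space (Suc (Suc 0)))"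
    by (rule measurable_compose[OF pm(1) gm])
  have h: "(\<lambda>x. g (x (Suc 0))) \<in> weighted_fun (pow_space (Suc (Suc 0))) (path_weight (Suc 0) s)"
  proof (rule weighted_funI[OF hm])
    fix x :: "nat \<Rightarrow> 'a"
    have "weight s (x (Suc 0)) \<le> path_weight (Suc 0) s x" by (rule path_weight_ge) simp
    then show "\<bar>g (x (Suc 0))\<bar> \<le> c * path_weight (Suc 0) s x"
      using c[of "x (Suc 0)"] mult_left_mono[OF _ c0] by fastforce
  qed
  have "(\<integral>x. g x \<partial>marginal n (Suc t)) = (\<integral>\<omega>. g (X n (Suc t) \<omega>) \<partial>M)"
    by (rule marginal_integral[OF n t gm])
  also have "\<dots> = (\<integral>x. g (x (Suc 0)) \<partial>array_law n t (Suc 0))"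
    using array_law_integral(1)[OF n _ hm, of t] t by simp
  also have "\<dots> = (\<integral>x. path_op 0 0 ?u (\<lambda>x. g (x (Suc 0))) x \<partial>array_law n t 0)"
    using array_law_step[OF n _ s h, of t] t by simp
  also have "\<dots> = (\<integral>x. Kop 0 ?u g (x 0) \<partial>array_law n t 0)"
    by (simp add: path_op_def Kop_def kernel_op_def)
  also have "\<dots> = (\<integral>\<omega>. Kop 0 ?u g (X n t \<omega>) \<partial>M)"
    using array_law_integral(1)[OF n _ measurable_compose[OF pm(2) Kg], of t] t by simp
  also have "\<dots> = (\<integral>x. Kop 0 ?u g x \<partial>marginal n t)"
    using t by (intro marginal_integral[OF n _ Kg, symmetric]) simp
  finally show ?thesis .
qed

text \<open>The comparison measure moves with \<open>t\<close>: it is the invariant measure frozen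
  at the current parameter \<open>t / n\<close>, which makes the gap a functional of mass
  zero.\<close>

definition "gap n t g = (\<integral>x. g x \<partial>marginal n t) - (\<integral>x. (g x :: real) \<partial>\<pi> (real t / real n))"

lemma gap_functional: "n \<ge> 1 \<Longrightarrow> t \<le> n \<Longrightarrow> weighted_functional borel (weight 0) (gap n t)"
  unfolding gap_def using time_in_unit
  by (intro functional_minus marginal_functional \<pi>_functional) auto

lemma gap_one:
  assumes "n \<ge> 1" "t \<le> n"
  shows "gap n t (\<lambda>_. 1) = 0"
proof -
  have "(\<integral>x. 1 \<partial>marginal n t) = (1::real)"
    using prob_space.prob_space[OF prob_space.prob_space_distr[OF M_prob X_measurable[OF assms]]]
    by (simp add: marginal_def)
  then show ?thesis using \<pi>_one[OF time_in_unit[OF assms]] by (simp add: gap_def)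
qed

lemma marginal_0: "n \<ge> 1 \<Longrightarrow> marginal n 0 = \<pi> 0"
  using chain[of n] by (simp add: markov_chain_def marginal_def)

text \<open>The error accumulated in \<open>r\<close> steps, up to the factor \<open>1 / n\<close>:
  every step adds a Lipschitz error \<open>L\<close>, and an error is multiplied by the one-step
  norm bound \<open>C0 * (1 + 1)\<close> each time it is transported, at least once. The growth in
  \<open>r\<close> is harmless, since it is used only for \<open>r \<le> m\<close> or for bounded
  \<open>n\<close>.\<close>

definition "step_const L r = (\<Sum>i<r. (C0 * (1 + 1)) ^ Suc i) * (L :: real)"

lemma gap_steps:
  assumes L: "L > 0" "\<And>u v. u \<in> {0..1} \<Longrightarrow> v \<in> {0..1} \<Longrightarrow>
      dual_bound borel (weight 0) (\<lambda>g. (\<integral>x. g x \<partial>\<pi> v) - (\<integral>x. g x \<partial>\<pi> u)) (L * \<bar>v - u\<bar>)"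
    and n: "n \<ge> 1"
  shows "t + r \<le> n \<Longrightarrow> dual_bound borel (weight 0)
    (\<lambda>g. gap n (t + r) g - gap n t (Pop (map (\<lambda>i. real i / real n) [Suc t..<Suc (t + r)]) g))
    (step_const L r / real n)"
proof (induction r)
  case 0
  then show ?case by (simp add: dual_bound_def step_const_def)
next
  case (Suc r)
  define c where "c = C0 * (1 + 1)"
  let ?u = "real (Suc (t + r)) / real n" and ?v = "real (t + r) / real n"
  let ?us = "map (\<lambda>i. real i / real n) [Suc t..<Suc (t + r)]"
  have tr: "t + r \<le> n" "t \<le> n" "Suc (t + r) \<le> n" using Suc.prems by auto
  have u: "?u \<in> {0..1}" by (rule time_in_unit[OF n tr(3)])
  have v: "?v \<in> {0..1}" by (rule time_in_unit[OF n tr(1)])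
  have us: "set ?us \<subseteq> {0..1}" by (rule grid_in_unit[OF n tr(1)])
  let ?R = "\<lambda>g :: 'a \<Rightarrow> real. (\<integral>x. g x \<partial>\<pi> ?v) - (\<integral>x. g x \<partial>\<pi> ?u)"
  let ?G = "\<lambda>g. gap n (t + r) g - gap n t (Pop ?us g)"
  have uv: "\<bar>?v - ?u\<bar> = 1 / real n" using n by (simp add: diff_divide_distrib[symmetric])
  have "dual_bound borel (weight (0 + 0)) ?R (L / real n)" using L(2)[OF u v] unfolding uv by simp
  then have R: "dual_bound borel (weight 0) (\<lambda>g. ?R (Kop 0 ?u g)) (c * (L / real n))"
  proof -
    assume R: "dual_bound borel (weight (0 + 0)) ?R (L / real n)"
    have "weighted_functional borel (weight (0 + 0)) ?R"
      by (rule functional_minus[OF \<pi>_functional[OF v] \<pi>_functional[OF u]]) simp_all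
    from E.comp_bound[OF _ u this R] show ?thesis by (simp add: c_def)
  qed
  have Gf: "weighted_functional borel (weight (0 + 0)) ?G"
    using gap_functional[OF n tr(1)] Pop_functional[OF us _ gap_functional[OF n tr(2)]]
    by (auto intro: functional_minus)
  have "dual_bound borel (weight (0 + 0)) ?G (step_const L r / real n)" using Suc.IH[OF tr(1)] by simp
  from E.comp_bound[OF _ u Gf this]
  have G: "dual_bound borel (weight 0) (\<lambda>g. ?G (Kop 0 ?u g)) (c * (step_const L r / real n))"
    by (simp add: c_def)
  have "dual_bound borel (weight 0) (\<lambda>g. ?G (Kop 0 ?u g) + ?R (Kop 0 ?u g)) (c * (step_const L r / real n) + c * (L / real n))"
    by (rule dual_bound_add[OF G R])
  also have "c * (step_const L r / real n) + c * (L / real n) = step_const L (Suc r) / real n"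
  proof -
    have "step_const L (Suc r) = c * step_const L r + c * L"
      unfolding step_const_def c_def[symmetric]
      by (subst sum.lessThan_Suc_shift) (simp add: sum_distrib_left algebra_simps)
    then show ?thesis by (simp add: add_divide_distrib)
  qed
  finally have bound: "dual_bound borel (weight 0) (\<lambda>g. ?G (Kop 0 ?u g) + ?R (Kop 0 ?u g)) (step_const L (Suc r) / real n)" .
  have upt: "[Suc t..<Suc (t + Suc r)] = [Suc t..<Suc (t + r)] @ [Suc (t + r)]" by simp
  have "?G (Kop 0 ?u g) + ?R (Kop 0 ?u g)
      = gap n (t + Suc r) g - gap n t (Pop (map (\<lambda>i. real i / real n) [Suc t..<Suc (t + Suc r)]) g)"
    if "g \<in> weighted_ball borel (weight 0)" for g
  proof -
    note g = weighted_ball_fun[OF that]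
    show ?thesis
      unfolding upt map_append Pop_append
      using marginal_step[OF n tr(3) _ g] \<pi>_Kop[OF u _ g] by (simp add: gap_def)
  qed
  then show ?case using bound by (simp add: dual_bound_def)
qed

text \<open>For large \<open>n\<close> the parameters of \<open>m\<close> consecutive steps lie
  within \<open>\<epsilon>\<close> of each other, so a block contracts the gap by
  \<open>\<alpha>\<close> up to an error \<open>S / n\<close>. Induction in blocks gives
  \<open>H / n\<close> with \<open>H\<close> the fixed point of this recursion; for the finitely
  many small \<open>n\<close> the crude bound from time 0, where the gap vanishes, is
  enough.\<close>

lemma gap_bound:
  obtains B where "B > 0" "\<And>n t. n \<ge> 1 \<Longrightarrow> t \<le> n \<Longrightarrow> dual_bound borel (weight 0) (gap n t) (B / real n)"
proof -
  obtain L where L: "L > 0" "\<And>u v. u \<in> {0..1} \<Longrightarrow> v \<in> {0..1} \<Longrightarrow>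
    dual_bound borel (weight 0) (\<lambda>g. (\<integral>x. g x \<partial>\<pi> v) - (\<integral>x. g x \<partial>\<pi> u)) (L * \<bar>v - u\<bar>)"
    using \<pi>_Lipschitz by blast
  obtain \<alpha> \<beta> where \<alpha>: "0 \<le> \<alpha>" "\<alpha> < 1" and \<beta>: "0 < \<beta>" and contr: "contracting 0 \<alpha> \<beta>"
    using contraction[OF le0] by blast
  let ?W = "\<lambda>x. 1 + \<beta> * weight 0 x"
  have steps: "dual_bound borel (weight 0)
      (\<lambda>g. gap n (t + r) g - gap n t (Pop (map (\<lambda>i. real i / real n) [Suc t..<Suc (t + r)]) g))
      (step_const L r / real n)" if "n \<ge> 1" "t + r \<le> n" for n t r
    by (rule gap_steps[OF L that])
  have sc_mono: "step_const L r \<le> step_const L r'" if "r \<le> r'" for r r'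
    unfolding step_const_def using that C0 L(1) by (intro mult_right_mono sum_mono2) auto
  have sc0: "0 \<le> step_const L r" for r using sc_mono[of 0 r] by (simp add: step_const_def)
  have start: "dual_bound borel (weight 0) (gap n t) (step_const L t / real n)" if "n \<ge> 1" "t \<le> n" for n t
  proof -
    have "gap n 0 = (\<lambda>g. 0)" by (simp add: gap_def marginal_0[OF that(1)] fun_eq_iff)
    then show ?thesis using steps[OF that(1), of 0 t] that by simp
  qed
  \<comment> \<open>\<open>n > N0\<close> forces \<open>m / n < \<epsilon>\<close>, and the indices
    within a block differ by less than \<open>m\<close>.\<close>
  define N0 where "N0 = nat \<lceil>real m / \<epsilon>\<rceil>"
  define S where "S = (1 + \<beta>) * step_const L m"
  \<comment> \<open>The solution of \<open>\<alpha> * H + S = H\<close>, the bound reproduced by one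
    block.\<close>
  define H where "H = S / (1 - \<alpha>)"
  have S0: "0 \<le> S" using sc0 \<beta> by (simp add: S_def)
  have H: "S \<le> H" "\<alpha> * H + S = H"
  proof -
    have "(1 - \<alpha>) * H = S" using \<alpha> by (simp add: H_def)
    then show "\<alpha> * H + S = H" by (simp add: algebra_simps)
    moreover have "0 \<le> \<alpha> * H" using S0 \<alpha> by (simp add: H_def)
    ultimately show "S \<le> H" by simp
  qed
  have large: "dual_bound borel ?W (gap n t) (H / real n)" if n: "n \<ge> 1" "n > N0" and "t \<le> n" for n t
    using \<open>t \<le> n\<close>
  proof (induction t rule: less_induct)
    case (less t)
    show ?case
    proof (cases "t < m")
      case True
      have "dual_bound borel ?W (gap n t) ((1 + \<beta>) * (step_const L t / real n))"
        by (intro bound_to_equiv \<beta> gap_functional start n less.prems)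
      moreover have "(1 + \<beta>) * (step_const L t / real n) \<le> H / real n"
      proof -
        have "(1 + \<beta>) * step_const L t \<le> S"
          unfolding S_def using True \<beta> by (intro mult_left_mono sc_mono) auto
        then have "(1 + \<beta>) * step_const L t \<le> H" using H(1) by simp
        then have "(1 + \<beta>) * step_const L t / real n \<le> H / real n" by (intro divide_right_mono) auto
        then show ?thesis by simp
      qed
      ultimately show ?thesis by (rule dual_bound_le)
    next
      case False
      define t0 where "t0 = t - m"
      have t: "t = t0 + m" "t0 < t" "t0 \<le> n" "t0 + m \<le> n"
        using False params(1) less.prems by (auto simp: t0_def)
      let ?us = "map (\<lambda>i. real i / real n) [Suc t0..<Suc (t0 + m)]"
      have us: "set ?us \<subseteq> {0..1}" by (rule grid_in_unit[OF n(1) t(4)])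
      have close: "\<forall>v\<in>set ?us. \<forall>w\<in>set ?us. \<bar>v - w\<bar> < \<epsilon>"
      proof (intro ballI)
        fix v w assume "v \<in> set ?us" "w \<in> set ?us"
        then obtain i i' where "i \<in> {Suc t0..<Suc (t0 + m)}" "i' \<in> {Suc t0..<Suc (t0 + m)}"
          and i: "v = real i / real n" "w = real i' / real n"
          by (simp only: set_map set_upt) blast
        then have "Suc t0 \<le> i" "i \<le> t0 + m" "Suc t0 \<le> i'" "i' \<le> t0 + m" by simp_all
        then have "\<bar>real i - real i'\<bar> < real m" by linarith
        moreover have "real m < \<epsilon> * real n"
        proof -
          have "real m / \<epsilon> < real n" using n(2) unfolding N0_def by linarith
          then show ?thesis using params by (simp add: divide_less_eq mult.commute)
        qed
        ultimately have "\<bar>real i - real i'\<bar> / real n < \<epsilon>"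
          using n(1) by (simp add: divide_less_eq)
        then show "\<bar>v - w\<bar> < \<epsilon>" using n(1) by (simp add: i diff_divide_distrib[symmetric])
      qed
      have "dual_bound borel ?W (\<lambda>g. gap n t0 (Pop ?us g)) (\<alpha> * (H / real n))"
        by (rule contractingD[OF contr _ us close gap_functional[OF n(1) t(3)] gap_one[OF n(1) t(3)] less.IH[OF t(2,3)]]) simp
      moreover have "dual_bound borel ?W (\<lambda>g. gap n (t0 + m) g - gap n t0 (Pop ?us g)) ((1 + \<beta>) * (step_const L m / real n))"
        by (intro bound_to_equiv \<beta> functional_minus gap_functional Pop_functional us steps n t) simp_all
      ultimately have "dual_bound borel ?W (\<lambda>g. gap n t0 (Pop ?us g) + (gap n (t0 + m) g - gap n t0 (Pop ?us g)))
          (\<alpha> * (H / real n) + (1 + \<beta>) * (step_const L m / real n))"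
        by (rule dual_bound_add)
      moreover have "\<alpha> * (H / real n) + (1 + \<beta>) * (step_const L m / real n) = H / real n"
        using H(2) by (simp add: S_def add_divide_distrib[symmetric])
      ultimately show ?thesis by (simp add: t(1))
    qed
  qed
  define B where "B = max (step_const L N0) (H / \<beta>) + 1"
  show ?thesis
  proof (rule that[of B])
    show "B > 0" using sc0[of N0] by (simp add: B_def)
    fix n t :: nat assume n: "n \<ge> 1" and t: "t \<le> n"
    show "dual_bound borel (weight 0) (gap n t) (B / real n)"
    proof (cases "n > N0")
      case True
      have "dual_bound borel (weight 0) (gap n t) ((1 / \<beta>) * (H / real n))"
        by (intro bound_from_equiv \<beta> gap_functional large n t True)
      moreover have "(1 / \<beta>) * (H / real n) \<le> B / real n"
      proof -
        have "H / \<beta> \<le> B" by (simp add: B_def)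
        then have "(H / \<beta>) / real n \<le> B / real n" by (intro divide_right_mono) auto
        then show ?thesis by simp
      qed
      ultimately show ?thesis by (rule dual_bound_le)
    next
      case False
      have "step_const L t \<le> B" using sc_mono[of t N0] False t by (simp add: B_def)
      then have "step_const L t / real n \<le> B / real n" by (intro divide_right_mono) auto
      then show ?thesis by (rule dual_bound_le[OF start[OF n t]])
    qed
  qed
qed

text \<open>Induction on the length of the window. With \<open>v\<close> the parameter of the last
  step, the new difference is the old one composed with the step at \<open>v\<close>, plus the
  stationary law at \<open>u\<close> applied to the difference of the steps at \<open>v\<close> and
  \<open>u\<close>. The latter is Lipschitz at the cost of one level, and the stationary law
  integrates that level uniformly in \<open>u\<close>. For length one the gap is combined with the
  Lipschitz continuity of \<open>\<pi>\<close>.\<close>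

lemma array_law_gap:
  "\<exists>B>0. \<forall>n\<ge>1. \<forall>u\<in>{0..1}. \<forall>t. t + j \<le> n \<longrightarrow>
    dual_bound (pow_space (Suc j)) (path_weight j 0)
      (\<lambda>g. (\<integral>x. g x \<partial>array_law n t j) - (\<integral>x. g x \<partial>stationary_law u j))
      (B * (\<bar>u - real t / real n\<bar> + 1 / real n))"
proof (induction j)
  case 0
  obtain B where B: "B > 0" "\<And>n t. n \<ge> 1 \<Longrightarrow> t \<le> n \<Longrightarrow> dual_bound borel (weight 0) (gap n t) (B / real n)"
    using gap_bound by blast
  obtain L where L: "L > 0" "\<And>u v. u \<in> {0..1} \<Longrightarrow> v \<in> {0..1} \<Longrightarrow>
    dual_bound borel (weight 0) (\<lambda>g. (\<integral>x. g x \<partial>\<pi> v) - (\<integral>x. g x \<partial>\<pi> u)) (L * \<bar>v - u\<bar>)"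
    using \<pi>_Lipschitz by blast
  show ?case
  proof (intro exI[of _ "B + L"] conjI allI impI ballI)
    show "B + L > 0" using B L by simp
    fix n t :: nat and u :: real assume n: "1 \<le> n" and u: "u \<in> {0..1}" and t: "t + 0 \<le> n"
    let ?v = "real t / real n"
    have v: "?v \<in> {0..1}" using time_in_unit[OF n] t by simp
    show "dual_bound (pow_space (Suc 0)) (path_weight 0 0)
      (\<lambda>g. (\<integral>x. g x \<partial>array_law n t 0) - (\<integral>x. g x \<partial>stationary_law u 0))
      ((B + L) * (\<bar>u - ?v\<bar> + 1 / real n))"
      unfolding dual_bound_def
    proof
      fix g assume g: "g \<in> weighted_ball (pow_space (Suc 0)) (path_weight 0 0)"
      define h where "h x = g (\<lambda>i\<in>{..<Suc 0}. x)" for x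
      have gm: "g \<in> borel_measurable (pow_space (Suc 0))" by (rule weighted_ballD(1)[OF g])
      have hm: "h \<in> borel_measurable borel" unfolding h_def by (rule measurable_compose[OF singleton_measurable gm])
      have hb: "h \<in> weighted_ball borel (weight 0)"
      proof (rule weighted_ballI[OF hm])
        fix x show "\<bar>h x\<bar> \<le> weight 0 x"
          using weighted_ballD(2)[OF g, of "\<lambda>i\<in>{..<Suc 0}. x"] measurable_space[OF singleton_measurable, of x]
          unfolding h_def path_weight_singleton by simp
      qed
      have "(\<integral>x. g x \<partial>array_law n t 0) = (\<integral>x. h x \<partial>marginal n t)"
      proof -
        have "(\<lambda>i\<in>{..<Suc 0}. X n (t + i) \<omega>) = (\<lambda>i\<in>{..<Suc 0}. X n t \<omega>)" for \<omega>
          by (intro ext) (auto simp: restrict_def)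
        then show ?thesis
          unfolding array_law_integral(1)[OF n t gm] using marginal_integral[OF n _ hm, of t] t by (simp add: h_def)
      qed
      moreover have "(\<integral>x. g x \<partial>stationary_law u 0) = (\<integral>x. h x \<partial>\<pi> u)"
        unfolding path_law.simps h_def by (rule integral_distr[OF singleton_measurable_\<pi>[OF u] gm])
      ultimately have eq: "(\<integral>x. g x \<partial>array_law n t 0) - (\<integral>x. g x \<partial>stationary_law u 0)
          = gap n t h + ((\<integral>x. h x \<partial>\<pi> ?v) - (\<integral>x. h x \<partial>\<pi> u))"
        by (simp add: gap_def)
      have "\<bar>gap n t h\<bar> \<le> B / real n" using B(2)[OF n, of t] t hb by (simp add: dual_bound_def)
      moreover have "\<bar>(\<integral>x. h x \<partial>\<pi> ?v) - (\<integral>x. h x \<partial>\<pi> u)\<bar> \<le> L * \<bar>?v - u\<bar>"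
        using L(2)[OF u v] hb by (simp add: dual_bound_def)
      ultimately have "\<bar>(\<integral>x. g x \<partial>array_law n t 0) - (\<integral>x. g x \<partial>stationary_law u 0)\<bar> \<le> B / real n + L * \<bar>u - ?v\<bar>"
        unfolding eq by (simp add: abs_minus_commute)
      also have "\<dots> \<le> (B + L) * (\<bar>u - ?v\<bar> + 1 / real n)"
      proof -
        have "0 \<le> B * \<bar>u - ?v\<bar>" "0 \<le> L * (1 / real n)" using B(1) L(1) by auto
        then show ?thesis by (simp add: distrib_left distrib_right add_divide_distrib)
      qed
      finally show "\<bar>(\<integral>x. g x \<partial>array_law n t 0) - (\<integral>x. g x \<partial>stationary_law u 0)\<bar>
          \<le> (B + L) * (\<bar>u - ?v\<bar> + 1 / real n)" .
    qed
  qed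
next
  case (Suc j)
  interpret P: smooth_operators k "pow_space (Suc j)" "path_weight j" "pow_space (Suc (Suc j))" "path_weight (Suc j)"
    "path_op j" "path_const j"
    by (rule path_operators)
  obtain B where B: "B > 0" "\<And>n u t. n \<ge> 1 \<Longrightarrow> u \<in> {0..1} \<Longrightarrow> t + j \<le> n \<Longrightarrow>
    dual_bound (pow_space (Suc j)) (path_weight j 0)
      (\<lambda>g. (\<integral>x. g x \<partial>array_law n t j) - (\<integral>x. g x \<partial>stationary_law u j))
      (B * (\<bar>u - real t / real n\<bar> + 1 / real n))"
    using Suc by blast
  define c where "c = path_const j"
  define A where "A = (1 + C0) ^ j * (b / (1 - lam))"
  have c: "c > 0" using P.c_pos by (simp add: c_def)
  have A: "A > 0" using C0 params by (simp add: A_def)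
  show ?case
  proof (intro exI[of _ "c * B + c * A * (real j + 1)"] conjI allI impI ballI)
    show "c * B + c * A * (real j + 1) > 0" using B(1) c A by (intro add_pos_nonneg) auto
    fix n t :: nat and u :: real assume n: "1 \<le> n" and u: "u \<in> {0..1}" and t: "t + Suc j \<le> n"
    let ?v = "real (t + Suc j) / real n" and ?d = "\<bar>u - real t / real n\<bar> + 1 / real n"
    have v: "?v \<in> {0..1}" by (rule time_in_unit[OF n t])
    have t': "t + j \<le> n" using t by simp
    \<comment> \<open>The last step uses the parameter at time \<open>t + Suc j\<close>, and the
      shift by \<open>j + 1\<close> grid points is absorbed into the term
      \<open>1 / n\<close>.\<close>
    have dv: "\<bar>?v - u\<bar> \<le> (real j + 1) * ?d"
    proof -
      have eq: "?v = real t / real n + (real j + 1) / real n" by (simp add: add_divide_distrib)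
      have "0 \<le> (real j + 1) / real n" by simp
      then have "\<bar>?v - u\<bar> \<le> \<bar>u - real t / real n\<bar> + (real j + 1) / real n" unfolding eq by arith
      also have "\<dots> \<le> (real j + 1) * ?d" by (simp add: algebra_simps add_divide_distrib)
      finally show ?thesis .
    qed
    have stat1: "weighted_functional (pow_space (Suc j)) (path_weight j 1) (\<lambda>g. \<integral>x. g x \<partial>stationary_law u j)"
      by (rule stationary_law_functional[OF u k])
    have stat1b: "dual_bound (pow_space (Suc j)) (path_weight j 1) (\<lambda>g. \<integral>x. g x \<partial>stationary_law u j) A"
      using stationary_law_integrable[OF u k, of j] stationary_law_space[OF u, of j]
      by (intro integral_dual_bound) (auto simp: A_def)
    show "dual_bound (pow_space (Suc (Suc j))) (path_weight (Suc j) 0)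
      (\<lambda>g. (\<integral>x. g x \<partial>array_law n t (Suc j)) - (\<integral>x. g x \<partial>stationary_law u (Suc j)))
      ((c * B + c * A * (real j + 1)) * ?d)"
      unfolding dual_bound_def
    proof
      fix g assume g: "g \<in> weighted_ball (pow_space (Suc (Suc j))) (path_weight (Suc j) 0)"
      note gf = weighted_ball_fun[OF g]
      have Kf: "path_op j 0 w g \<in> weighted_fun (pow_space (Suc j)) (path_weight j 0)" if "w \<in> {0..1}" for w
        using P.K_weighted_fun[of 0 0 w g] that gf by simp
      have eq: "(\<integral>x. g x \<partial>array_law n t (Suc j)) - (\<integral>x. g x \<partial>stationary_law u (Suc j))
          = ((\<integral>x. path_op j 0 ?v g x \<partial>array_law n t j) - (\<integral>x. path_op j 0 ?v g x \<partial>stationary_law u j))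
            + (\<integral>x. path_op j 0 ?v g x - path_op j 0 u g x \<partial>stationary_law u j)"
        using array_law_step[OF n t le0 gf] stationary_law_step[OF u le0 gf]
          functional_diff[OF stationary_law_functional[OF u le0] Kf[OF v] Kf[OF u]] by simp
      have "weighted_functional (pow_space (Suc j)) (path_weight j (0 + 0))
          (\<lambda>g. (\<integral>x. g x \<partial>array_law n t j) - (\<integral>x. g x \<partial>stationary_law u j))"
        using array_law_functional[OF n t' le0] stationary_law_functional[OF u le0] by (auto intro: functional_minus)
      from P.comp_bound[OF _ v this, of "B * ?d"] B(2)[OF n u t'] g
      have 1: "\<bar>(\<integral>x. path_op j 0 ?v g x \<partial>array_law n t j) - (\<integral>x. path_op j 0 ?v g x \<partial>stationary_law u j)\<bar> \<le> c * (B * ?d)"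
        by (simp add: dual_bound_def c_def)
      have 2: "\<bar>\<integral>x. path_op j 0 ?v g x - path_op j 0 u g x \<partial>stationary_law u j\<bar> \<le> (\<bar>?v - u\<bar> * c) * A"
      proof (rule dual_boundD[OF stat1b stat1])
        show "(\<lambda>x. path_op j 0 ?v g x - path_op j 0 u g x) \<in> borel_measurable (pow_space (Suc j))"
          using weighted_fun_measurable[OF Kf[OF v]] weighted_fun_measurable[OF Kf[OF u]] by simp
        show "\<bar>path_op j 0 ?v g x - path_op j 0 u g x\<bar> \<le> \<bar>?v - u\<bar> * c * path_weight j 1 x"
          if "x \<in> space (pow_space (Suc j))" for x
          using P.K_Lipschitz[of 0 0 u ?v x] u v k g that by (simp add: dual_bound_def c_def mult.assoc)
      qed (use c path_weight_nonneg in auto)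
      have "\<bar>?v - u\<bar> * c * A \<le> ((real j + 1) * ?d) * c * A"
        using dv c A by (intro mult_right_mono) auto
      then show "\<bar>(\<integral>x. g x \<partial>array_law n t (Suc j)) - (\<integral>x. g x \<partial>stationary_law u (Suc j))\<bar>
          \<le> (c * B + c * A * (real j + 1)) * ?d"
      proof -
        assume 3: "\<bar>?v - u\<bar> * c * A \<le> ((real j + 1) * ?d) * c * A"
        have "c * (B * x) + ((real j + 1) * x) * c * A = (c * B + c * A * (real j + 1)) * x" for x
          by (simp add: algebra_simps)
        from this[of ?d] show ?thesis
          unfolding eq using 1 2 3 by (intro order_trans[OF abs_triangle_ineq]) linarith
      qed
    qed
  qed
qed

theorem array_locally_stationary:
  "locally_stationary (weight 0) M X (\<lambda>u. path_law (\<pi> u) (Q u))"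
  unfolding locally_stationary_def
proof (intro allI impI)
  fix j :: nat assume "1 \<le> j"
  then obtain i where j: "j = Suc i" by (cases j) auto
  obtain B where B: "B > 0" "\<And>n u t. n \<ge> 1 \<Longrightarrow> u \<in> {0..1} \<Longrightarrow> t + i \<le> n \<Longrightarrow>
    dual_bound (pow_space (Suc i)) (path_weight i 0)
      (\<lambda>g. (\<integral>x. g x \<partial>array_law n t i) - (\<integral>x. g x \<partial>stationary_law u i))
      (B * (\<bar>u - real t / real n\<bar> + 1 / real n))"
    using array_law_gap[of i] by blast
  show "\<exists>C>0. \<forall>u\<in>{0..1}. \<forall>n\<ge>1. \<forall>t\<ge>1. t + j \<le> n + 1 \<longrightarrow>
        weighted_norm (pow_space j) (sum_weight (weight 0) j)
            (\<lambda>A. measure (window_law M (X n) t j) A - measure (path_law (\<pi> u) (Q u) j) A)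
          \<le> ereal (C * (\<bar>u - real t / real n\<bar> + 1 / real n))"
    unfolding j path_weight_def[symmetric]
  proof (intro exI[of _ B] conjI B(1) ballI allI impI)
    fix u and n t :: nat assume u: "u \<in> {0..1::real}" and n: "1 \<le> n" and "t + Suc i \<le> n + 1"
    then have t: "t + i \<le> n" by simp
    let ?T = "\<lambda>g :: (nat \<Rightarrow> 'a) \<Rightarrow> real. (\<integral>x. g x \<partial>array_law n t i) - (\<integral>x. g x \<partial>stationary_law u i)"
    show "weighted_norm (pow_space (Suc i)) (path_weight i 0)
        (\<lambda>A. measure (array_law n t i) A - measure (stationary_law u i) A)
      \<le> ereal (B * (\<bar>u - real t / real n\<bar> + 1 / real n))"
    proof (rule weighted_norm_functional_le[where T="?T"])
      show "weighted_functional (pow_space (Suc i)) (path_weight i 0) ?T"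
        by (intro functional_minus array_law_functional stationary_law_functional n t u le0)
      show "measure (array_law n t i) A - measure (stationary_law u i) A = ?T (indicator A)"
        if A: "A \<in> sets (pow_space (Suc i))" for A
      proof -
        have "A \<inter> space N = A" if "sets N = sets (pow_space (Suc i) :: (nat \<Rightarrow> 'a) measure)" for N
          using sets.sets_into_space[of A N] A that by auto
        then show ?thesis
          using array_law_space(1)[OF n t] stationary_law_space(1)[OF u, of i] by simp
      qed
      show "dual_bound (pow_space (Suc i)) (path_weight i 0) ?T (B * (\<bar>u - real t / real n\<bar> + 1 / real n))"
        by (rule B(2)[OF n u t])
    qed (auto intro: path_weight_ge_1 path_weight_measurable)
  qed
qed

end

theorem proposition2:
  fixes \<gamma> :: "'a::topological_space \<Rightarrow> 'a measure"
    and f :: "real \<Rightarrow> 'a \<Rightarrow> 'a \<Rightarrow> real"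
    and Q :: "real \<Rightarrow> 'a \<Rightarrow> 'a measure"
    and \<pi> :: "real \<Rightarrow> 'a measure"
    and M :: "'w measure"
    and X :: "nat \<Rightarrow> nat \<Rightarrow> 'w \<Rightarrow> 'a"
    and \<phi> :: "'a \<Rightarrow> real"
    and m k :: nat
    and d0 \<epsilon> K lam b d1 q C :: real
    and \<eta> :: "real \<Rightarrow> real"
    and \<nu> :: "real \<Rightarrow> 'a measure"
    and D :: "nat \<Rightarrow> real \<Rightarrow> 'a \<Rightarrow> 'a \<Rightarrow> real"
  assumes kernel_\<gamma>: "measure_kernel borel borel \<gamma>"
    and f_measurable: "(\<lambda>(u, x, y). f u x y) \<in>
          borel_measurable (restrict_space borel {0..1} \<Otimes>\<^sub>M borel \<Otimes>\<^sub>M borel)"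
    and f_nonneg: "\<And>u x y. u \<in> {0..1} \<Longrightarrow> 0 \<le> f u x y"
    and Q_density: "\<And>u x. u \<in> {0..1} \<Longrightarrow> Q u x = density (\<gamma> x) (\<lambda>y. ennreal (f u x y))"
    and Q_markov: "\<And>u. u \<in> {0..1} \<Longrightarrow> Q u \<in> borel \<rightarrow>\<^sub>M prob_algebra borel"
    and \<pi>_invariant: "\<And>u. u \<in> {0..1} \<Longrightarrow> invariant_prob (Q u) (\<pi> u)"
    and \<pi>_unique: "\<And>u \<mu>. u \<in> {0..1} \<Longrightarrow> invariant_prob (Q u) \<mu> \<Longrightarrow> \<mu> = \<pi> u"
    and M_prob: "prob_space M"
    and X_markov: "\<And>n. n \<ge> 1 \<Longrightarrow>
          markov_chain M n (X n) (\<pi> 0) (\<lambda>t. Q (real t / real n))"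
    and \<phi>_measurable: "\<phi> \<in> borel_measurable borel"
    and \<phi>_ge_1: "\<And>x. 1 \<le> \<phi> x"
    \<comment> \<open>SC1\<close>
    and SC1_constants: "m \<ge> 1" "d0 \<ge> 1" "\<epsilon> > 0" "K > 0" "0 < lam" "lam < 1" "b > 0"
    and SC1_\<eta>: "\<And>r. r > 0 \<Longrightarrow> \<eta> r > 0"
    and SC1_\<nu>: "\<And>r. r > 0 \<Longrightarrow> \<nu> r \<in> space (prob_algebra borel)"
    and SC1_drift: "\<And>us x. length us = m \<Longrightarrow> set us \<subseteq> {0..1} \<Longrightarrow>
          (\<forall>v\<in>set us. \<forall>w\<in>set us. \<bar>v - w\<bar> < \<epsilon>) \<Longrightarrow>
          (\<integral>\<^sup>+ y. ennreal (\<phi> y powr d0) \<partial>kernel_prod Q us x) \<le> ennreal (lam * \<phi> x powr d0 + b)"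
    and SC1_minorization: "\<And>r us x A. r > 0 \<Longrightarrow> length us = m \<Longrightarrow> set us \<subseteq> {0..1} \<Longrightarrow>
          (\<forall>v\<in>set us. \<forall>w\<in>set us. \<bar>v - w\<bar> < \<epsilon>) \<Longrightarrow>
          \<phi> x powr d0 \<le> r \<Longrightarrow> A \<in> sets borel \<Longrightarrow>
          ennreal (\<eta> r) * emeasure (\<nu> r) A \<le> emeasure (kernel_prod Q us x) A"
    and SC1_growth: "\<And>u x. u \<in> {0..1} \<Longrightarrow>
          (\<integral>\<^sup>+ y. ennreal (\<phi> y powr d0) \<partial>Q u x) \<le> ennreal (K * \<phi> x powr d0)"
    \<comment> \<open>SC2: \<open>D l\<close> is the derivative of order \<open>l\<close> of \<open>f\<close> in its first argument\<close>
    and SC2_k: "k \<ge> 1"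
    and SC2_0: "\<And>u x y. u \<in> {0..1} \<Longrightarrow> D 0 u x y = f u x y"
    and SC2_deriv: "\<And>l u x y. l < k \<Longrightarrow> u \<in> {0..1} \<Longrightarrow>
          ((\<lambda>v. D l v x y) has_real_derivative D (Suc l) u x y) (at u within {0..1})"
    and SC2_continuous: "\<And>x y. continuous_on {0..1} (\<lambda>u. D k u x y)"
    \<comment> \<open>SC3\<close>
    and SC3_constants: "d1 > 0" "q \<ge> 0" "C > 0" "d1 + real k * q \<le> d0"
    and SC3_bound: "\<And>l d u x. 1 \<le> l \<Longrightarrow> l \<le> k \<Longrightarrow> 0 \<le> d \<Longrightarrow> d \<le> d1 + real (k - l) * q \<Longrightarrow>
          u \<in> {0..1} \<Longrightarrow>
          (\<integral>\<^sup>+ y. ennreal (\<phi> y powr d * \<bar>D l u x y\<bar>) \<partial>\<gamma> x) \<le> ennreal (C * \<phi> x powr (d + q * real l))"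
    and SC3_limit: "\<And>s u x. s \<le> k \<Longrightarrow> u \<in> {0..1} \<Longrightarrow>
          ((\<lambda>v. \<integral>\<^sup>+ y. ennreal (\<phi> y powr (d1 + q * real s) * \<bar>D (k - s) v x y - D (k - s) u x y\<bar>) \<partial>\<gamma> x)
             \<longlongrightarrow> 0) (at u within {0..1})"
  shows "locally_stationary (\<lambda>x. \<phi> x powr d1) M X (\<lambda>u. path_law (\<pi> u) (Q u)) \<and>
         (\<forall>j\<ge>1. weighted_C_k (pow_space j) (sum_weight (\<lambda>x. \<phi> x powr d1) j) k
            (\<lambda>u. measure (path_law (\<pi> u) (Q u) j)))"
proof -
  interpret M: prob_space M by fact
  \<comment> \<open>\<open>C\<close> serves the derivatives and \<open>K\<close> the kernel itself;
    the entry 1 ensures \<open>K powr r \<le> C0\<close> for every \<open>r\<close> between 0 and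
    1.\<close>
  define C0 where "C0 = max C (max 1 K)"
  have C0: "C \<le> C0" "1 \<le> C0" "K \<le> C0" by (auto simp: C0_def)
  have f_section: "f u x \<in> borel_measurable borel" if "u \<in> {0..1}" for u x
  proof -
    have "(\<lambda>y. (u, x, y)) \<in> borel \<rightarrow>\<^sub>M restrict_space borel {0..1} \<Otimes>\<^sub>M borel \<Otimes>\<^sub>M borel"
      using that by (intro measurable_Pair measurable_const) (auto simp: space_restrict_space)
    from measurable_compose[OF this f_measurable] show ?thesis by simp
  qed
  have D0: "D 0 u x = f u x" if "u \<in> {0..1}" for u x
    using SC2_0[OF that] by (intro ext)
  have D_bound: "(\<integral>\<^sup>+ y. ennreal (\<phi> y powr d * \<bar>D l u x y\<bar>) \<partial>\<gamma> x) \<le> ennreal (C0 * \<phi> x powr (d + q * real l))"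
    if l: "l \<le> k" and d: "0 \<le> d" "d \<le> d1 + q * real (k - l)" and u: "u \<in> {0..1}" for l d u x
  proof (cases "l = 0")
    case False
    then have "(\<integral>\<^sup>+ y. ennreal (\<phi> y powr d * \<bar>D l u x y\<bar>) \<partial>\<gamma> x) \<le> ennreal (C * \<phi> x powr (d + q * real l))"
      using l d u by (intro SC3_bound) (auto simp: mult.commute)
    also have "\<dots> \<le> ennreal (C0 * \<phi> x powr (d + q * real l))"
      using C0(1) by (intro ennreal_leI mult_right_mono) auto
    finally show ?thesis .
  next
    case True
    \<comment> \<open>For order 0 the bound comes from the growth condition at the exponent
      \<open>d0\<close>: Jensen's inequality for the power \<open>r = d / d0\<close> lowers it to
      \<open>d\<close>.\<close>
    define r where "r = d / d0"
    have d0: "d0 > 0" "d \<le> d0" using SC1_constants(2) SC3_constants(4) d True by (auto simp: mult.commute)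
    then have r: "0 \<le> r" "r \<le> 1" "d0 * r = d" using d by (auto simp: r_def)
    have pos: "0 < \<phi> y powr d0" for y using \<phi>_ge_1[of y] by simp
    have Qs: "sets (Q u x) = sets borel" "prob_space (Q u x)"
      using measurable_space[OF Q_markov[OF u], of x] by (auto simp: space_prob_algebra)
    have sets_\<gamma>: "sets (\<gamma> x) = sets borel" using kernel_\<gamma> by (simp add: measure_kernel_def)
    have fm: "f u x \<in> borel_measurable (\<gamma> x)" "(\<lambda>y. \<phi> y powr d) \<in> borel_measurable (\<gamma> x)"
      "(\<lambda>y. \<phi> y powr d0) \<in> borel_measurable (Q u x)"
      using f_section[OF u, of x] \<phi>_measurable
        measurable_cong_sets[OF sets_\<gamma> refl, of borel] measurable_cong_sets[OF Qs(1) refl, of borel] by auto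
    have "(\<integral>\<^sup>+ y. ennreal (\<phi> y powr d * \<bar>D l u x y\<bar>) \<partial>\<gamma> x) = (\<integral>\<^sup>+ y. ennreal (f u x y) * ennreal (\<phi> y powr d) \<partial>\<gamma> x)"
      using f_nonneg[OF u] by (intro nn_integral_cong) (simp add: True D0[OF u] ennreal_mult[symmetric] mult.commute)
    also have "\<dots> = (\<integral>\<^sup>+ y. ennreal (\<phi> y powr d) \<partial>Q u x)"
      unfolding Q_density[OF u] using fm by (intro nn_integral_density[symmetric]) auto
    also have "\<dots> = (\<integral>\<^sup>+ y. ennreal ((\<phi> y powr d0) powr r) \<partial>Q u x)"
      by (simp add: powr_powr r)
    also have "\<dots> \<le> ennreal ((K * \<phi> x powr d0) powr r)"
      using pos SC1_constants(4) by (intro nn_integral_powr_le[OF Qs(2) fm(3) pos _ SC1_growth[OF u]] r) auto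
    also have "\<dots> \<le> ennreal (C0 * \<phi> x powr (d + q * real l))"
    proof (rule ennreal_leI)
      have "K powr r \<le> C0 powr r" using SC1_constants(4) C0 r by (intro powr_mono2) auto
      also have "\<dots> \<le> C0 powr 1" using C0 r by (intro powr_mono) auto
      finally have "K powr r \<le> C0" using C0 by simp
      then show "(K * \<phi> x powr d0) powr r \<le> C0 * \<phi> x powr (d + q * real l)"
        using SC1_constants(4) by (simp add: powr_mult powr_powr r True mult_right_mono)
    qed
    finally show ?thesis .
  qed
  interpret ergodic_array \<gamma> Q D \<phi> k d1 q C0 \<pi> m d0 \<epsilon> lam b \<eta> \<nu> M X
  proof
    show "sets (\<gamma> x) = sets borel" for x using kernel_\<gamma> by (simp add: measure_kernel_def)
    show "D 0 u x \<in> borel_measurable borel" if "u \<in> {0..1}" for u x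
      using f_section[OF that] by (simp add: D0[OF that])
    show "0 \<le> D 0 u x y" if "u \<in> {0..1}" for u x y
      using f_nonneg[OF that] by (simp add: D0[OF that])
    show "Q u x = density (\<gamma> x) (\<lambda>y. ennreal (D 0 u x y))" if "u \<in> {0..1}" for u x
      by (simp add: D0[OF that] Q_density[OF that])
    show "((\<lambda>v. \<integral>\<^sup>+ y. ennreal (\<phi> y powr (d1 + q * real (k - l)) * \<bar>D l v x y - D l u x y\<bar>) \<partial>\<gamma> x) \<longlongrightarrow> 0)
        (at u within {0..1})" if "l \<le> k" "u \<in> {0..1}" for l u x
      \<comment> \<open>The hypothesis is indexed by \<open>s = k - l\<close>, the number of
        derivatives below the top order.\<close>
      using SC3_limit[of "k - l" u x] that by simp
    show "d1 + q * real k \<le> d0" using SC3_constants(4) by (simp add: mult.commute)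
  qed (fact Q_markov \<phi>_measurable \<phi>_ge_1 SC2_deriv SC2_continuous D_bound SC2_k \<pi>_invariant SC1_constants
      SC1_\<eta> SC1_\<nu> SC1_drift SC1_minorization M_prob X_markov SC3_constants
    | use SC3_constants C0 in simp)+
  have V: "weight 0 = (\<lambda>x. \<phi> x powr d1)" by (simp add: weight_def deg_def fun_eq_iff)
  have "weighted_C_k (pow_space j) (sum_weight (\<lambda>x. \<phi> x powr d1) j) k (\<lambda>u. measure (path_law (\<pi> u) (Q u) j))"
    if "j \<ge> 1" for j
    using stationary_law_C_k[of "j - 1"] that by (simp add: path_weight_def V del: path_law.simps)
  then show ?thesis using array_locally_stationary unfolding V by blast
qed

end
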